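(* Let $\Omega\subset\mathbb R^n$ be open, let $f\in W^{1,p}_{\rm loc}(\Omega,\mathbb R^m)$ with $n<p\le\infty$, and let $$\tilde\Omega=\{x\in\Omega\mid\text{there is a representative }\tilde f\text{ of }f\text{ that is differentiable at }x\}.$$ Then $\mathcal L^n(\Omega\setminus\tilde\Omega)=0$ and $f$ is (precisely) differentiable at any $x\in\tilde\Omega$ with $$\mathrm{pr}f(x)=f^\star(x)=\operatorname*{ess\,lim}_{y\to x}f(y)=\int_\Omega f\,d\,\mathrm{dens}_x\quad\text{for all }\mathrm{dens}_x\in\mathrm{Dens}_x$$ and $$Df(x)=(Df)^\star(x).$$ For $\mathcal L^n$-a.e. $x\in\tilde\Omega$ one has $$Df(x)=\mathrm{pr}(Df)(x)=\int_\Omega Df\,d\,\mathrm{dens}_x^\Omega\quad\text{for all }\mathrm{dens}_x^\Omega\in\mathcal L^n\text{-}\mathrm{Dens}_x^\Omega .\qquad( * )$$ In particular, $( * )$ is valid for every $x\in\tilde\Omega$ for which $Df\in L^\infty(B_{\tilde\delta}(x),\mathbb R^{m\times n})$ for some $\tilde\delta>0$.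
   Context: $\mathcal L^n$ is Lebesgue measure, $\mathcal B(\Omega)$ the Borel subsets of $\Omega$. $W^{1,p}_{\rm loc}(\Omega,\mathbb R^m)$ is the usual local Sobolev space, consisting of classes of $\mathcal L^n$-a.e. equal functions. $\mathrm{ba}(\Omega,\mathcal B(\Omega),\mathcal L^n)$ is the space of bounded finitely additive set functions $\mu:\mathcal B(\Omega)\to\mathbb R$ with $\mu(A)=0$ whenever $\mathcal L^n(A)=0$. Integral: for $\mu\ge0$ in this space put $\mu^*(A)=\inf\{\mu(B):A\subset B\in\mathcal B(\Omega)\}$. A function $g:\Omega\to\mathbb R$ is $\mu$-integrable if there are Borel step functions $h_k$ with $\mu^*(\{|h_k-g|>\varepsilon\})\to0$ for all $\varepsilon>0$ and $\int_\Omega|h_k-h_l|\,d\mu\to0$; then $\int_\Omega g\,d\mu=\lim_k\int_\Omega h_k\,d\mu$. This depends only on the $\mathcal L^n$-a.e. class of $g$; vector and matrix functions are treated componentwise. For $x\in\Omega$: $\mathrm{Dens}_x$ is the set of $\mu\in\mathrm{ba}(\Omega,\mathcal B(\Omega),\mathcal L^n)$ with $\mu\ge0$ and $\mu(B_\delta(x)\cap\Omega)=\mu(\Omega)=1$ for all $\delta>0$; $\mathcal L^n\text{-}\mathrm{Dens}_x^\Omega$ is the set of all $\mu\in\mathrm{ba}(\Omega,\mathcal B(\Omega),\mathcal L^n)$ with $$\liminf_{\delta\downarrow0}\frac{\mathcal L^n(A\cap\Omega\cap B_\delta(x))}{\mathcal L^n(\Omega\cap B_\delta(x))}\le\mu(A)\le\limsup_{\delta\downarrow0}\frac{\mathcal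 L^n(A\cap\Omega\cap B_\delta(x))}{\mathcal L^n(\Omega\cap B_\delta(x))}\quad\forall A\in\mathcal B(\Omega).$$ For a locally integrable $g$ (class) and $x\in\Omega$: $g^\star(x)=\lim_{\delta\downarrow0}\frac1{\mathcal L^n(B_\delta(x)\cap\Omega)}\int_{B_\delta(x)\cap\Omega}g\,d\mathcal L^n$ if the limit exists; $\mathrm{pr}g(x)=\int_\Omega g\,d\,\mathrm{dens}_x^\Omega$ for a selected $\mathrm{dens}_x^\Omega\in\mathcal L^n\text{-}\mathrm{Dens}_x^\Omega$ for which the integral exists ("exists as integral"). $\operatorname{ess\,lim}_{y\to x}g(y)=\beta$ means $\lim_{\delta\downarrow0}\operatorname{ess\,sup}_{B_\delta(x)\cap\Omega}|g-\beta|=0$. A representative $\tilde f:\Omega\to\mathbb R^m$ is differentiable at $x$ if for some $\alpha\in\mathbb R^m$ and linear $L$ one has $\lim_{y\to x,y\ne x}\frac{\tilde f(y)-\alpha-L(y-x)}{|y-x|}=0$ ($\alpha$ need not be $\tilde f(x)$). The class $f$ is (precisely) differentiable at $x\in\Omega$ with (precise) derivative $Df(x):=L$ if $\mathrm{pr}f$ exists as integral on a ball around $x$ and, for some $\alpha\in\mathbb R^m$ and some selection of the measures defining $\mathrm{pr}f$, $\lim_{y\to x,\,y\in\Omega,\,y\ne x}\frac{\mathrm{pr}f(y)-\alpha-L(y-x)}{|y-x|}=0$. $Df$ as a function is the map $x\mapsto Df(x)$, defined $\mathcal L^n$-a.e. on $\Omega$ (it agrees $\mathcal L^n$-a.e.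 with the weak derivative). *)

theory Defs
  imports "HOL-Analysis.Analysis" "HOL-Probability.Essential_Supremum"
begin

section \<open>Local Sobolev spaces\<close>

text \<open>
  Classes of almost everywhere equal functions are given by an arbitrary representative, a total
  function on the whole space whose values outside \<open>\<Omega>\<close> are never used.
\<close>

definition in_Lp :: "ennreal \<Rightarrow> 'a::euclidean_space set \<Rightarrow> ('a \<Rightarrow> 'b::euclidean_space) \<Rightarrow> bool" where
  "in_Lp p S g \<longleftrightarrow> g \<in> borel_measurable (lebesgue_on S) \<and>
     (if p = \<infinity> then esssup (lebesgue_on S) (\<lambda>x. ereal (norm (g x))) < \<infinity>
      else integrable (lebesgue_on S) (\<lambda>x. norm (g x) powr enn2real p))"

definition in_Lp_loc :: "ennreal \<Rightarrow> 'a::euclidean_space set \<Rightarrow> ('a \<Rightarrow> 'b::euclidean_space) \<Rightarrow> bool" where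
  "in_Lp_loc p \<Omega> g \<longleftrightarrow> (\<forall>K. compact K \<and> K \<subseteq> \<Omega> \<longrightarrow> in_Lp p K g)"

definition locally_integrable :: "'a::euclidean_space set \<Rightarrow> ('a \<Rightarrow> 'b::euclidean_space) \<Rightarrow> bool" where
  "locally_integrable \<Omega> g \<longleftrightarrow> (\<forall>K. compact K \<and> K \<subseteq> \<Omega> \<longrightarrow> integrable (lebesgue_on K) g)"

definition partial_deriv :: "'n \<Rightarrow> (real^'n \<Rightarrow> real) \<Rightarrow> real^'n \<Rightarrow> real" where
  "partial_deriv j \<phi> x = frechet_derivative \<phi> (at x) (axis j 1)"

primrec C_times :: "nat \<Rightarrow> (real^'n \<Rightarrow> real) \<Rightarrow> bool" where
  "C_times 0 \<phi> \<longleftrightarrow> continuous_on UNIV \<phi>"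
| "C_times (Suc k) \<phi> \<longleftrightarrow> \<phi> differentiable_on UNIV \<and> (\<forall>j. C_times k (partial_deriv j \<phi>))"

definition test_function :: "(real^'n) set \<Rightarrow> (real^'n \<Rightarrow> real) \<Rightarrow> bool" where
  "test_function \<Omega> \<phi> \<longleftrightarrow> (\<forall>k. C_times k \<phi>) \<and>
     compact (closure {x. \<phi> x \<noteq> 0}) \<and> closure {x. \<phi> x \<noteq> 0} \<subseteq> \<Omega>"

text \<open>\<open>G x $ i $ j\<close> is the weak partial derivative of the \<open>i\<close>-th component in direction \<open>j\<close>.\<close>

definition weak_derivative ::
    "(real^'n) set \<Rightarrow> (real^'n \<Rightarrow> real^'m) \<Rightarrow> (real^'n \<Rightarrow> real^'n^'m) \<Rightarrow> bool" where
  "weak_derivative \<Omega> f G \<longleftrightarrow> locally_integrable \<Omega> f \<and> locally_integrable \<Omega> G \<and>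
     (\<forall>\<phi> i j. test_function \<Omega> \<phi> \<longrightarrow>
        (\<integral>x. f x $ i * partial_deriv j \<phi> x \<partial>lebesgue_on \<Omega>)
          = - (\<integral>x. G x $ i $ j * \<phi> x \<partial>lebesgue_on \<Omega>))"

definition in_W1p_loc :: "ennreal \<Rightarrow> (real^'n) set \<Rightarrow> (real^'n \<Rightarrow> real^'m) \<Rightarrow> bool" where
  "in_W1p_loc p \<Omega> f \<longleftrightarrow> in_Lp_loc p \<Omega> f \<and> (\<exists>G. weak_derivative \<Omega> f G \<and> in_Lp_loc p \<Omega> G)"


section \<open>Finitely additive set functions and their integral\<close>

abbreviation borel_subsets :: "'a::euclidean_space set \<Rightarrow> 'a set set" where
  "borel_subsets \<Omega> \<equiv> sets (restrict_space borel \<Omega>)"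

text \<open>Set functions are total; only their values on \<^term>\<open>borel_subsets \<Omega>\<close> matter.\<close>

definition ba :: "'a::euclidean_space set \<Rightarrow> ('a set \<Rightarrow> real) set" where
  "ba \<Omega> = {\<mu>. (\<exists>C. \<forall>A\<in>borel_subsets \<Omega>. \<bar>\<mu> A\<bar> \<le> C) \<and>
     additive (borel_subsets \<Omega>) \<mu> \<and>
     (\<forall>A\<in>borel_subsets \<Omega>. emeasure lborel A = 0 \<longrightarrow> \<mu> A = 0)}"

definition ba_outer :: "'a::euclidean_space set \<Rightarrow> ('a set \<Rightarrow> real) \<Rightarrow> 'a set \<Rightarrow> real" where
  "ba_outer \<Omega> \<mu> A = (INF B\<in>{B \<in> borel_subsets \<Omega>. A \<subseteq> B}. \<mu> B)"

definition step_integral :: "'a::euclidean_space set \<Rightarrow> ('a set \<Rightarrow> real) \<Rightarrow> ('a \<Rightarrow> real) \<Rightarrow> real" where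
  "step_integral \<Omega> \<mu> h = (\<Sum>v\<in>h ` \<Omega>. v * \<mu> (h -` {v} \<inter> \<Omega>))"

text \<open>The integral is only meant for nonnegative \<open>\<mu>\<close>.\<close>

definition has_ba_integral_real ::
    "'a::euclidean_space set \<Rightarrow> ('a set \<Rightarrow> real) \<Rightarrow> ('a \<Rightarrow> real) \<Rightarrow> real \<Rightarrow> bool" where
  "has_ba_integral_real \<Omega> \<mu> g I \<longleftrightarrow> (\<exists>h :: nat \<Rightarrow> 'a \<Rightarrow> real.
     (\<forall>k. simple_function (restrict_space borel \<Omega>) (h k)) \<and>
     (\<forall>\<epsilon>>0. (\<lambda>k. ba_outer \<Omega> \<mu> {x\<in>\<Omega>. \<bar>h k x - g x\<bar> > \<epsilon>}) \<longlonglongrightarrow> 0) \<and>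
     ((\<lambda>(k, l). step_integral \<Omega> \<mu> (\<lambda>x. \<bar>h k x - h l x\<bar>)) \<longlongrightarrow> 0) (sequentially \<times>\<^sub>F sequentially) \<and>
     (\<lambda>k. step_integral \<Omega> \<mu> (h k)) \<longlonglongrightarrow> I)"

text \<open>
  For vector and matrix valued functions the integral is componentwise: the inner products with
  the elements of \<^const>\<open>Basis\<close> are the entries.
\<close>

definition has_ba_integral ::
    "'a::euclidean_space set \<Rightarrow> ('a set \<Rightarrow> real) \<Rightarrow> ('a \<Rightarrow> 'b::euclidean_space) \<Rightarrow> 'b \<Rightarrow> bool" where
  "has_ba_integral \<Omega> \<mu> g I \<longleftrightarrow> (\<forall>b\<in>Basis. has_ba_integral_real \<Omega> \<mu> (\<lambda>x. g x \<bullet> b) (I \<bullet> b))"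

definition ba_integrable ::
    "'a::euclidean_space set \<Rightarrow> ('a set \<Rightarrow> real) \<Rightarrow> ('a \<Rightarrow> 'b::euclidean_space) \<Rightarrow> bool" where
  "ba_integrable \<Omega> \<mu> g \<longleftrightarrow> (\<exists>I. has_ba_integral \<Omega> \<mu> g I)"

definition ba_integral ::
    "'a::euclidean_space set \<Rightarrow> ('a set \<Rightarrow> real) \<Rightarrow> ('a \<Rightarrow> 'b::euclidean_space) \<Rightarrow> 'b" where
  "ba_integral \<Omega> \<mu> g = (THE I. has_ba_integral \<Omega> \<mu> g I)"


section \<open>Density measures, precise values and precise derivatives\<close>

definition Dens :: "'a::euclidean_space set \<Rightarrow> 'a \<Rightarrow> ('a set \<Rightarrow> real) set" where
  "Dens \<Omega> x = {\<mu> \<in> ba \<Omega>. (\<forall>A\<in>borel_subsets \<Omega>. 0 \<le> \<mu> A) \<and>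
     (\<forall>\<delta>>0. \<mu> (ball x \<delta> \<inter> \<Omega>) = 1) \<and> \<mu> \<Omega> = 1}"

definition density_ratio :: "'a::euclidean_space set \<Rightarrow> 'a \<Rightarrow> 'a set \<Rightarrow> real \<Rightarrow> real" where
  "density_ratio \<Omega> x A \<delta> = measure lborel (A \<inter> \<Omega> \<inter> ball x \<delta>) / measure lborel (\<Omega> \<inter> ball x \<delta>)"

definition Ln_Dens :: "'a::euclidean_space set \<Rightarrow> 'a \<Rightarrow> ('a set \<Rightarrow> real) set" where
  "Ln_Dens \<Omega> x = {\<mu> \<in> ba \<Omega>. \<forall>A\<in>borel_subsets \<Omega>.
     Liminf (at_right 0) (\<lambda>\<delta>. ereal (density_ratio \<Omega> x A \<delta>)) \<le> ereal (\<mu> A) \<and>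
     ereal (\<mu> A) \<le> Limsup (at_right 0) (\<lambda>\<delta>. ereal (density_ratio \<Omega> x A \<delta>))}"

definition has_star_value ::
    "'a::euclidean_space set \<Rightarrow> ('a \<Rightarrow> 'b::euclidean_space) \<Rightarrow> 'a \<Rightarrow> 'b \<Rightarrow> bool" where
  "has_star_value \<Omega> g x \<beta> \<longleftrightarrow> locally_integrable \<Omega> g \<and>
     ((\<lambda>\<delta>. (1 / measure lebesgue (ball x \<delta> \<inter> \<Omega>)) *\<^sub>R
            integral\<^sup>L (lebesgue_on (ball x \<delta> \<inter> \<Omega>)) g) \<longlongrightarrow> \<beta>) (at_right 0)"

definition has_ess_lim ::
    "'a::euclidean_space set \<Rightarrow> ('a \<Rightarrow> 'b::euclidean_space) \<Rightarrow> 'a \<Rightarrow> 'b \<Rightarrow> bool" where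
  "has_ess_lim \<Omega> g x \<beta> \<longleftrightarrow>
     ((\<lambda>\<delta>. esssup (lebesgue_on (ball x \<delta> \<inter> \<Omega>)) (\<lambda>y. ereal (norm (g y - \<beta>)))) \<longlongrightarrow> 0) (at_right 0)"

text \<open>
  The precise value \<open>pr g(x)\<close> is the integral of \<open>g\<close> with respect to a selected element of
  \<^term>\<open>Ln_Dens \<Omega> x\<close> for which that integral exists. \<open>has_pr_value \<Omega> g x \<beta>\<close> says that such
  a selection is possible and that \<open>pr g(x) = \<beta>\<close> for every possible selection.
\<close>

definition has_pr_value ::
    "'a::euclidean_space set \<Rightarrow> ('a \<Rightarrow> 'b::euclidean_space) \<Rightarrow> 'a \<Rightarrow> 'b \<Rightarrow> bool" where
  "has_pr_value \<Omega> g x \<beta> \<longleftrightarrow> (\<exists>\<mu>\<in>Ln_Dens \<Omega> x. ba_integrable \<Omega> \<mu> g) \<and>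
     (\<forall>\<mu>\<in>Ln_Dens \<Omega> x. ba_integrable \<Omega> \<mu> g \<longrightarrow> ba_integral \<Omega> \<mu> g = \<beta>)"

text \<open>The value of \<open>\<alpha>\<close> need not be \<open>g x\<close>.\<close>

definition first_order_expansion ::
    "(real^'n) set \<Rightarrow> (real^'n \<Rightarrow> real^'m) \<Rightarrow> real^'n \<Rightarrow> real^'m \<Rightarrow> real^'n^'m \<Rightarrow> bool" where
  "first_order_expansion \<Omega> g x \<alpha> L \<longleftrightarrow>
     ((\<lambda>y. (g y - \<alpha> - L *v (y - x)) /\<^sub>R norm (y - x)) \<longlongrightarrow> 0) (at x within \<Omega>)"

definition diff_points :: "(real^'n) set \<Rightarrow> (real^'n \<Rightarrow> real^'m) \<Rightarrow> (real^'n) set" where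
  "diff_points \<Omega> f = {x\<in>\<Omega>. \<exists>g. (AE y in lebesgue_on \<Omega>. g y = f y) \<and>
     (\<exists>\<alpha> L. first_order_expansion \<Omega> g x \<alpha> L)}"

text \<open>Below, \<open>d\<close> is the selection of density measures that defines \<open>pr f\<close>.\<close>

definition has_precise_derivative ::
    "(real^'n) set \<Rightarrow> (real^'n \<Rightarrow> real^'m) \<Rightarrow> real^'n \<Rightarrow> real^'n^'m \<Rightarrow> bool" where
  "has_precise_derivative \<Omega> f x L \<longleftrightarrow> (\<exists>r>0. \<exists>d \<alpha>.
     (\<forall>y\<in>ball x r \<inter> \<Omega>. d y \<in> Ln_Dens \<Omega> y \<and> ba_integrable \<Omega> (d y) f) \<and>
     first_order_expansion \<Omega> (\<lambda>y. ba_integral \<Omega> (d y) f) x \<alpha> L)"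

definition precise_derivative ::
    "(real^'n) set \<Rightarrow> (real^'n \<Rightarrow> real^'m) \<Rightarrow> real^'n \<Rightarrow> real^'n^'m" where
  "precise_derivative \<Omega> f x = (THE L. has_precise_derivative \<Omega> f x L)"

end

theory Submission
  imports Defs "HOL-Computational_Algebra.Polynomial"
begin

text \<open>
  Let \<open>\<eta>\<close> be a smooth radial bump and \<open>u (y, s)\<close> the mean of \<open>f\<close> against \<open>\<eta>\<close> centred at \<open>y\<close> with
  radius \<open>s\<close>. Along a segment of pairs \<open>(y, s)\<close> the rescaled bumps satisfy a continuity equation, so
  that the derivative of \<open>u\<close> is an average of the weak derivative \<open>G\<close>. Since \<open>G\<close> is locally
  \<open>p\<close>-integrable and \<open>p > n\<close>, letting \<open>s \<rightarrow> 0\<close> gives a continuous representative together with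
  Morrey's estimate. Applied to \<open>f - G x (\<cdot> - x)\<close>, the estimate shows differentiability at all
  Lebesgue points \<open>x\<close> of order \<open>p\<close> of \<open>G\<close>, i.e. almost everywhere.

  At any point of differentiability, testing the weak derivative with radially decreasing cutoffs
  of a ball shows that the means of \<open>G\<close> over balls converge to the derivative. A density measure
  integrates a function that is essentially constant near \<open>x\<close> in measure to that constant, which
  settles the claims on \<open>f\<close> and those on \<open>Df\<close> at Lebesgue points. For bounded \<open>Df\<close> one needs that
  the bounds defining a density measure, which concern sets only, extend to means of bounded functions;
  this follows by splitting sets into halves of asymptotically equal density at \<open>x\<close>.
\<close>

section \<open>Smooth bump functions\<close>

text \<open>The condition \<open>p > n\<close> works through one exponent: by Hoelder the integral
  of \<open>norm (G z)\<close> over a ball of radius \<open>t\<close> is of order \<open>t\<close>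
  to the power \<open>n - n / p\<close>, so the radial derivative of the mean is of order
  \<open>t\<close> to the power \<open>- n / p\<close>, which is integrable at 0 exactly when
  \<open>p > n\<close>. A point of differentiability need not be a Lebesgue point of
  \<open>G\<close>. The means of \<open>G\<close> still converge there, but \<open>G\<close> need
  not be close to the limit off a set of density zero, so the argument for almost every point breaks
  down; hence the separate treatment of bounded \<open>Df\<close>. A density measure is not known to
  split a set in the ratio of its halves, so each half is used in both roles and the unknown term
  cancels. The selection of density measures is arbitrary, so each value is computed for all of them
  at once, and the existence of one is a separate compactness argument.
  \<open>precise_derivative\<close> is a definite description; its uniqueness comes from comparing
  every selection with the continuous representative.\<close>

primrec bump_poly :: "nat \<Rightarrow> real poly" where
  "bump_poly 0 = 1"
| "bump_poly (Suc k) = monom 1 2 * (bump_poly k - pderiv (bump_poly k))"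

text \<open>This is the \<open>k\<close>-th derivative of \<open>exp (- (1/t))\<close>, extended by
  0 to \<open>t \<le> 0\<close>. Differentiating \<open>P(1/t) * exp (- (1/t))\<close> produces
  \<open>(1/t)^2 * (P - P')(1/t) * exp (- (1/t))\<close>, which is the recursion of
  \<open>bump_poly\<close>.\<close>

definition rho :: "nat \<Rightarrow> real \<Rightarrow> real" where
  "rho k t = (if t > 0 then poly (bump_poly k) (1/t) * exp (- (1/t)) else 0)"

lemma poly_times_exp_tendsto_0: "((\<lambda>x::real. poly p x * exp (- x)) \<longlongrightarrow> 0) at_top"
proof -
  have "((\<lambda>x::real. \<Sum>i\<le>degree p. coeff p i * (x ^ i / exp x)) \<longlongrightarrow> (\<Sum>i\<le>degree p. coeff p i * 0)) at_top"
    by (intro tendsto_intros tendsto_power_div_exp_0)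
  then show ?thesis
    by (simp add: poly_altdef exp_minus field_simps sum_distrib_right sum_distrib_left)
qed

lemma DERIV_rho: "(rho k has_real_derivative rho (Suc k) t) (at t)"
proof -
  consider "t > 0" | "t < 0" | "t = 0" by linarith
  then show ?thesis
  proof cases
    case 1
    have "((\<lambda>t. poly (bump_poly k) (1/t) * exp (- (1/t))) has_real_derivative rho (Suc k) t) (at t)"
      using 1 unfolding rho_def
      by (auto intro!: derivative_eq_intros simp: poly_monom algebra_simps power2_eq_square power_divide)
    then show ?thesis
      by (rule has_field_derivative_transform_within_open[of _ _ _ "{0<..}"]) (use 1 in \<open>auto simp: rho_def\<close>)
  next
    case 2
    have "((\<lambda>t. 0) has_real_derivative rho (Suc k) t) (at t)"
      using 2 by (simp add: rho_def)
    then show ?thesis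
      by (rule has_field_derivative_transform_within_open[of _ _ _ "{..<0}"]) (use 2 in \<open>auto simp: rho_def\<close>)
  next
    case 3
    have "((\<lambda>h. rho k h / h) \<longlongrightarrow> 0) (at_right 0)"
    proof -
      \<comment> \<open>The factor \<open>1 / h\<close> of the difference quotient is absorbed into
        the polynomial; the exponential then beats both.\<close>
      have "((\<lambda>h::real. poly (monom 1 1 * bump_poly k) (inverse h) * exp (- inverse h)) \<longlongrightarrow> 0) (at_right 0)"
        using filterlim_compose[OF poly_times_exp_tendsto_0 filterlim_inverse_at_top_right] by blast
      moreover have "\<forall>\<^sub>F h in at_right 0. poly (monom 1 1 * bump_poly k) (inverse h) * exp (- inverse h) = rho k h / h"
        by (simp add: eventually_at_filter rho_def poly_monom divide_inverse)
      ultimately show ?thesis by (rule Lim_transform_eventually)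
    qed
    moreover have "((\<lambda>h. rho k h / h) \<longlongrightarrow> 0) (at_left 0)"
    proof (rule tendsto_eventually)
      show "\<forall>\<^sub>F h in at_left 0. rho k h / h = 0"
        by (auto simp: eventually_at_filter rho_def)
    qed
    ultimately have "((\<lambda>h. rho k h / h) \<longlongrightarrow> 0) (at 0)"
      by (simp add: filterlim_at_split)
    then show ?thesis
      using 3 by (simp add: DERIV_def rho_def)
  qed
qed

text \<open>Nonnegativity of \<open>rho 1\<close> says that \<open>rho 0\<close> is nondecreasing,
  so every \<open>bump\<close> is radially decreasing. This sign is what makes
  \<open>gradient_mean_bound\<close> work.\<close>

lemma rho_0_nonneg: "0 \<le> rho 0 t" and rho_0_le: "rho 0 t \<le> 1" and rho_1_nonneg: "0 \<le> rho 1 t"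
  by (auto simp: rho_def poly_monom)

lemma rho_0_pos: "0 < t \<Longrightarrow> 0 < rho 0 t"
  by (simp add: rho_def)

lemma rho_nonpos: "t \<le> 0 \<Longrightarrow> rho k t = 0"
  by (simp add: rho_def)

lemma continuous_on_rho: "continuous_on S (rho k)"
  by (meson DERIV_rho DERIV_isCont continuous_at_imp_continuous_on)

section \<open>Closure properties of the classes \<open>C_times\<close>\<close>

lemma partial_deriv_eq: "(\<phi> has_derivative \<phi>') (at x) \<Longrightarrow> partial_deriv j \<phi> x = \<phi>' (axis j 1)"
  by (metis frechet_derivative_at partial_deriv_def)

text \<open>The product rule leaves one factor undifferentiated; the induction in
  \<open>C_times_mult\<close> has to lower its level.\<close>

lemma C_times_mono: "C_times (Suc k) \<phi> \<Longrightarrow> C_times k \<phi>"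
proof (induction k arbitrary: \<phi>)
  case 0
  then show ?case by (auto intro: differentiable_imp_continuous_on)
next
  case (Suc k)
  then show ?case by (metis C_times.simps(2))
qed

lemma differentiable_frechet: "\<phi> differentiable_on UNIV \<Longrightarrow> (\<phi> has_derivative frechet_derivative \<phi> (at x)) (at x)"
  by (simp add: differentiable_on_def frechet_derivative_works)

lemma C_times_const: "C_times k (\<lambda>x::real^'n. c)"
proof (induction k arbitrary: c)
  case (Suc k)
  have "partial_deriv j (\<lambda>x::real^'n. c) = (\<lambda>x. 0)" for j
    by (rule ext, subst partial_deriv_eq[OF has_derivative_const]) simp
  then show ?case using Suc by simp
qed simp

lemma C_times_add: "C_times k \<phi> \<Longrightarrow> C_times k \<psi> \<Longrightarrow> C_times k (\<lambda>x. \<phi> x + \<psi> x)"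
proof (induction k arbitrary: \<phi> \<psi>)
  case 0
  then show ?case by (auto intro: continuous_intros)
next
  case (Suc k)
  have "partial_deriv j (\<lambda>x. \<phi> x + \<psi> x) = (\<lambda>x. partial_deriv j \<phi> x + partial_deriv j \<psi> x)" for j
    using Suc.prems
    by (intro ext, subst partial_deriv_eq[OF has_derivative_add[OF differentiable_frechet differentiable_frechet]])
      (auto simp: partial_deriv_def)
  then show ?case using Suc by (auto intro: derivative_intros)
qed

lemma C_times_mult: "C_times k \<phi> \<Longrightarrow> C_times k \<psi> \<Longrightarrow> C_times k (\<lambda>x. \<phi> x * \<psi> x)"
proof (induction k arbitrary: \<phi> \<psi>)
  case 0
  then show ?case by (auto intro: continuous_intros)
next
  case (Suc k)
  have "partial_deriv j (\<lambda>x. \<phi> x * \<psi> x) = (\<lambda>x. \<phi> x * partial_deriv j \<psi> x + partial_deriv j \<phi> x * \<psi> x)" for j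
    using Suc.prems
    by (intro ext, subst partial_deriv_eq[OF has_derivative_mult[OF differentiable_frechet differentiable_frechet]])
      (auto simp: partial_deriv_def)
  moreover have "C_times k (\<lambda>x. \<phi> x * partial_deriv j \<psi> x + partial_deriv j \<phi> x * \<psi> x)" for j
    using Suc C_times_mono by (intro C_times_add Suc.IH) auto
  ultimately show ?case using Suc.prems by (auto intro: derivative_intros)
qed

lemma C_times_component: "C_times k (\<lambda>x::real^'n. x $ i)"
proof (cases k)
  case (Suc l)
  have d: "((\<lambda>x. x $ i) has_derivative (\<lambda>x. x $ i)) (at x)" for x :: "real^'n"
    by (intro bounded_linear_imp_has_derivative bounded_linear_vec_nth)
  then have "partial_deriv j (\<lambda>x::real^'n. x $ i) = (\<lambda>x. axis j 1 $ i)" for j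
    by (rule_tac ext, subst partial_deriv_eq[OF d]) simp
  then show ?thesis
    using d by (auto simp: C_times_const Suc differentiable_on_def differentiable_def)
qed (auto intro: continuous_intros)

lemma C_times_sum: "(\<And>i. i \<in> I \<Longrightarrow> C_times k (\<phi> i)) \<Longrightarrow> C_times k (\<lambda>x. \<Sum>i\<in>I. \<phi> i x)"
  by (induction I rule: infinite_finite_induct) (auto intro: C_times_const C_times_add)

text \<open>The index \<open>i\<close> must be general: a partial derivative of \<open>rho i\<close>
  after \<open>\<phi>\<close> contains \<open>rho (Suc i)\<close> after \<open>\<phi>\<close>, to
  which the induction hypothesis is then applied.\<close>

lemma C_times_rho: "(\<And>l. C_times l \<phi>) \<Longrightarrow> C_times k (\<lambda>x. rho i (\<phi> x))"
proof (induction k arbitrary: i)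
  case 0
  have "continuous_on UNIV \<phi>" using 0[of 0] unfolding C_times.simps .
  from continuous_on_compose2[OF continuous_on_rho[of UNIV i] this] show ?case by simp
next
  case (Suc k)
  have \<phi>: "\<phi> differentiable_on UNIV" "C_times k (partial_deriv j \<phi>)" for j
    using Suc.prems[of "Suc k"] by auto
  have d: "((\<lambda>x. rho i (\<phi> x)) has_derivative (\<lambda>h. frechet_derivative \<phi> (at x) h * rho (Suc i) (\<phi> x))) (at x)" for x
    by (rule DERIV_compose_FDERIV[OF DERIV_rho differentiable_frechet[OF \<phi>(1)]])
  have "partial_deriv j (\<lambda>x. rho i (\<phi> x)) = (\<lambda>x. partial_deriv j \<phi> x * rho (Suc i) (\<phi> x))" for j
    by (rule ext, subst partial_deriv_eq[OF d]) (simp add: partial_deriv_def)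
  then show ?case
    using d Suc \<phi>(2) by (auto intro!: C_times_mult simp: differentiable_on_def differentiable_def)
qed

text \<open>The squared distance keeps the argument of \<open>rho 0\<close> polynomial, hence smooth
  at the centre too. The factor \<open>c\<close> has two uses: \<open>c = 1 / s\<^sup>2\<close> with
  \<open>r = s\<close> gives rescaled copies of one profile, while \<open>c\<close> tending to
  infinity at fixed \<open>r\<close> gives the indicator of the ball in the limit.\<close>

definition bump :: "real^'n \<Rightarrow> real \<Rightarrow> real \<Rightarrow> real^'n \<Rightarrow> real" where
  "bump y r c z = rho 0 (c * (r\<^sup>2 - (z - y) \<bullet> (z - y)))"

lemma has_derivative_bump:
  "(bump y r c has_derivative (\<lambda>h. - 2 * c * ((z - y) \<bullet> h) * rho 1 (c * (r\<^sup>2 - (z - y) \<bullet> (z - y))))) (at z)"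
proof -
  have *: "((\<lambda>z. c * (r\<^sup>2 - (z - y) \<bullet> (z - y))) has_derivative (\<lambda>h. - 2 * c * ((z - y) \<bullet> h))) (at z)"
    by (auto intro!: derivative_eq_intros simp: inner_commute algebra_simps)
  show ?thesis
    unfolding bump_def[abs_def] using DERIV_compose_FDERIV[OF DERIV_rho *, of 0] by simp
qed

lemma partial_deriv_bump:
  "partial_deriv j (bump y r c) z = - 2 * c * (z $ j - y $ j) * rho 1 (c * (r\<^sup>2 - (z - y) \<bullet> (z - y)))"
  by (subst partial_deriv_eq[OF has_derivative_bump]) (simp add: inner_axis)

lemma C_times_bump: "C_times k (bump y r c)"
proof -
  have "C_times l (\<lambda>z. c * (r\<^sup>2 + (\<Sum>i\<in>UNIV. (- 1) * ((z $ i + - y $ i) * (z $ i + - y $ i)))))" for l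
    by (intro C_times_mult C_times_add C_times_const C_times_sum C_times_component)
  then have "C_times k (\<lambda>z. rho 0 (c * (r\<^sup>2 + (\<Sum>i\<in>UNIV. (- 1) * ((z $ i + - y $ i) * (z $ i + - y $ i))))))"
    by (rule C_times_rho)
  then show ?thesis
    by (simp add: bump_def[abs_def] inner_vec_def sum_negf)
qed

lemma bump_eq_0: "0 \<le> r \<Longrightarrow> 0 < c \<Longrightarrow> z \<notin> ball y r \<Longrightarrow> bump y r c z = 0"
  and bump_pos: "0 < c \<Longrightarrow> z \<in> ball y r \<Longrightarrow> 0 < bump y r c z"
proof -
  have [simp]: "(z - y) \<bullet> (z - y) = (dist y z)\<^sup>2"
    by (metis dist_norm dist_commute power2_norm_eq_inner)
  show "0 \<le> r \<Longrightarrow> 0 < c \<Longrightarrow> z \<notin> ball y r \<Longrightarrow> bump y r c z = 0"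
    by (auto simp: bump_def not_less intro!: rho_nonpos mult_nonneg_nonpos power_mono)
  show "0 < c \<Longrightarrow> z \<in> ball y r \<Longrightarrow> 0 < bump y r c z"
    by (auto simp: bump_def intro!: rho_0_pos mult_pos_pos power_strict_mono)
qed

text \<open>The factor \<open>v\<close> is there for the components of \<open>kern_field\<close>,
  which are affine functions times a bump.\<close>

lemma test_function_times_bump:
  assumes "\<And>k. C_times k v" "0 < r" "0 < c" "cball y r \<subseteq> \<Omega>"
  shows "test_function \<Omega> (\<lambda>z. v z * bump y r c z)"
proof -
  have *: "{z. v z * bump y r c z \<noteq> 0} \<subseteq> cball y r"
    using bump_eq_0[of r c _ y] assms by (force simp: subset_iff)
  then have **: "closure {z. v z * bump y r c z \<noteq> 0} \<subseteq> cball y r"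
    by (simp add: closure_minimal)
  have "bounded {z. v z * bump y r c z \<noteq> 0}"
    using * bounded_cball bounded_subset by blast
  then show ?thesis
    using ** assms C_times_mult[OF _ C_times_bump] unfolding test_function_def compact_closure by blast
qed

section \<open>Integration by parts\<close>

text \<open>The mean value theorem bounds all difference quotients by \<open>w\<close>, so dominated
  convergence applies along every sequence tending to \<open>t\<close>; such a sequence is shifted
  first so that it stays in the interval.\<close>

lemma DERIV_integral:
  fixes h h' :: "real \<Rightarrow> 'a \<Rightarrow> real"
  assumes t: "t \<in> {a<..<b}"
    and int: "\<And>s. s \<in> {a<..<b} \<Longrightarrow> integrable M (h s)"
    and der: "\<And>s z. s \<in> {a<..<b} \<Longrightarrow> z \<in> space M \<Longrightarrow> ((\<lambda>s. h s z) has_real_derivative h' s z) (at s)"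
    and bd: "\<And>s z. s \<in> {a<..<b} \<Longrightarrow> z \<in> space M \<Longrightarrow> \<bar>h' s z\<bar> \<le> w z"
    and w: "integrable M w"
  shows "((\<lambda>s. \<integral>z. h s z \<partial>M) has_real_derivative (\<integral>z. h' t z \<partial>M)) (at t)"
  unfolding has_field_derivative_iff tendsto_at_iff_sequentially comp_def
proof (intro allI impI)
  fix X :: "nat \<Rightarrow> real"
  assume X: "\<forall>i. X i \<in> UNIV - {t}" "X \<longlonglongrightarrow> t"
  have "\<forall>\<^sub>F i in sequentially. X i \<in> {a<..<b}"
    using topological_tendstoD[OF X(2) open_greaterThanLessThan] t by blast
  then obtain N where N: "\<And>i. X (i + N) \<in> {a<..<b}"
    by (metis eventually_sequentially le_add2)
  define Y where "Y i = X (i + N)" for i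
  have Y: "Y i \<in> {a<..<b}" "Y i \<noteq> t" for i
    using N X(1) by (auto simp: Y_def)
  have Yl: "Y \<longlonglongrightarrow> t" using X(2) unfolding Y_def by (rule LIMSEQ_ignore_initial_segment)
  have lim: "(\<lambda>i. (h (Y i) z - h t z) / (Y i - t)) \<longlonglongrightarrow> h' t z" if "z \<in> space M" for z
    using der[OF t that] Y Yl unfolding has_field_derivative_iff tendsto_at_iff_sequentially comp_def by simp
  have meas: "(\<lambda>z. (h (Y i) z - h t z) / (Y i - t)) \<in> borel_measurable M" for i
    using int[OF Y(1)] int[OF t] by measurable
  have A: "(\<lambda>i. \<integral>z. (h (Y i) z - h t z) / (Y i - t) \<partial>M) \<longlonglongrightarrow> (\<integral>z. h' t z \<partial>M)"
  proof (rule integral_dominated_convergence[where w=w])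
    show "h' t \<in> borel_measurable M"
      by (rule borel_measurable_LIMSEQ_real[OF lim meas])
    show "AE x in M. (\<lambda>i. (h (Y i) x - h t x) / (Y i - t)) \<longlonglongrightarrow> h' t x"
      using lim by simp
    show "AE z in M. norm ((h (Y i) z - h t z) / (Y i - t)) \<le> w z" for i
    proof (rule AE_I2)
      fix z assume z: "z \<in> space M"
      have "norm (h (Y i) z - h t z) \<le> w z * norm (Y i - t)"
        by (rule field_differentiable_bound[of "{a<..<b}"])
          (use der bd z Y t in \<open>auto intro: has_field_derivative_at_within\<close>)
      then show "norm ((h (Y i) z - h t z) / (Y i - t)) \<le> w z"
        using Y(2) by (simp add: field_simps)
    qed
  qed (use w meas in auto)
  have eq: "(\<integral>z. (h (Y i) z - h t z) / (Y i - t) \<partial>M) = ((\<integral>z. h (Y i) z \<partial>M) - (\<integral>z. h t z \<partial>M)) / (Y i - t)" for i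
    using int[OF Y(1)] int[OF t] by simp
  from A show "(\<lambda>i. ((\<integral>z. h (X i) z \<partial>M) - (\<integral>z. h t z \<partial>M)) / (X i - t)) \<longlonglongrightarrow> (\<integral>z. h' t z \<partial>M)"
    unfolding eq unfolding Y_def by (rule LIMSEQ_offset)
qed

lemma bounded_compact_support:
  fixes g :: "'a::euclidean_space \<Rightarrow> real"
  assumes "continuous_on UNIV g" "compact K" "\<And>x. x \<notin> K \<Longrightarrow> g x = 0"
  obtains B where "0 \<le> B" "\<And>x. \<bar>g x\<bar> \<le> B"
proof -
  have "compact (g ` K)"
    using assms by (meson compact_continuous_image continuous_on_subset subset_UNIV)
  then obtain B where "\<And>y. y \<in> g ` K \<Longrightarrow> \<bar>y\<bar> \<le> B"
    by (metis bounded_real compact_imp_bounded)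
  then have "\<bar>g x\<bar> \<le> max B 0" for x
    using assms(3)[of x] by (cases "x \<in> K") force+
  then show ?thesis using that by (meson max.cobounded2)
qed

lemma integrable_times_compact_support:
  fixes u \<psi> :: "'a::euclidean_space \<Rightarrow> real"
  assumes u: "integrable (lebesgue_on K) u" and K: "compact K" "K \<subseteq> \<Omega>" and \<Omega>: "\<Omega> \<in> sets lebesgue"
    and \<psi>: "continuous_on UNIV \<psi>" "\<And>x. x \<notin> K \<Longrightarrow> \<psi> x = 0"
  shows "integrable (lebesgue_on \<Omega>) (\<lambda>x. u x * \<psi> x)"
proof -
  obtain B where B: "0 \<le> B" "\<And>x. \<bar>\<psi> x\<bar> \<le> B" using bounded_compact_support[OF \<psi>(1) K(1) \<psi>(2)] by blast
  have K': "K \<in> sets lebesgue" using K(1) by (simp add: borel_compact)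
  have "\<psi> \<in> borel_measurable lebesgue"
    using \<psi>(1) by (intro measurable_completion) (simp add: borel_measurable_continuous_onI)
  then have m: "\<psi> \<in> borel_measurable (lebesgue_on S)" for S
    by (simp add: measurable_restrict_space1)
  have "integrable (lebesgue_on K) (\<lambda>x. u x * \<psi> x)"
  proof (rule Bochner_Integration.integrable_bound)
    show "integrable (lebesgue_on K) (\<lambda>x. B * u x)" using u by simp
    show "(\<lambda>x. u x * \<psi> x) \<in> borel_measurable (lebesgue_on K)" using u m[of K] by measurable
    show "AE x in lebesgue_on K. norm (u x * \<psi> x) \<le> norm (B * u x)"
      using B by (auto simp: abs_mult intro!: AE_I2 mult_right_mono) (metis abs_ge_zero abs_of_nonneg mult.commute mult_left_mono)
  qed
  then have "integrable lebesgue (\<lambda>x. if x \<in> K then u x * \<psi> x else 0)"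
    by (simp add: K' Lebesgue_Measure.integrable_restrict_UNIV)
  also have "(\<lambda>x. if x \<in> K then u x * \<psi> x else 0) = (\<lambda>x. if x \<in> \<Omega> then u x * \<psi> x else 0)"
    using \<psi>(2) K(2) by (auto simp: fun_eq_iff)
  finally show ?thesis by (simp add: \<Omega> Lebesgue_Measure.integrable_restrict_UNIV)
qed

lemma integrable_on_compact_continuous:
  fixes g :: "'a::euclidean_space \<Rightarrow> 'b::euclidean_space"
  assumes "continuous_on UNIV g" "compact K"
  shows "integrable (lebesgue_on K) g"
proof -
  have "bounded (g ` K)"
    by (intro compact_imp_bounded compact_continuous_image continuous_on_subset[OF assms(1)] assms(2)) simp
  then obtain B where "\<And>x. x \<in> K \<Longrightarrow> norm (g x) \<le> B" unfolding bounded_iff by blast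
  show ?thesis
  proof (rule integrableI_bounded_set_indicator[where A=K and B=B, THEN integrable_restrict_space[THEN iffD2, rotated]])
  show "K \<inter> space lebesgue \<in> sets lebesgue" using assms(2) by (simp add: borel_compact)
  show "K \<in> sets lebesgue" using assms(2) by (simp add: borel_compact)
  show "emeasure lebesgue K < \<infinity>"
    using fmeasurableD2[OF lmeasurable_compact[OF assms(2)]] by (simp add: less_top)
  show "g \<in> borel_measurable lebesgue"
    using assms by (intro measurable_completion) (simp add: borel_measurable_continuous_onI)
  show "AE x in lebesgue. x \<in> K \<longrightarrow> norm (g x) \<le> B" using \<open>\<And>x. x \<in> K \<Longrightarrow> norm (g x) \<le> B\<close> by simp
qed
qed

lemma integrable_continuous_compact_support:
  fixes g :: "'a::euclidean_space \<Rightarrow> real"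
  assumes "continuous_on UNIV g" "compact K" "\<And>x. x \<notin> K \<Longrightarrow> g x = 0"
  shows "integrable lborel g"
proof -
  have "integrable (lebesgue_on UNIV) (\<lambda>x. 1 * g x)"
    by (rule integrable_times_compact_support[of K]) (use assms in \<open>auto intro!: integrable_on_compact_continuous continuous_intros\<close>)
  then show ?thesis
    using assms(1) by (simp add: lebesgue_on_UNIV_eq integrable_completion borel_measurable_continuous_onI)
qed

text \<open>By translation invariance the integral of \<open>\<phi> (z + t *\<^sub>R ?e)\<close>
  does not depend on \<open>t\<close>. Differentiating under the integral at \<open>t = 0\<close>
  gives the integral of the partial derivative, so this is 0.\<close>

lemma integral_partial_deriv_eq_0:
  fixes \<phi> :: "real^'n \<Rightarrow> real"
  assumes \<phi>: "\<phi> differentiable_on UNIV" "continuous_on UNIV (partial_deriv j \<phi>)"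
    and K: "compact K" "\<And>x. x \<notin> K \<Longrightarrow> \<phi> x = 0" "\<And>x. x \<notin> K \<Longrightarrow> partial_deriv j \<phi> x = 0"
  shows "(\<integral>z. partial_deriv j \<phi> z \<partial>lborel) = 0"
proof -
  let ?e = "axis j 1 :: real^'n"
  have cont: "continuous_on UNIV \<phi>" by (rule differentiable_imp_continuous_on[OF \<phi>(1)])
  note int = integrable_continuous_compact_support[OF cont K(1,2)]
  have shift: "integrable lborel (\<lambda>z. \<phi> (z + c))" "(\<integral>z. \<phi> (z + c) \<partial>lborel) = (\<integral>z. \<phi> z \<partial>lborel)" for c
  proof -
    have m: "\<phi> \<in> borel_measurable borel" using cont by (rule borel_measurable_continuous_onI)
    have "integrable (distr lborel borel ((+) c)) \<phi>" using int by (simp add: lborel_distr_plus)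
    then show "integrable lborel (\<lambda>z. \<phi> (z + c))"
      using m by (subst (asm) integrable_distr_eq) (auto simp: add.commute)
    have "(\<integral>z. \<phi> z \<partial>lborel) = (\<integral>z. \<phi> z \<partial>distr lborel borel ((+) c))" by (simp add: lborel_distr_plus)
    also have "\<dots> = (\<integral>z. \<phi> (z + c) \<partial>lborel)"
      using m by (subst integral_distr) (auto simp: add.commute)
    finally show "(\<integral>z. \<phi> (z + c) \<partial>lborel) = (\<integral>z. \<phi> z \<partial>lborel)" by simp
  qed
  obtain B where B: "0 \<le> B" "\<And>x. \<bar>partial_deriv j \<phi> x\<bar> \<le> B"
    using bounded_compact_support[OF \<phi>(2) K(1,3)] by blast
  obtain R where R: "\<And>x. x \<in> K \<Longrightarrow> norm x \<le> R" using K(1) compact_imp_bounded bounded_iff by metis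
  have "((\<lambda>t. \<integral>z. \<phi> (z + t *\<^sub>R ?e) \<partial>lborel) has_real_derivative (\<integral>z. partial_deriv j \<phi> (z + 0 *\<^sub>R ?e) \<partial>lborel)) (at 0)"
  \<comment> \<open>Shifts have length below 1, so all shifted supports lie in the ball of radius
    \<open>R + 1\<close>.\<close>
  proof (rule DERIV_integral[where a="-1" and b=1 and w="\<lambda>z. B * indicator (cball 0 (R + 1)) z"])
    fix s :: real and z :: "real^'n" assume s: "s \<in> {-1<..<1}"
    have "((\<lambda>s. \<phi> (z + s *\<^sub>R ?e)) has_derivative (\<lambda>h. frechet_derivative \<phi> (at (z + s *\<^sub>R ?e)) (h *\<^sub>R ?e))) (at s)"
      by (rule has_derivative_compose[OF _ differentiable_frechet[OF \<phi>(1)], of "\<lambda>s. z + s *\<^sub>R ?e"])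
        (auto intro!: derivative_eq_intros)
    moreover have "frechet_derivative \<phi> (at (z + s *\<^sub>R ?e)) (h *\<^sub>R ?e) = partial_deriv j \<phi> (z + s *\<^sub>R ?e) * h" for h
      using linear_cmul[OF has_derivative_linear[OF differentiable_frechet[OF \<phi>(1)]]] by (simp add: partial_deriv_def mult.commute)
    ultimately show "((\<lambda>s. \<phi> (z + s *\<^sub>R ?e)) has_real_derivative partial_deriv j \<phi> (z + s *\<^sub>R ?e)) (at s)"
      by (simp add: has_field_derivative_def)
    show "\<bar>partial_deriv j \<phi> (z + s *\<^sub>R ?e)\<bar> \<le> B * indicator (cball 0 (R + 1)) z"
    proof (cases "z \<in> cball 0 (R + 1)")
      case False
      have "norm z \<le> norm (z + s *\<^sub>R ?e) + norm (s *\<^sub>R ?e)" by (metis add_diff_cancel norm_triangle_ineq4)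
      moreover have "norm (s *\<^sub>R ?e) < 1" using s by (auto simp: norm_axis_1)
      ultimately have "z + s *\<^sub>R ?e \<notin> K" using False R[of "z + s *\<^sub>R ?e"] by auto
      then show ?thesis using K(3) B(1) by (simp add: zero_le_mult_iff)
    qed (use B in auto)
  qed (use shift in \<open>auto intro!: integrable_mult_right integrable_real_indicator emeasure_lborel_cball_finite simp: less_top[symmetric]\<close>)
  moreover have "((\<lambda>t. \<integral>z. \<phi> (z + t *\<^sub>R ?e) \<partial>lborel) has_real_derivative 0) (at 0)"
    by (simp add: shift)
  ultimately show ?thesis using DERIV_unique by fastforce
qed

section \<open>Test functions and the weak derivative of affine functions\<close>

lemma test_functionD:
  assumes "test_function \<Omega> \<phi>"
  obtains K where "compact K" "K \<subseteq> \<Omega>" "\<phi> differentiable_on UNIV" "\<And>j. continuous_on UNIV (partial_deriv j \<phi>)"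
    "\<And>x. x \<notin> K \<Longrightarrow> \<phi> x = 0" "\<And>x j. x \<notin> K \<Longrightarrow> partial_deriv j \<phi> x = 0"
proof
  let ?K = "closure {x. \<phi> x \<noteq> 0}"
  show "compact ?K" "?K \<subseteq> \<Omega>" using assms by (auto simp: test_function_def)
  have "C_times 1 \<phi>" using assms by (simp add: test_function_def)
  then show "\<phi> differentiable_on UNIV" "continuous_on UNIV (partial_deriv j \<phi>)" for j by auto
  show 0: "x \<notin> ?K \<Longrightarrow> \<phi> x = 0" for x using closure_subset[of "{x. \<phi> x \<noteq> 0}"] by auto
  show "partial_deriv j \<phi> x = 0" if "x \<notin> ?K" for x j
  proof -
    have "((\<lambda>_. 0) has_derivative (\<lambda>_. 0)) (at x)" by simp
    then have "(\<phi> has_derivative (\<lambda>_. 0)) (at x)"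
    proof (rule has_derivative_transform_within_open)
      show "open (- ?K)" by (simp add: open_Compl)
      show "x \<in> - ?K" using that by blast
      show "0 = \<phi> y" if "y \<in> - ?K" for y using 0[of y] that by (metis ComplD)
    qed
    then show ?thesis by (simp add: partial_deriv_eq)
  qed
qed

lemma locally_integrable_nth: "locally_integrable \<Omega> f \<Longrightarrow> locally_integrable \<Omega> (\<lambda>x. f x $ i)"
  unfolding locally_integrable_def using integrable_bounded_linear[OF bounded_linear_vec_nth] by blast

lemma locally_integrable_diff:
  "locally_integrable \<Omega> f \<Longrightarrow> locally_integrable \<Omega> g \<Longrightarrow> locally_integrable \<Omega> (\<lambda>x. f x - g x)"
  unfolding locally_integrable_def by auto

lemma integrable_times_test:
  assumes "locally_integrable \<Omega> u" "open \<Omega>" "test_function \<Omega> \<phi>"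
  shows "integrable (lebesgue_on \<Omega>) (\<lambda>x. u x * \<phi> x)"
    and "integrable (lebesgue_on \<Omega>) (\<lambda>x. u x * partial_deriv j \<phi> x)"
proof -
  obtain K where K: "compact K" "K \<subseteq> \<Omega>" "\<phi> differentiable_on UNIV" "\<And>j. continuous_on UNIV (partial_deriv j \<phi>)"
    "\<And>x. x \<notin> K \<Longrightarrow> \<phi> x = 0" "\<And>x j. x \<notin> K \<Longrightarrow> partial_deriv j \<phi> x = 0"
    using test_functionD[OF assms(3)] by blast
  have u: "integrable (lebesgue_on K) u" using assms(1) K unfolding locally_integrable_def by blast
  have O: "\<Omega> \<in> sets lebesgue" using assms(2) by (simp add: borel_open)
  show "integrable (lebesgue_on \<Omega>) (\<lambda>x. u x * \<phi> x)"
    using K(5) by (intro integrable_times_compact_support[OF u K(1,2) O] differentiable_imp_continuous_on K(3))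
  show "integrable (lebesgue_on \<Omega>) (\<lambda>x. u x * partial_deriv j \<phi> x)"
    using K(6) by (intro integrable_times_compact_support[OF u K(1,2) O] K(4))
qed

text \<open>A component of the affine map times a test function is again differentiable with compact
  support, so its partial derivatives integrate to 0; the product rule turns this into the weak
  identity. It allows first-order Taylor parts to be subtracted from Sobolev functions.\<close>

lemma weak_derivative_affine:
  fixes L :: "real^'n^'m"
  assumes "open \<Omega>"
  shows "weak_derivative \<Omega> (\<lambda>z. a + L *v (z - x)) (\<lambda>_. L)"
  unfolding weak_derivative_def
proof (intro conjI allI impI)
  have c: "continuous_on UNIV (\<lambda>z. a + L *v (z - x))"
    by (intro continuous_intros bounded_linear.continuous_on[OF matrix_vector_mul_bounded_linear])
  show "locally_integrable \<Omega> (\<lambda>z. a + L *v (z - x))" "locally_integrable \<Omega> (\<lambda>_. L)"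
    unfolding locally_integrable_def using integrable_on_compact_continuous[OF c]
      integrable_on_compact_continuous[OF continuous_on_const] by blast+
  fix \<phi> i j assume \<phi>: "test_function \<Omega> \<phi>"
  obtain K where K: "compact K" "K \<subseteq> \<Omega>" "\<phi> differentiable_on UNIV" "\<And>j. continuous_on UNIV (partial_deriv j \<phi>)"
    "\<And>x. x \<notin> K \<Longrightarrow> \<phi> x = 0" "\<And>x j. x \<notin> K \<Longrightarrow> partial_deriv j \<phi> x = 0"
    using test_functionD[OF \<phi>] by blast
  have O: "\<Omega> \<in> sets lebesgue" using assms(1) by (simp add: borel_open)
  define l where "l z = (a + L *v (z - x)) $ i" for z
  have dl: "(l has_derivative (\<lambda>h. (L *v h) $ i)) (at z)" for z
  proof -
    have "((\<lambda>z. a $ i + (\<Sum>k\<in>UNIV. L $ i $ k * (z $ k - x $ k))) has_derivative (\<lambda>h. \<Sum>k\<in>UNIV. L $ i $ k * h $ k)) (at z)"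
      by (auto intro!: derivative_eq_intros bounded_linear.has_derivative[OF bounded_linear_vec_nth])
    then show ?thesis by (simp add: l_def[abs_def] matrix_vector_mult_def)
  qed
  have lc: "continuous_on UNIV l"
    by (simp add: continuous_at_imp_continuous_on has_derivative_continuous[OF dl])
  have d: "((\<lambda>z. l z * \<phi> z) has_derivative (\<lambda>h. l z * frechet_derivative \<phi> (at z) h + (L *v h) $ i * \<phi> z)) (at z)" for z
    by (rule has_derivative_mult[OF dl differentiable_frechet[OF K(3)]])
  have p: "partial_deriv j (\<lambda>z. l z * \<phi> z) = (\<lambda>z. l z * partial_deriv j \<phi> z + L $ i $ j * \<phi> z)"
    by (rule ext, subst partial_deriv_eq[OF d])
      (simp add: partial_deriv_def matrix_vector_mult_def axis_def if_distrib cong: if_cong)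
  have c\<phi>: "continuous_on UNIV \<phi>" by (rule differentiable_imp_continuous_on[OF K(3)])
  have "(\<integral>z. partial_deriv j (\<lambda>z. l z * \<phi> z) z \<partial>lborel) = 0"
  proof (rule integral_partial_deriv_eq_0[of _ _ K])
    show "(\<lambda>z. l z * \<phi> z) differentiable_on UNIV"
      using d by (auto simp: differentiable_on_def differentiable_def)
    show "continuous_on UNIV (partial_deriv j (\<lambda>z. l z * \<phi> z))"
      unfolding p by (intro continuous_intros lc K(4) c\<phi>)
  qed (use K in \<open>auto simp: p\<close>)
  then have "(\<integral>z. l z * partial_deriv j \<phi> z + L $ i $ j * \<phi> z \<partial>lebesgue) = 0"
    unfolding p by (subst integral_completion) (auto intro!: borel_measurable_continuous_onI continuous_intros lc K(4) c\<phi>)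
  also have "(\<integral>z. l z * partial_deriv j \<phi> z + L $ i $ j * \<phi> z \<partial>lebesgue) =
      (\<integral>z. (if z \<in> \<Omega> then l z * partial_deriv j \<phi> z + L $ i $ j * \<phi> z else 0) \<partial>lebesgue)"
    using K(2,5,6) by (intro Bochner_Integration.integral_cong) (auto simp: subset_eq)
  also have "\<dots> = (\<integral>z. l z * partial_deriv j \<phi> z + L $ i $ j * \<phi> z \<partial>lebesgue_on \<Omega>)"
    by (rule Lebesgue_Measure.integral_restrict_UNIV[OF O])
  also have "\<dots> = (\<integral>z. l z * partial_deriv j \<phi> z \<partial>lebesgue_on \<Omega>) + (\<integral>z. L $ i $ j * \<phi> z \<partial>lebesgue_on \<Omega>)"
  proof (rule Bochner_Integration.integral_add)
    have "locally_integrable \<Omega> l" "locally_integrable \<Omega> (\<lambda>z. L $ i $ j)"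
      unfolding locally_integrable_def using lc by (auto intro!: integrable_on_compact_continuous)
    then show "integrable (lebesgue_on \<Omega>) (\<lambda>z. l z * partial_deriv j \<phi> z)"
      "integrable (lebesgue_on \<Omega>) (\<lambda>z. L $ i $ j * \<phi> z)"
      using integrable_times_test[OF _ assms \<phi>] by blast+
  qed
  finally show "(\<integral>z. (a + L *v (z - x)) $ i * partial_deriv j \<phi> z \<partial>lebesgue_on \<Omega>) = - (\<integral>z. L $ i $ j * \<phi> z \<partial>lebesgue_on \<Omega>)"
    by (simp add: l_def)
qed

section \<open>Lebesgue points\<close>

text \<open>Absolute continuity of the integral by truncation: the part of \<open>g\<close> above a
  level \<open>N\<close> has total integral below \<open>e / 2\<close>, and the part below it
  contributes at most \<open>N\<close> times the measure of \<open>S\<close>.\<close>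

lemma integral_small_on_small_sets:
  fixes g :: "'a \<Rightarrow> real"
  assumes g: "integrable M g" "\<And>x. 0 \<le> g x" and e: "0 < e"
  obtains d where "0 < d" "\<And>S. S \<in> fmeasurable M \<Longrightarrow> measure M S < d \<Longrightarrow> (\<integral>x. indicator S x * g x \<partial>M) \<le> e"
proof -
  have [measurable]: "g \<in> borel_measurable M" using g(1) by simp
  have im: "integrable M (\<lambda>x. min (g x) (real N))" for N
    by (rule Bochner_Integration.integrable_bound[OF g(1)]) (use g(2) in auto)
  have "(\<lambda>N. \<integral>x. min (g x) (real N) \<partial>M) \<longlonglongrightarrow> (\<integral>x. g x \<partial>M)"
  proof (rule integral_dominated_convergence[where w=g])
    have "\<forall>\<^sub>F N in sequentially. min (g x) (real N) = g x" for x
      using eventually_ge_at_top[of "nat \<lceil>g x\<rceil>"] by eventually_elim linarith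
    then show "AE x in M. (\<lambda>N. min (g x) (real N)) \<longlonglongrightarrow> g x"
      by (intro AE_I2 tendsto_eventually)
  qed (use g in auto)
  then have "\<forall>\<^sub>F N in sequentially. (\<integral>x. min (g x) (real N) \<partial>M) > (\<integral>x. g x \<partial>M) - e / 2"
    using e by (intro order_tendstoD) auto
  then obtain N where N: "(\<integral>x. min (g x) (real N) \<partial>M) > (\<integral>x. g x \<partial>M) - e / 2"
    by (auto simp: eventually_sequentially)
  show ?thesis
  \<comment> \<open>The \<open>+ 1\<close> keeps the threshold finite and positive for
    \<open>N = 0\<close>.\<close>
  proof (rule that[of "e / (2 * (real N + 1))"])
    fix S assume S: "S \<in> fmeasurable M" "measure M S < e / (2 * (real N + 1))"
    have iS: "integrable M (\<lambda>x. real N * indicator S x)"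
      using S(1) by (intro integrable_mult_right integrable_real_indicator) (auto simp: fmeasurable_def)
    have "(\<integral>x. indicator S x * g x \<partial>M) \<le> (\<integral>x. (g x - min (g x) (real N)) + real N * indicator S x \<partial>M)"
    proof (rule Bochner_Integration.integral_mono)
      show "integrable M (\<lambda>x. indicator S x * g x)"
        using integrable_mult_indicator[OF _ g(1), of S] S(1) by auto
    qed (use g im iS in \<open>auto simp: indicator_def\<close>)
    also have "\<dots> = (\<integral>x. g x \<partial>M) - (\<integral>x. min (g x) (real N) \<partial>M) + real N * measure M S"
      using g(1) im iS S(1) by (simp add: fmeasurable_def Int_absorb1 sets.sets_into_space)
    also have "\<dots> \<le> e / 2 + (real N + 1) * measure M S"
      using N measure_nonneg[of M S] unfolding distrib_right by linarith
    also have "\<dots> \<le> e" using S(2) by (simp add: field_simps)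
    finally show "(\<integral>x. indicator S x * g x \<partial>M) \<le> e" .
  qed (use e in auto)
qed

text \<open>Suppose \<open>g < a\<close> on a set where means over arbitrarily small balls exceed
  \<open>b > a\<close>. By Vitali, disjoint such balls cover the set up to a null set, all inside an
  open \<open>T\<close> that barely exceeds \<open>{g < a}\<close>. On their union \<open>U\<close>
  this gives \<open>b * |U| \<le> a * |U|\<close> plus a small error, so \<open>U\<close> is small.
  The one-sided bound is enough, as it will be applied to all functions
  \<open>norm (G z - c) powr q\<close>.\<close>

lemma Lebesgue_differentiation_limsup:
  fixes g :: "'a::euclidean_space \<Rightarrow> real"
  assumes g: "integrable lebesgue g" "\<And>x. 0 \<le> g x"
  shows "AE x in lebesgue. \<forall>c>g x. \<forall>\<^sub>F r in at_right 0.
    (\<integral>z. g z \<partial>lebesgue_on (ball x r)) \<le> c * measure lebesgue (ball x r)"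
proof -
  let ?I = "\<lambda>S. \<integral>z. indicator S z * g z \<partial>lebesgue"
  have gm[measurable]: "g \<in> borel_measurable lebesgue" using g(1) by simp
  have I: "integrable lebesgue (\<lambda>z. indicator S z * g z)" if "S \<in> sets lebesgue" for S
    using integrable_mult_indicator[OF that g(1)] by simp
  define big where "big b x r \<longleftrightarrow> ?I (ball x r) > b * measure lebesgue (ball x r)" for b x r
  define E where "E a b R = {x \<in> ball 0 R. g x < a \<and> (\<exists>\<^sub>F r in at_right 0. big b x r)}" for a b R
  have neg: "negligible (E a b R)" if ab: "0 < a" "a < b" for a b R
    unfolding negligible_outer_le
  proof (intro allI impI)
    fix e :: real assume e: "0 < e"
    \<comment> \<open>The tolerance carries the factor \<open>b - a\<close> that is cancelled at the
      end from \<open>(b - a) * measure lebesgue U\<close>.\<close>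
    obtain d where d: "0 < d"
      "\<And>S. S \<in> lmeasurable \<Longrightarrow> measure lebesgue S < d \<Longrightarrow> ?I S \<le> e * (b - a)"
      using integral_small_on_small_sets[OF g, of "e * (b - a)"] e ab by (metis diff_gt_0_iff_gt mult_pos_pos)
    define M where "M = {x. g x < a} \<inter> ball 0 R"
    have "{x \<in> space lebesgue. g x < a} \<in> sets lebesgue" by measurable
    then have M: "M \<in> sets lebesgue" unfolding M_def by (intro sets.Int) (auto simp: borel_open)
    have Mf: "M \<in> lmeasurable"
      by (rule fmeasurableI2[of "ball 0 R"]) (use M in \<open>auto simp: M_def\<close>)
    obtain T where T: "open T" "M \<subseteq> T" "T - M \<in> lmeasurable" "emeasure lebesgue (T - M) < ennreal d"
      using sets_lebesgue_outer_open[OF M d(1)] by blast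
    have Tf: "T \<in> lmeasurable"
      using fmeasurable.Un[OF Mf T(3)] T(2) by (simp add: Un_absorb1)
    let ?K = "{(x, r). x \<in> E a b R \<and> 0 < r \<and> ball x r \<subseteq> T \<and> big b x r}"
    obtain C where C: "countable C" "C \<subseteq> ?K"
      "pairwise (\<lambda>i j. disjnt (ball (fst i) (snd i)) (ball (fst j) (snd j))) C"
      "negligible (E a b R - (\<Union>i \<in> C. ball (fst i) (snd i)))"
    proof (rule Vitali_covering_theorem_balls[of "E a b R" ?K fst snd])
      fix x and \<delta> :: real assume x: "x \<in> E a b R" and "0 < \<delta>"
      then have "x \<in> T" using T(2) by (auto simp: E_def M_def)
      then obtain \<rho> where \<rho>: "0 < \<rho>" "ball x \<rho> \<subseteq> T" using T(1) openE by blast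
      have "\<exists>\<^sub>F r in at_right 0. big b x r" using x by (simp add: E_def)
      moreover have "\<forall>\<^sub>F r in at_right 0. r \<in> {0<..<min \<rho> \<delta>}"
        using \<open>0 < \<delta>\<close> \<rho>(1) by (intro eventually_at_right_real) auto
      ultimately have "\<exists>r. big b x r \<and> r \<in> {0<..<min \<rho> \<delta>}"
        unfolding frequently_def by (metis (mono_tags, lifting) eventually_mono)
      then obtain r where r: "big b x r" "0 < r" "r < \<rho>" "r < \<delta>" by auto
      moreover have "ball x r \<subseteq> T" using \<rho>(2) r(3) by (meson order_trans less_imp_le subset_ball)
      ultimately show "\<exists>i. i \<in> ?K \<and> x \<in> ball (fst i) (snd i) \<and> snd i < \<delta>"
        using x by (intro exI[of _ "(x, r)"]) auto
    qed
    define U where "U = (\<Union>i\<in>C. ball (fst i) (snd i))"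
    have CK: "ball (fst i) (snd i) \<subseteq> T \<and> big b (fst i) (snd i)" if "i \<in> C" for i
      using subsetD[OF C(2) that] by (simp add: case_prod_beta)
    then have U: "open U" "U \<subseteq> T" unfolding U_def by (blast, blast)
    have Us: "U \<in> sets lebesgue" using U(1) by (simp add: borel_open)
    have Uf: "U \<in> lmeasurable" by (rule fmeasurableI2[OF Tf U(2) Us])
    have disj: "disjoint_family_on (\<lambda>i. ball (fst i) (snd i)) C"
      using C(3) by (auto simp: pairwise_def disjoint_family_on_def disjnt_def)
    have enn: "ennreal (?I S) = (\<integral>\<^sup>+z. ennreal (indicator S z * g z) \<partial>lebesgue)" if "S \<in> sets lebesgue" for S
      using nn_integral_eq_integral[OF I[OF that]] g(2) by simp
    have enn2: "(\<integral>\<^sup>+z. ennreal (indicator S z * g z) \<partial>lebesgue) = emeasure (density lebesgue g) S" if "S \<in> sets lebesgue" for S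
      using that by (subst emeasure_density) (auto simp: indicator_def intro!: nn_integral_cong)
    have "ennreal b * emeasure lebesgue U = ennreal b * (\<integral>\<^sup>+i. emeasure lebesgue (ball (fst i) (snd i)) \<partial>count_space C)"
      unfolding U_def using C(1) disj by (subst emeasure_UN_countable) (auto simp: borel_open)
    also have "\<dots> = (\<integral>\<^sup>+i. ennreal b * emeasure lebesgue (ball (fst i) (snd i)) \<partial>count_space C)"
      by (subst nn_integral_cmult) auto
    also have "\<dots> \<le> (\<integral>\<^sup>+i. emeasure (density lebesgue g) (ball (fst i) (snd i)) \<partial>count_space C)"
    proof (rule nn_integral_mono)
      fix i assume "i \<in> space (count_space C)"
      then have "big b (fst i) (snd i)" using CK by simp
      then have "b * measure lebesgue (ball (fst i) (snd i)) \<le> ?I (ball (fst i) (snd i))" by (simp add: big_def)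
      then have "ennreal (b * measure lebesgue (ball (fst i) (snd i))) \<le> ennreal (?I (ball (fst i) (snd i)))"
        by (rule ennreal_leI)
      moreover have "ennreal (b * measure lebesgue (ball (fst i) (snd i))) = ennreal b * emeasure lebesgue (ball (fst i) (snd i))"
        using ab by (subst ennreal_mult) (auto simp: emeasure_eq_measure2 fmeasurableD2)
      ultimately show "ennreal b * emeasure lebesgue (ball (fst i) (snd i)) \<le> emeasure (density lebesgue g) (ball (fst i) (snd i))"
        using enn[of "ball (fst i) (snd i)"] enn2[of "ball (fst i) (snd i)"] by (simp add: borel_open)
    qed
    also have "\<dots> = emeasure (density lebesgue g) U"
      unfolding U_def using C(1) disj by (subst emeasure_UN_countable) (auto simp: borel_open)
    also have "\<dots> = ennreal (?I U)" using enn[OF Us] enn2[OF Us] by simp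
    finally have "ennreal (b * measure lebesgue U) \<le> ennreal (?I U)"
      using ab Uf by (subst ennreal_mult) (auto simp: emeasure_eq_measure2)
    then have "b * measure lebesgue U \<le> ?I U"
      using g(2) by (subst (asm) ennreal_le_iff) (auto intro!: Bochner_Integration.integral_nonneg)
    also have "?I U \<le> (\<integral>z. a * indicator U z + indicator (T - M) z * g z \<partial>lebesgue)"
    proof (rule Bochner_Integration.integral_mono)
      have "integrable lebesgue (\<lambda>z. a * indicator U z)"
        using Uf by (intro integrable_mult_right integrable_real_indicator) (auto simp: fmeasurable_def)
      then show "integrable lebesgue (\<lambda>z. a * indicator U z + indicator (T - M) z * g z)"
        using I[of "T - M"] T(3) by (intro Bochner_Integration.integrable_add) auto
      fix z
      show "indicator U z * g z \<le> a * indicator U z + indicator (T - M) z * g z"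
        using U(2) g(2)[of z] ab by (cases "z \<in> U"; cases "z \<in> M") (auto simp: M_def indicator_def)
    qed (use I[OF Us] in simp)
    also have "\<dots> = a * measure lebesgue U + ?I (T - M)"
      using Uf I[of "T - M"] T(3) by (subst Bochner_Integration.integral_add) (auto simp: fmeasurable_def)
    also have "?I (T - M) \<le> e * (b - a)"
      using T(3,4) d(1) by (intro d(2)) (auto simp: emeasure_eq_measure2 ennreal_less_iff)
    finally have "(b - a) * measure lebesgue U \<le> (b - a) * e" by (simp add: algebra_simps)
    then have mU: "measure lebesgue U \<le> e" using ab by simp
    show "\<exists>T. E a b R \<subseteq> T \<and> T \<in> lmeasurable \<and> measure lebesgue T \<le> e"
    proof (intro exI[of _ "U \<union> (E a b R - U)"] conjI)
      have N: "negligible (E a b R - U)" using C(4) by (simp add: U_def)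
      then show "U \<union> (E a b R - U) \<in> lmeasurable" using Uf negligible_imp_measurable by blast
      show "measure lebesgue (U \<union> (E a b R - U)) \<le> e"
        using mU measure_Un_le[OF Us negligible_imp_sets[OF N]] negligible_imp_measure0[OF N] by linarith
    qed blast
  qed
  \<comment> \<open>Two rationals fit between \<open>g x\<close> and any \<open>c > g x\<close>, so
    countably many exceptional sets suffice; \<open>0 < a\<close> costs nothing because
    \<open>g\<close> is nonnegative.\<close>
  define Q :: "(real \<times> real \<times> real) set"
    where "Q = {(a, b, R). a \<in> \<rat> \<and> b \<in> \<rat> \<and> R \<in> range real \<and> 0 < a \<and> a < b}"
  have "countable Q"
    by (rule countable_subset[of _ "\<rat> \<times> \<rat> \<times> range real"]) (auto simp: Q_def intro!: countable_SIGMA countable_rat)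
  then have "negligible (\<Union>(a, b, R)\<in>Q. E a b R)"
    by (intro negligible_countable_Union) (auto simp: Q_def intro!: neg)
  then have "AE x in lebesgue. x \<notin> (\<Union>(a, b, R)\<in>Q. E a b R)"
    unfolding negligible_iff_null_sets by (rule AE_not_in)
  then show ?thesis
  proof eventually_elim
    fix x assume x: "x \<notin> (\<Union>(a, b, R)\<in>Q. E a b R)"
    show "\<forall>c>g x. \<forall>\<^sub>F r in at_right 0. (\<integral>z. g z \<partial>lebesgue_on (ball x r)) \<le> c * measure lebesgue (ball x r)"
    proof (intro allI impI)
      fix c assume "g x < c"
      then obtain a where a: "a \<in> \<rat>" "g x < a" "a < c" using Rats_dense_in_real by blast
      then obtain b where b: "b \<in> \<rat>" "a < b" "b < c" using Rats_dense_in_real by blast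
      obtain R :: nat where R: "norm x < real R" using reals_Archimedean2 by blast
      have "0 < a" using g(2)[of x] a(2) by linarith
      then have "(a, b, real R) \<in> Q" using a b by (auto simp: Q_def)
      then have "x \<notin> E a b R" using x by blast
      then have "\<forall>\<^sub>F r in at_right 0. \<not> big b x r" using a(2) R by (simp add: E_def frequently_def)
      then show "\<forall>\<^sub>F r in at_right 0. (\<integral>z. g z \<partial>lebesgue_on (ball x r)) \<le> c * measure lebesgue (ball x r)"
      proof eventually_elim
        case (elim r)
        have "(\<integral>z. g z \<partial>lebesgue_on (ball x r)) = ?I (ball x r)"
          by (subst integral_restrict_space) (auto simp: borel_open)
        also have "\<dots> \<le> b * measure lebesgue (ball x r)" using elim by (simp add: big_def)
        also have "\<dots> \<le> c * measure lebesgue (ball x r)" using b by (intro mult_right_mono) auto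
        finally show ?case .
      qed
    qed
  qed
qed

text \<open>The exponent \<open>q = 1\<close> is used to recover a function from its weighted means,
  an exponent above the dimension for differentiability and for density measures. Multiplying by the
  volume avoids quotients.\<close>

definition lebesgue_point :: "real \<Rightarrow> ('a::euclidean_space \<Rightarrow> 'b::real_normed_vector) \<Rightarrow> 'a \<Rightarrow> bool" where
  "lebesgue_point q G x \<longleftrightarrow> (\<forall>\<epsilon>>0. \<forall>\<^sub>F r in at_right 0.
     (\<integral>z. norm (G z - G x) powr q \<partial>lebesgue_on (ball x r)) \<le> \<epsilon> * measure lebesgue (ball x r))"

text \<open>Lindeloef: countably many of the balls cover \<open>\<Omega>\<close>, so the exceptional
  null sets add up to a null set.\<close>

lemma AE_local:
  fixes \<Omega> :: "'a::euclidean_space set"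
  assumes "open \<Omega>" and P: "\<And>x. x \<in> \<Omega> \<Longrightarrow> \<exists>r>0. AE y in lebesgue. y \<in> ball x r \<longrightarrow> P y"
  shows "AE y in lebesgue. y \<in> \<Omega> \<longrightarrow> P y"
proof -
  define F where "F = {ball x r |x r. x \<in> \<Omega> \<and> r > 0 \<and> (AE y in lebesgue. y \<in> ball x r \<longrightarrow> P y)}"
  have "\<And>S. S \<in> F \<Longrightarrow> open S" by (auto simp: F_def)
  then obtain F' where F': "F' \<subseteq> F" "countable F'" "\<Union>F' = \<Union>F" using Lindelof by metis
  have "\<Omega> \<subseteq> \<Union>F"
  proof
    fix x assume x: "x \<in> \<Omega>"
    then obtain r where "r > 0" "AE y in lebesgue. y \<in> ball x r \<longrightarrow> P y" using P by blast
    then have "ball x r \<in> F" "x \<in> ball x r" using x by (auto simp: F_def)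
    then show "x \<in> \<Union>F" by blast
  qed
  have "AE y in lebesgue. \<forall>B\<in>F'. y \<in> B \<longrightarrow> P y"
    unfolding AE_ball_countable[OF F'(2)] using F'(1) by (auto simp: F_def)
  then show ?thesis by eventually_elim (use \<open>\<Omega> \<subseteq> \<Union>F\<close> F'(3) in auto)
qed

lemma integrable_lebesgue_on_subset:
  fixes f :: "'a::euclidean_space \<Rightarrow> 'b::{banach, second_countable_topology}"
  assumes "integrable (lebesgue_on T) f" "S \<subseteq> T" "S \<in> sets lebesgue" "T \<in> sets lebesgue"
  shows "integrable (lebesgue_on S) f"
proof -
  have "integrable lebesgue (\<lambda>x. indicator T x *\<^sub>R f x)"
    using assms by (simp add: integrable_restrict_space)
  from integrable_mult_indicator[OF assms(3) this]
  moreover have "(\<lambda>x. indicat_real S x *\<^sub>R indicat_real T x *\<^sub>R f x) = (\<lambda>x. indicat_real S x *\<^sub>R f x)"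
    using assms(2) by (auto simp: fun_eq_iff indicator_def)
  ultimately show ?thesis using assms by (simp add: integrable_restrict_space)
qed

text \<open>The constant comes from \<open>norm (a + b) \<le> 2 * max (norm a) (norm b)\<close>
  instead of convexity, so exponents below 1 are covered as well.\<close>

lemma norm_add_powr_le:
  fixes a b :: "'a::real_normed_vector"
  assumes "0 \<le> q"
  shows "norm (a + b) powr q \<le> 2 powr q * (norm a powr q + norm b powr q)"
proof -
  have "norm (a + b) \<le> 2 * max (norm a) (norm b)" using norm_triangle_ineq[of a b] by linarith
  then have "norm (a + b) powr q \<le> (2 * max (norm a) (norm b)) powr q" using assms by (intro powr_mono2) auto
  also have "\<dots> = 2 powr q * max (norm a) (norm b) powr q" by (simp add: powr_mult)
  also have "max (norm a) (norm b) powr q \<le> norm a powr q + norm b powr q" by (auto simp: max_def)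
  finally show ?thesis by simp
qed

lemma measure_lebesgue_ball:
  fixes x :: "'a::euclidean_space"
  assumes "0 \<le> r"
  shows "measure lebesgue (ball x r) = unit_ball_vol (real DIM('a)) * r ^ DIM('a)"
  using content_ball[OF assms, of x] by simp

lemma integrable_powr_diff_const:
  fixes G :: "'a::euclidean_space \<Rightarrow> 'b::euclidean_space"
  assumes G: "G \<in> borel_measurable (lebesgue_on K)" "integrable (lebesgue_on K) (\<lambda>z. norm (G z) powr q)"
    and K: "K \<in> lmeasurable" and q: "0 \<le> q"
  shows "integrable (lebesgue_on K) (\<lambda>z. norm (G z - c) powr q)"
proof (rule Bochner_Integration.integrable_bound)
  have "integrable (lebesgue_on K) (\<lambda>z. norm c powr q)"
    by (simp add: finite_measure.integrable_const finite_measure_lebesgue_on K)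
  then show "integrable (lebesgue_on K) (\<lambda>z. 2 powr q * (norm (G z) powr q + norm c powr q))" using G(2) by simp
  show "(\<lambda>z. norm (G z - c) powr q) \<in> borel_measurable (lebesgue_on K)" using G(1) by measurable
  show "AE z in lebesgue_on K. norm (norm (G z - c) powr q) \<le> norm (2 powr q * (norm (G z) powr q + norm c powr q))"
    using norm_add_powr_le[OF q, of "G _" "- c"] by (auto simp: abs_mult)
qed

text \<open>The exceptional set of the differentiation bound for
  \<open>norm (G z - c) powr q\<close> depends on \<open>c\<close>. Letting \<open>c\<close> run
  through a countable dense set gives one null set, off which \<open>G y\<close> may be replaced by
  a nearby \<open>c\<close>. The cutoff to \<open>?K\<close> turns local into global
  integrability.\<close>

theorem AE_lebesgue_point:
  fixes G :: "'a::euclidean_space \<Rightarrow> 'b::euclidean_space"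
  assumes "open \<Omega>" and q: "0 < q"
    and G: "\<And>K. compact K \<Longrightarrow> K \<subseteq> \<Omega> \<Longrightarrow> G \<in> borel_measurable (lebesgue_on K)"
      "\<And>K. compact K \<Longrightarrow> K \<subseteq> \<Omega> \<Longrightarrow> integrable (lebesgue_on K) (\<lambda>z. norm (G z) powr q)"
  shows "AE x in lebesgue. x \<in> \<Omega> \<longrightarrow> lebesgue_point q G x"
proof (rule AE_local[OF assms(1)])
  fix x assume "x \<in> \<Omega>"
  then obtain r where r: "0 < r" "cball x r \<subseteq> \<Omega>" using assms(1) open_contains_cball by blast
  obtain D :: "'b set" where D: "countable D" "\<And>S. open S \<Longrightarrow> S \<noteq> {} \<Longrightarrow> \<exists>d\<in>D. d \<in> S"
    using countable_dense_setE by blast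
  let ?K = "cball x r"
  have iK: "integrable (lebesgue_on ?K) (\<lambda>z. norm (G z - c) powr q)" for c
    using q r by (intro integrable_powr_diff_const G) auto
  have iK': "integrable lebesgue (\<lambda>z. if z \<in> ?K then norm (G z - c) powr q else 0)" for c
    using iK by (subst Lebesgue_Measure.integrable_restrict_UNIV) (auto simp: borel_closed)
  have isub: "integrable (lebesgue_on S) (\<lambda>z. norm (G z - c) powr q)" if "S \<subseteq> ?K" "S \<in> sets lebesgue" for S c
    by (rule integrable_lebesgue_on_subset[OF iK that]) (simp add: borel_closed)
  have "AE y in lebesgue. \<forall>c\<in>D. \<forall>e>(if y \<in> ?K then norm (G y - c) powr q else 0). \<forall>\<^sub>F s in at_right 0.
    (\<integral>z. (if z \<in> ?K then norm (G z - c) powr q else 0) \<partial>lebesgue_on (ball y s)) \<le> e * measure lebesgue (ball y s)"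
    unfolding AE_ball_countable[OF D(1)]
    by (intro ballI Lebesgue_differentiation_limsup iK') simp
  then have "AE y in lebesgue. y \<in> ball x r \<longrightarrow> lebesgue_point q G y"
  proof eventually_elim
    fix y
    assume A: "\<forall>c\<in>D. \<forall>e>(if y \<in> ?K then norm (G y - c) powr q else 0). \<forall>\<^sub>F s in at_right 0.
    (\<integral>z. (if z \<in> ?K then norm (G z - c) powr q else 0) \<partial>lebesgue_on (ball y s)) \<le> e * measure lebesgue (ball y s)"
    show "y \<in> ball x r \<longrightarrow> lebesgue_point q G y"
      unfolding lebesgue_point_def
    proof (intro impI allI)
      fix \<epsilon> :: real assume y: "y \<in> ball x r" and \<epsilon>: "0 < \<epsilon>"
      \<comment> \<open>The mean of \<open>norm (G z - c) powr q\<close> costs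
        \<open>2 * \<eta>\<close> and the exchange of \<open>c\<close> for \<open>G y\<close> costs
        \<open>\<eta>\<close>, both multiplied by the \<open>2 powr q\<close> of the quasi-triangle
        inequality.\<close>
      define \<eta> where "\<eta> = \<epsilon> / (3 * 2 powr q)"
      have \<eta>: "0 < \<eta>" using \<epsilon> by (simp add: \<eta>_def)
      obtain c where c: "c \<in> D" "norm (G y - c) < \<eta> powr (1 / q)"
        using D(2)[of "ball (G y) (\<eta> powr (1 / q))"] \<eta> by (auto simp: dist_norm)
      have t: "norm (G y - c) powr q \<le> \<eta>"
      proof -
        have "norm (G y - c) powr q \<le> (\<eta> powr (1 / q)) powr q" using c(2) q by (intro powr_mono2) auto
        then show ?thesis using q \<eta> by (simp add: powr_powr)
      qed
      obtain s0 where s0: "0 < s0" "ball y s0 \<subseteq> ball x r" using y open_ball openE by blast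
      have "\<forall>\<^sub>F s in at_right 0. s \<in> {0<..<s0}" using s0 by (intro eventually_at_right_real)
      moreover have "\<forall>\<^sub>F s in at_right 0. (\<integral>z. (if z \<in> ?K then norm (G z - c) powr q else 0) \<partial>lebesgue_on (ball y s))
          \<le> (2 * \<eta>) * measure lebesgue (ball y s)"
        using A[rule_format, OF c(1), of "2 * \<eta>"] t \<eta> y by (auto split: if_splits)
      ultimately show "\<forall>\<^sub>F s in at_right 0. (\<integral>z. norm (G z - G y) powr q \<partial>lebesgue_on (ball y s)) \<le> \<epsilon> * measure lebesgue (ball y s)"
      proof eventually_elim
        fix s assume s: "s \<in> {0<..<s0}" and B: "(\<integral>z. (if z \<in> ?K then norm (G z - c) powr q else 0) \<partial>lebesgue_on (ball y s))
          \<le> (2 * \<eta>) * measure lebesgue (ball y s)"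
        have sub: "ball y s \<subseteq> ?K" using s s0(2) subset_ball[of s s0 y] ball_subset_cball[of x r] by force
        have bs: "ball y s \<in> sets lebesgue" by (simp add: borel_open)
        have cst: "integrable (lebesgue_on (ball y s)) (\<lambda>z. k)" for k :: real
          by (simp add: finite_measure.integrable_const finite_measure_lebesgue_on)
        have "(\<integral>z. norm (G z - G y) powr q \<partial>lebesgue_on (ball y s))
            \<le> (\<integral>z. 2 powr q * (norm (G z - c) powr q + \<eta>) \<partial>lebesgue_on (ball y s))"
        proof (rule Bochner_Integration.integral_mono)
          fix z
          have "norm (G z - G y) powr q \<le> 2 powr q * (norm (G z - c) powr q + norm (c - G y) powr q)"
            using norm_add_powr_le[of q "G z - c" "c - G y"] q by simp
          also have "\<dots> \<le> 2 powr q * (norm (G z - c) powr q + \<eta>)"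
            using t by (intro mult_left_mono add_left_mono) (auto simp: norm_minus_commute)
          finally show "norm (G z - G y) powr q \<le> 2 powr q * (norm (G z - c) powr q + \<eta>)" .
        qed (use isub[OF sub bs] cst in auto)
        also have "\<dots> = 2 powr q * ((\<integral>z. norm (G z - c) powr q \<partial>lebesgue_on (ball y s)) + \<eta> * measure lebesgue (ball y s))"
          using isub[OF sub bs, of c] cst[of \<eta>] bs by (simp add: measure_restrict_space)
        also have "(\<integral>z. norm (G z - c) powr q \<partial>lebesgue_on (ball y s))
            = (\<integral>z. (if z \<in> ?K then norm (G z - c) powr q else 0) \<partial>lebesgue_on (ball y s))"
          using sub by (intro Bochner_Integration.integral_cong) auto
        also have "2 powr q * (\<dots> + \<eta> * measure lebesgue (ball y s))
           \<le> 2 powr q * ((2 * \<eta>) * measure lebesgue (ball y s) + \<eta> * measure lebesgue (ball y s))"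
          using B by (intro mult_left_mono add_right_mono) auto
        also have "\<dots> = \<epsilon> * measure lebesgue (ball y s)" by (simp add: \<eta>_def field_simps)
        finally show "(\<integral>z. norm (G z - G y) powr q \<partial>lebesgue_on (ball y s)) \<le> \<epsilon> * measure lebesgue (ball y s)" .
      qed
    qed
  qed
  then show "\<exists>r>0. AE y in lebesgue. y \<in> ball x r \<longrightarrow> lebesgue_point q G y" using r(1) by blast
qed

section \<open>Morrey's estimate\<close>

text \<open>One row of \<open>weak_derivative\<close>: the estimates are carried out for scalar
  functions and reassembled in \<open>Sobolev_representative\<close>.\<close>

definition weak_gradient :: "(real^'n) set \<Rightarrow> (real^'n \<Rightarrow> real) \<Rightarrow> (real^'n \<Rightarrow> real^'n) \<Rightarrow> bool" where
  "weak_gradient \<Omega> F H \<longleftrightarrow> locally_integrable \<Omega> F \<and> locally_integrable \<Omega> H \<and>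
     (\<forall>\<phi> j. test_function \<Omega> \<phi> \<longrightarrow>
        (\<integral>x. F x * partial_deriv j \<phi> x \<partial>lebesgue_on \<Omega>) = - (\<integral>x. H x $ j * \<phi> x \<partial>lebesgue_on \<Omega>))"

lemma weak_gradient_component: "weak_derivative \<Omega> f G \<Longrightarrow> weak_gradient \<Omega> (\<lambda>x. f x $ i) (\<lambda>x. G x $ i)"
  by (simp add: weak_derivative_def weak_gradient_def locally_integrable_nth)

text \<open>The power of \<open>1 / s\<close> makes the integral independent of \<open>y\<close> and
  \<open>s\<close> (\<open>integral_kern\<close>). It is not normalised to 1; the common value is
  divided out in \<open>Morrey\<close>.\<close>

definition kern :: "real^'n \<Rightarrow> real \<Rightarrow> real^'n \<Rightarrow> real" where
  "kern y s z = (1 / s) ^ CARD('n) * bump y s (1 / s\<^sup>2) z"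

lemma kern_nonneg: "0 < s \<Longrightarrow> 0 \<le> kern y s z"
  by (simp add: kern_def bump_def rho_0_nonneg)

lemma kern_le: "0 < s \<Longrightarrow> kern y s (z::real^'n) \<le> (1 / s) ^ CARD('n)"
  using mult_left_mono[OF rho_0_le, of "(1 / s) ^ CARD('n)"] by (simp add: kern_def bump_def)

lemma kern_eq_0: "0 < s \<Longrightarrow> z \<notin> ball y s \<Longrightarrow> kern y s z = 0"
  by (simp add: kern_def bump_eq_0)

lemma continuous_on_bump: "continuous_on S (bump y r c)"
  by (simp add: continuous_at_imp_continuous_on has_derivative_continuous[OF has_derivative_bump])

lemma continuous_on_kern: "continuous_on S (kern y s)"
  unfolding kern_def[abs_def] by (intro continuous_intros continuous_on_bump)

text \<open>Arguments occurring in kernels are at most 1 by \<open>rho_1_le_1\<close>, so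
  compactness of \<open>{0..1}\<close> gives the bound.\<close>

lemma rho_1_bounded: obtains B where "0 \<le> B" "\<And>t. t \<le> 1 \<Longrightarrow> \<bar>rho 1 t\<bar> \<le> B"
proof -
  have "compact (rho 1 ` {0..1})" by (intro compact_continuous_image continuous_on_rho) auto
  then have "bounded (rho 1 ` {0..1})" by (rule compact_imp_bounded)
  then obtain B where B: "\<forall>y\<in>rho 1 ` {0..1}. \<bar>y\<bar> \<le> B"
    unfolding bounded_real by (rule exE)
  show ?thesis
  proof (rule that[of "max B 0"])
    fix t :: real assume "t \<le> 1"
    then show "\<bar>rho 1 t\<bar> \<le> max B 0"
      using B[rule_format, of "rho 1 t"] rho_nonpos[of t 1] by (cases "t \<le> 0") auto
  qed auto
qed

lemma rho_1_le_1: "0 < s \<Longrightarrow> 1 / s\<^sup>2 * (s\<^sup>2 - (z - y) \<bullet> (z - y)) \<le> 1" for z :: "'a::real_inner"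
  by (simp add: field_simps)

text \<open>If the centre moves with velocity \<open>w\<close> and the radius grows at rate
  \<open>\<sigma>\<close>, a point with fixed relative position \<open>(z - y) / s\<close> moves
  with velocity \<open>w + (\<sigma> / s) *\<^sub>R (z - y)\<close>. The field is the resulting
  flux; \<open>\<sigma> = 0\<close> is translation, \<open>w = 0\<close> dilation.\<close>

definition kern_field :: "real^'n \<Rightarrow> real \<Rightarrow> real^'n \<Rightarrow> real \<Rightarrow> real^'n \<Rightarrow> real^'n" where
  "kern_field w \<sigma> y s z = kern y s z *\<^sub>R (w + (\<sigma> / s) *\<^sub>R (z - y))"

text \<open>The divergence of \<open>kern_field\<close> in closed form
  (\<open>sum_partial_deriv_kern_field\<close>), so that it can be compared with the derivative of
  \<open>kern\<close> along the curve and estimated.\<close>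

definition kern_div :: "real^'n \<Rightarrow> real \<Rightarrow> real^'n \<Rightarrow> real \<Rightarrow> real^'n \<Rightarrow> real" where
  "kern_div w \<sigma> y s z = (1 / s) ^ CARD('n) *
     (real CARD('n) * (\<sigma> / s) * rho 0 (1 / s\<^sup>2 * (s\<^sup>2 - (z - y) \<bullet> (z - y)))
      - 2 / s\<^sup>2 * ((w + (\<sigma> / s) *\<^sub>R (z - y)) \<bullet> (z - y)) * rho 1 (1 / s\<^sup>2 * (s\<^sup>2 - (z - y) \<bullet> (z - y))))"

lemma test_function_kern_field:
  assumes "0 < s" "cball y s \<subseteq> \<Omega>"
  shows "test_function \<Omega> (\<lambda>z. kern_field w \<sigma> y s z $ j)"
proof -
  have "C_times k (\<lambda>z. (1 / s) ^ CARD('a) * (w $ j + (\<sigma> / s) * (z $ j + - y $ j)))" for k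
    by (intro C_times_mult C_times_add C_times_const C_times_component)
  from test_function_times_bump[OF this assms(1) _ assms(2), of "1 / s\<^sup>2"] assms(1)
  show ?thesis by (simp add: kern_field_def kern_def mult_ac)
qed

lemma partial_deriv_kern_field:
  "partial_deriv j (\<lambda>z. kern_field w \<sigma> y s z $ j) z = (1 / s) ^ CARD('n) *
     ((\<sigma> / s) * rho 0 (1 / s\<^sup>2 * (s\<^sup>2 - (z - y) \<bullet> (z - y)))
      - 2 / s\<^sup>2 * ((w $ j + (\<sigma> / s) * (z $ j - y $ j)) * (z $ j - y $ j)) * rho 1 (1 / s\<^sup>2 * (s\<^sup>2 - (z - y) \<bullet> (z - y))))"
  if "0 < s" for y :: "real^'n"
proof -
  let ?R = "rho 1 (1 / s\<^sup>2 * (s\<^sup>2 - (z - y) \<bullet> (z - y)))"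
  have l: "((\<lambda>z. w $ j + (\<sigma> / s) * (z $ j - y $ j)) has_derivative (\<lambda>h. (\<sigma> / s) * h $ j)) (at z)"
    using that by (auto intro!: derivative_eq_intros bounded_linear.has_derivative[OF bounded_linear_vec_nth])
  have "((\<lambda>z. (1 / s) ^ CARD('n) * (bump y s (1 / s\<^sup>2) z * (w $ j + (\<sigma> / s) * (z $ j - y $ j)))) has_derivative
     (\<lambda>h. (1 / s) ^ CARD('n) * (bump y s (1 / s\<^sup>2) z * ((\<sigma> / s) * h $ j) +
          (- 2 * (1 / s\<^sup>2) * ((z - y) \<bullet> h) * ?R) * (w $ j + (\<sigma> / s) * (z $ j - y $ j))))) (at z)"
    by (rule has_derivative_mult_right[OF has_derivative_mult[OF has_derivative_bump l]])
  then have "((\<lambda>z. kern_field w \<sigma> y s z $ j) has_derivative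
     (\<lambda>h. (1 / s) ^ CARD('n) * (bump y s (1 / s\<^sup>2) z * ((\<sigma> / s) * h $ j) +
          (- 2 * (1 / s\<^sup>2) * ((z - y) \<bullet> h) * ?R) * (w $ j + (\<sigma> / s) * (z $ j - y $ j))))) (at z)"
    using that by (simp add: kern_field_def kern_def mult_ac)
  from partial_deriv_eq[OF this, of j]
  have "partial_deriv j (\<lambda>z. kern_field w \<sigma> y s z $ j) z = (1 / s) ^ CARD('n) * (bump y s (1 / s\<^sup>2) z * (\<sigma> / s * 1) +
          (- 2 * (1 / s\<^sup>2) * (z $ j - y $ j) * ?R) * (w $ j + (\<sigma> / s) * (z $ j - y $ j)))"
    by (simp add: inner_axis)
  moreover have "c * (r * (q * 1) + (- 2 * (1 / S) * d * R) * u) = c * (q * r - 2 / S * (u * d) * R)" for c r q S d R u :: real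
    by (simp add: algebra_simps)
  ultimately show ?thesis unfolding bump_def by (simp only:)
qed

lemma sum_partial_deriv_kern_field:
  fixes y :: "real^'n"
  assumes "0 < s"
  shows "(\<Sum>j\<in>UNIV. partial_deriv j (\<lambda>z. kern_field w \<sigma> y s z $ j) z) = kern_div w \<sigma> y s z"
proof -
  have *: "(\<Sum>j\<in>UNIV. c * (a * R0 - k * (u j * v j) * R1)) = c * (real CARD('n) * a * R0 - k * (\<Sum>j\<in>UNIV. u j * v j) * R1)"
    for c a R0 k R1 :: real and u v :: "'n \<Rightarrow> real"
    by (simp add: sum_subtractf sum_distrib_left sum_distrib_right right_diff_distrib mult_ac)
  show ?thesis
    unfolding partial_deriv_kern_field[OF assms] kern_div_def * by (simp add: inner_vec_def)
qed

text \<open>The continuity equation: along the curve, the density \<open>kern\<close> is transported by the velocity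
  field \<open>w + (\<sigma> / s) *\<^sub>R (z - y)\<close>.\<close>

lemma DERIV_kern:
  assumes "0 < s + t * \<sigma>"
  shows "((\<lambda>t. kern (y + t *\<^sub>R w) (s + t * \<sigma>) z) has_real_derivative
           - kern_div w \<sigma> (y + t *\<^sub>R w) (s + t * \<sigma>) z) (at t)"
proof -
  let ?y = "y + t *\<^sub>R w" and ?s = "s + t * \<sigma>"
  let ?N = "\<lambda>t. (z - (y + t *\<^sub>R w)) \<bullet> (z - (y + t *\<^sub>R w))"
  have s: "?s \<noteq> 0" "?s > 0" using assms by auto
  have N: "(?N has_real_derivative - 2 * ((z - ?y) \<bullet> w)) (at t)"
    unfolding has_field_derivative_def
    by (auto intro!: derivative_eq_intros simp: fun_eq_iff inner_commute algebra_simps)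
  have q: "((\<lambda>t. 1 / (s + t * \<sigma>)\<^sup>2 * ((s + t * \<sigma>)\<^sup>2 - ?N t)) has_real_derivative
      2 * ((z - ?y) \<bullet> w) / ?s\<^sup>2 + 2 * \<sigma> * ?N t / ?s ^ 3) (at t)"
  proof -
    have *: "- (2 * S * \<sigma>) / (S\<^sup>2 * S\<^sup>2) * (S\<^sup>2 - M) + (2 * S * \<sigma> - - 2 * P) * (1 / S\<^sup>2) = 2 * P / S\<^sup>2 + 2 * \<sigma> * M / S ^ 3"
      if "S \<noteq> 0" for S M P :: real
      using that by (simp add: field_simps power2_eq_square power3_eq_cube)
    have "((\<lambda>t. (s + t * \<sigma>)\<^sup>2) has_real_derivative 2 * ?s * \<sigma>) (at t)"
      by (auto intro!: derivative_eq_intros)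
    note S = this
    have "((\<lambda>t. 1 / (s + t * \<sigma>)\<^sup>2) has_real_derivative - (2 * ?s * \<sigma>) / (?s\<^sup>2 * ?s\<^sup>2)) (at t)"
      using DERIV_divide[OF DERIV_const S, of 1] s(1) by simp
    from DERIV_mult[OF this DERIV_diff[OF S N]] show ?thesis
      unfolding *[OF s(1)] .
  qed
  have p: "((\<lambda>t. (1 / (s + t * \<sigma>)) ^ CARD('a)) has_real_derivative
      - (real CARD('a) * (\<sigma> / ?s) * (1 / ?s) ^ CARD('a))) (at t)"
  proof -
    obtain k where k: "CARD('a) = Suc k" using zero_less_card_finite[where 'a='a] gr0_implies_Suc by blast
    have "((\<lambda>t. s + t * \<sigma>) has_real_derivative \<sigma>) (at t)" by (auto intro!: derivative_eq_intros)
    from DERIV_divide[OF DERIV_const this, of 1] s(1)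
    have "((\<lambda>t. 1 / (s + t * \<sigma>)) has_real_derivative - \<sigma> / (?s * ?s)) (at t)" by simp
    note S = this
    have "real (Suc k) * (- \<sigma> / (S * S) * (1 / S) ^ (Suc k - Suc 0)) = - (real (Suc k) * (\<sigma> / S) * (1 / S) ^ Suc k)" for S
      by simp
    then show ?thesis
      unfolding k by (intro DERIV_cong[OF DERIV_power[OF S]])
  qed
  have D: "((\<lambda>t. kern (y + t *\<^sub>R w) (s + t * \<sigma>) z) has_real_derivative
     (- (real CARD('a) * (\<sigma> / ?s) * (1 / ?s) ^ CARD('a))) * rho 0 (1 / ?s\<^sup>2 * (?s\<^sup>2 - ?N t)) +
     (rho 1 (1 / ?s\<^sup>2 * (?s\<^sup>2 - ?N t)) * (2 * ((z - ?y) \<bullet> w) / ?s\<^sup>2 + 2 * \<sigma> * ?N t / ?s ^ 3)) * (1 / ?s) ^ CARD('a)) (at t)"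
    unfolding kern_def bump_def
    using DERIV_mult[OF p DERIV_chain2[OF DERIV_rho[of 0] q]] by simp
  have I: "(w + (\<sigma> / ?s) *\<^sub>R (z - ?y)) \<bullet> (z - ?y) = (z - ?y) \<bullet> w + (\<sigma> / ?s) * ?N t"
    by (simp only: inner_add_left inner_scaleR_left inner_commute[of w])
  have alg: "(- (n * (\<sigma> / S) * c)) * R0 + (R1 * (2 * P / S\<^sup>2 + 2 * \<sigma> * M / S ^ 3)) * c
      = - (c * (n * (\<sigma> / S) * R0 - 2 / S\<^sup>2 * (P + (\<sigma> / S) * M) * R1))" for n c R0 R1 P M S :: real
    by (simp add: algebra_simps add_divide_distrib power2_eq_square power3_eq_cube)
  show ?thesis
    unfolding kern_div_def I
    by (rule D[unfolded alg[of "real CARD('a)" ?s "(1 / ?s) ^ CARD('a)" "rho 0 (1 / ?s\<^sup>2 * (?s\<^sup>2 - ?N t))"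
        "rho 1 (1 / ?s\<^sup>2 * (?s\<^sup>2 - ?N t))" "(z - ?y) \<bullet> w" "?N t"]])
qed

text \<open>The bound is uniform in \<open>y\<close>, \<open>z\<close> and all radii above
  \<open>s0\<close>; it supplies the dominating function for differentiation under the
  integral.\<close>

lemma kern_div_bound:
  fixes w :: "real^'n"
  assumes "0 \<le> B" "\<And>t. t \<le> 1 \<Longrightarrow> \<bar>rho 1 t\<bar> \<le> B" "0 < s0" "s0 \<le> s"
  shows "\<bar>kern_div w \<sigma> y s z\<bar> \<le> (1 / s0) ^ CARD('n) * (real CARD('n) * (\<bar>\<sigma>\<bar> / s0) + 2 / s0 * (norm w + \<bar>\<sigma>\<bar>) * B)"
proof (cases "z \<in> ball y s")
  case True
  let ?q = "1 / s\<^sup>2 * (s\<^sup>2 - (z - y) \<bullet> (z - y))"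
  have s: "0 < s" using assms by linarith
  have zy: "norm (z - y) \<le> s" using True by (simp add: dist_norm norm_minus_commute)
  have "\<bar>real CARD('n) * (\<sigma> / s) * rho 0 ?q\<bar> \<le> real CARD('n) * (\<bar>\<sigma>\<bar> / s0) * 1"
    using assms(3,4) rho_0_le[of ?q] rho_0_nonneg[of ?q] unfolding abs_mult
    by (intro mult_mono) (auto intro!: divide_left_mono)
  moreover have "\<bar>2 / s\<^sup>2 * ((w + (\<sigma> / s) *\<^sub>R (z - y)) \<bullet> (z - y)) * rho 1 ?q\<bar> \<le> 2 / s0 * (norm w + \<bar>\<sigma>\<bar>) * B"
  proof -
    have "norm (w + (\<sigma> / s) *\<^sub>R (z - y)) \<le> norm w + \<bar>\<sigma>\<bar> / s * norm (z - y)"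
      using norm_triangle_ineq[of w "(\<sigma> / s) *\<^sub>R (z - y)"] s by simp
    also have "\<dots> \<le> norm w + \<bar>\<sigma>\<bar> / s * s" using zy s by (intro add_left_mono mult_left_mono) auto
    finally have "norm (w + (\<sigma> / s) *\<^sub>R (z - y)) \<le> norm w + \<bar>\<sigma>\<bar>" using s by simp
    then have "\<bar>(w + (\<sigma> / s) *\<^sub>R (z - y)) \<bullet> (z - y)\<bar> \<le> (norm w + \<bar>\<sigma>\<bar>) * s"
      using zy by (intro order_trans[OF Cauchy_Schwarz_ineq2] mult_mono) auto
    then have "2 / s\<^sup>2 * \<bar>(w + (\<sigma> / s) *\<^sub>R (z - y)) \<bullet> (z - y)\<bar> \<le> 2 / s\<^sup>2 * ((norm w + \<bar>\<sigma>\<bar>) * s)"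
      by (intro mult_left_mono) auto
    also have "\<dots> = 2 / s * (norm w + \<bar>\<sigma>\<bar>)" using s by (simp add: power2_eq_square)
    also have "\<dots> \<le> 2 / s0 * (norm w + \<bar>\<sigma>\<bar>)"
      using assms(3,4) by (intro mult_right_mono divide_left_mono) auto
    finally have "(2 / s\<^sup>2 * \<bar>(w + (\<sigma> / s) *\<^sub>R (z - y)) \<bullet> (z - y)\<bar>) * \<bar>rho 1 ?q\<bar> \<le> (2 / s0 * (norm w + \<bar>\<sigma>\<bar>)) * B"
      by (rule mult_mono[OF _ assms(2)[OF rho_1_le_1[OF s]]]) (use assms in auto)
    then show ?thesis by (simp add: abs_mult)
  qed
  moreover have "(1 / s) ^ CARD('n) \<le> (1 / s0) ^ CARD('n)"
    using assms(3,4) s by (intro power_mono divide_left_mono) auto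
  ultimately show ?thesis
    unfolding kern_div_def abs_mult[of "(1 / s) ^ CARD('n)"] using s assms(1,3)
    by (intro mult_mono order_trans[OF abs_triangle_ineq4] add_mono) auto
next
  case False
  have s: "0 < s" using assms by linarith
  have "s\<^sup>2 \<le> (z - y) \<bullet> (z - y)"
    using False s power_mono[of s "norm (z - y)" 2]
    by (simp add: dist_norm norm_minus_commute flip: power2_norm_eq_inner)
  then have "1 / s\<^sup>2 * (s\<^sup>2 - (z - y) \<bullet> (z - y)) \<le> 0" using s by (simp add: mult_nonneg_nonpos divide_nonpos_pos)
  then show ?thesis using assms by (simp add: kern_div_def rho_nonpos)
qed

lemma kern_div_eq_0:
  assumes "0 < s" "z \<notin> ball y s"
  shows "kern_div w \<sigma> y s z = 0"
proof -
  have "s\<^sup>2 \<le> (z - y) \<bullet> (z - y)"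
    using assms power_mono[of s "norm (z - y)" 2]
    by (simp add: dist_norm norm_minus_commute flip: power2_norm_eq_inner)
  then have "1 / s\<^sup>2 * (s\<^sup>2 - (z - y) \<bullet> (z - y)) \<le> 0" using assms by (simp add: mult_nonneg_nonpos divide_nonpos_pos)
  then show ?thesis using assms by (simp add: kern_div_def rho_nonpos)
qed

lemma integrable_lebesgue_on_if:
  fixes g :: "'a::euclidean_space \<Rightarrow> real"
  assumes "integrable (lebesgue_on K) g" "K \<subseteq> \<Omega>" "K \<in> sets lebesgue" "\<Omega> \<in> sets lebesgue"
  shows "integrable (lebesgue_on \<Omega>) (\<lambda>z. if z \<in> K then g z else 0)"
proof -
  have "integrable lebesgue (\<lambda>z. if z \<in> K then g z else 0)"
    using assms by (simp add: Lebesgue_Measure.integrable_restrict_UNIV)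
  moreover have "(\<lambda>z. if z \<in> K then g z else 0) = (\<lambda>z. if z \<in> \<Omega> then if z \<in> K then g z else 0 else 0)"
    using assms(2) by (auto simp: fun_eq_iff)
  ultimately show ?thesis using Lebesgue_Measure.integrable_restrict_UNIV[OF assms(4), of "\<lambda>z. if z \<in> K then g z else 0"] by simp
qed

section \<open>Weighted means and their derivatives in centre and radius\<close>

definition Uk :: "(real^'n) set \<Rightarrow> (real^'n \<Rightarrow> real) \<Rightarrow> real^'n \<Rightarrow> real \<Rightarrow> real" where
  "Uk \<Omega> F y s = (\<integral>z. F z * kern y s z \<partial>lebesgue_on \<Omega>)"

text \<open>The components of \<open>kern_field\<close> are test functions, so summing the weak
  identity over all directions moves the divergence onto \<open>H\<close>. For the bound, the
  velocity has length at most \<open>norm w + \<bar>\<sigma>\<bar>\<close> on the ball because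
  \<open>norm (z - y) \<le> s\<close> there, and \<open>kern\<close> is at most
  \<open>(1 / s) ^ CARD('n)\<close>.\<close>

lemma
  fixes H :: "real^'n \<Rightarrow> real^'n"
  assumes \<Omega>: "open \<Omega>" and wg: "weak_gradient \<Omega> F H" and y: "0 < s" "cball y s \<subseteq> \<Omega>"
  shows integral_kern_field: "(\<integral>z. - (F z * kern_div w \<sigma> y s z) \<partial>lebesgue_on \<Omega>) = (\<integral>z. H z \<bullet> kern_field w \<sigma> y s z \<partial>lebesgue_on \<Omega>)"
    and integral_kern_field_bound: "\<bar>\<integral>z. H z \<bullet> kern_field w \<sigma> y s z \<partial>lebesgue_on \<Omega>\<bar>
      \<le> (norm w + \<bar>\<sigma>\<bar>) * ((1 / s) ^ CARD('n) * (\<integral>z. norm (H z) \<partial>lebesgue_on (ball y s)))"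
proof -
  have li: "locally_integrable \<Omega> F" "locally_integrable \<Omega> H" using wg by (auto simp: weak_gradient_def)
  note t = test_function_kern_field[OF y, of w \<sigma>]
  note I1 = integrable_times_test(2)[OF li(1) \<Omega> t] and I2 = integrable_times_test(1)[OF locally_integrable_nth[OF li(2)] \<Omega> t]
  have "(\<integral>z. - (F z * kern_div w \<sigma> y s z) \<partial>lebesgue_on \<Omega>)
     = - (\<integral>z. (\<Sum>j\<in>UNIV. F z * partial_deriv j (\<lambda>z. kern_field w \<sigma> y s z $ j) z) \<partial>lebesgue_on \<Omega>)"
    by (simp add: sum_partial_deriv_kern_field[OF y(1), symmetric] sum_distrib_left)
  also have "\<dots> = - (\<Sum>j\<in>UNIV. \<integral>z. F z * partial_deriv j (\<lambda>z. kern_field w \<sigma> y s z $ j) z \<partial>lebesgue_on \<Omega>)"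
    by (simp add: I1)
  also have "\<dots> = (\<Sum>j\<in>UNIV. \<integral>z. H z $ j * kern_field w \<sigma> y s z $ j \<partial>lebesgue_on \<Omega>)"
    using wg t by (simp add: weak_gradient_def sum_negf)
  also have "\<dots> = (\<integral>z. H z \<bullet> kern_field w \<sigma> y s z \<partial>lebesgue_on \<Omega>)"
    by (simp add: I2 inner_vec_def)
  finally show "(\<integral>z. - (F z * kern_div w \<sigma> y s z) \<partial>lebesgue_on \<Omega>) = (\<integral>z. H z \<bullet> kern_field w \<sigma> y s z \<partial>lebesgue_on \<Omega>)" .
  let ?C = "(norm w + \<bar>\<sigma>\<bar>) * (1 / s) ^ CARD('n)"
  have sets: "ball y s \<in> sets lebesgue" "\<Omega> \<in> sets lebesgue" "cball y s \<in> sets lebesgue"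
    using \<Omega> by (auto simp: borel_open borel_closed)
  have sub: "ball y s \<subseteq> cball y s" "ball y s \<subseteq> \<Omega>" using y(2) ball_subset_cball by blast+
  have "integrable (lebesgue_on (cball y s)) H" using li(2) y(2) by (simp add: locally_integrable_def)
  then have iH: "integrable (lebesgue_on (ball y s)) H"
    by (rule integrable_lebesgue_on_subset[OF _ sub(1) sets(1,3)])
  have "norm (\<integral>z. H z \<bullet> kern_field w \<sigma> y s z \<partial>lebesgue_on \<Omega>) \<le> (\<integral>z. (if z \<in> ball y s then ?C * norm (H z) else 0) \<partial>lebesgue_on \<Omega>)"
  proof (rule Bochner_Integration.integral_norm_bound_integral)
    show "integrable (lebesgue_on \<Omega>) (\<lambda>z. H z \<bullet> kern_field w \<sigma> y s z)" by (simp add: I2 inner_vec_def)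
    show "integrable (lebesgue_on \<Omega>) (\<lambda>z. if z \<in> ball y s then ?C * norm (H z) else 0)"
      using iH by (intro integrable_lebesgue_on_if sub sets) simp
    fix z
    show "norm (H z \<bullet> kern_field w \<sigma> y s z) \<le> (if z \<in> ball y s then ?C * norm (H z) else 0)"
    proof (cases "z \<in> ball y s")
      case True
      have "norm (z - y) \<le> s" using True by (simp add: dist_norm norm_minus_commute)
      then have "\<bar>\<sigma>\<bar> / s * norm (z - y) \<le> \<bar>\<sigma>\<bar> / s * s" using y(1) by (intro mult_left_mono) auto
      then have v: "norm (w + (\<sigma> / s) *\<^sub>R (z - y)) \<le> norm w + \<bar>\<sigma>\<bar>"
        using norm_triangle_ineq[of w "(\<sigma> / s) *\<^sub>R (z - y)"] y(1) by simp
      have "norm (kern_field w \<sigma> y s z) \<le> (1 / s) ^ CARD('n) * (norm w + \<bar>\<sigma>\<bar>)"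
        unfolding kern_field_def norm_scaleR using kern_le[OF y(1), of y z] kern_nonneg[OF y(1), of y z] v y(1)
        by (intro mult_mono) auto
      then have "norm (H z) * norm (kern_field w \<sigma> y s z) \<le> norm (H z) * ((1 / s) ^ CARD('n) * (norm w + \<bar>\<sigma>\<bar>))"
        by (rule mult_left_mono) auto
      then have "\<bar>H z \<bullet> kern_field w \<sigma> y s z\<bar> \<le> ?C * norm (H z)"
        using Cauchy_Schwarz_ineq2[of "H z" "kern_field w \<sigma> y s z"] by (simp only: mult_ac)
      then show ?thesis using True by simp
    qed (simp add: kern_field_def kern_eq_0[OF y(1)])
  qed
  also have "\<dots> = (\<integral>z. ?C * norm (H z) \<partial>lebesgue_on (ball y s))"
    by (rule Lebesgue_Measure.integral_restrict[OF sub(2) sets(1,2)])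
  finally show "\<bar>\<integral>z. H z \<bullet> kern_field w \<sigma> y s z \<partial>lebesgue_on \<Omega>\<bar>
      \<le> (norm w + \<bar>\<sigma>\<bar>) * ((1 / s) ^ CARD('n) * (\<integral>z. norm (H z) \<partial>lebesgue_on (ball y s)))"
    by (simp add: mult.assoc)
qed

text \<open>The continuity equation turns the derivative of the kernel into minus a divergence, and
  \<open>integral_kern_field\<close> moves it onto \<open>H\<close>. A fixed compact
  \<open>K\<close> and a positive lower bound \<open>cc\<close> of the radii provide the
  domination.\<close>

lemma DERIV_Uk:
  fixes H :: "real^'n \<Rightarrow> real^'n"
  assumes \<Omega>: "open \<Omega>" and wg: "weak_gradient \<Omega> F H" and K: "compact K" "K \<subseteq> \<Omega>"
    and t: "t \<in> {a<..<b}" and cc: "0 < cc" "\<And>t. t \<in> {a<..<b} \<Longrightarrow> cc \<le> s + t * \<sigma>"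
    and sub: "\<And>t. t \<in> {a<..<b} \<Longrightarrow> cball (y + t *\<^sub>R w) (s + t * \<sigma>) \<subseteq> K"
  shows "((\<lambda>t. Uk \<Omega> F (y + t *\<^sub>R w) (s + t * \<sigma>)) has_real_derivative
    (\<integral>z. H z \<bullet> kern_field w \<sigma> (y + t *\<^sub>R w) (s + t * \<sigma>) z \<partial>lebesgue_on \<Omega>)) (at t)"
proof -
  have spos: "0 < s + t * \<sigma>" if "t \<in> {a<..<b}" for t using cc that by fastforce
  have li: "integrable (lebesgue_on K) F" using wg K by (auto simp: weak_gradient_def locally_integrable_def)
  have sets: "K \<in> sets lebesgue" "\<Omega> \<in> sets lebesgue" using \<Omega> K by (auto simp: borel_open borel_compact)
  obtain B where B: "0 \<le> B" "\<And>t. t \<le> 1 \<Longrightarrow> \<bar>rho 1 t\<bar> \<le> B" using rho_1_bounded by blast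
  \<comment> \<open>The value of \<open>kern_div_bound\<close> for the smallest admissible radius
    \<open>cc\<close>.\<close>
  define C where "C = (1 / cc) ^ CARD('n) * (real CARD('n) * (\<bar>\<sigma>\<bar> / cc) + 2 / cc * (norm w + \<bar>\<sigma>\<bar>) * B)"
  have "((\<lambda>t. \<integral>z. F z * kern (y + t *\<^sub>R w) (s + t * \<sigma>) z \<partial>lebesgue_on \<Omega>) has_real_derivative
     (\<integral>z. - (F z * kern_div w \<sigma> (y + t *\<^sub>R w) (s + t * \<sigma>) z) \<partial>lebesgue_on \<Omega>)) (at t)"
  proof (rule DERIV_integral[OF t, where w="\<lambda>z. if z \<in> K then C * \<bar>F z\<bar> else 0"])
    fix r assume r: "r \<in> {a<..<b}"
    show "integrable (lebesgue_on \<Omega>) (\<lambda>z. F z * kern (y + r *\<^sub>R w) (s + r * \<sigma>) z)"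
    proof (rule integrable_times_compact_support[OF li K sets(2) continuous_on_kern])
      show "kern (y + r *\<^sub>R w) (s + r * \<sigma>) z = 0" if "z \<notin> K" for z
        using kern_eq_0[OF spos[OF r]] sub[OF r] that ball_subset_cball by blast
    qed
    fix z
    show "((\<lambda>t. F z * kern (y + t *\<^sub>R w) (s + t * \<sigma>) z) has_real_derivative - (F z * kern_div w \<sigma> (y + r *\<^sub>R w) (s + r * \<sigma>) z)) (at r)"
      using DERIV_cmult[OF DERIV_kern[OF spos[OF r], where y = y and w = w and z = z], of "F z"] by simp
    show "\<bar>- (F z * kern_div w \<sigma> (y + r *\<^sub>R w) (s + r * \<sigma>) z)\<bar> \<le> (if z \<in> K then C * \<bar>F z\<bar> else 0)"
    proof (cases "z \<in> K")
      case True
      have "\<bar>F z\<bar> * \<bar>kern_div w \<sigma> (y + r *\<^sub>R w) (s + r * \<sigma>) z\<bar> \<le> \<bar>F z\<bar> * C"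
        unfolding C_def by (intro mult_left_mono kern_div_bound B cc r) auto
      then show ?thesis using True by (simp add: abs_mult mult.commute)
    next
      case False
      then have "z \<notin> ball (y + r *\<^sub>R w) (s + r * \<sigma>)" using sub[OF r] ball_subset_cball by blast
      from kern_div_eq_0[OF spos[OF r] this] show ?thesis using False by simp
    qed
  next
    show "integrable (lebesgue_on \<Omega>) (\<lambda>z. if z \<in> K then C * \<bar>F z\<bar> else 0)"
      using li by (intro integrable_lebesgue_on_if K sets) simp
  qed
  then show ?thesis
    unfolding Uk_def integral_kern_field[OF \<Omega> wg spos[OF t] order_trans[OF sub[OF t] K(2)]] .
qed

text \<open>With fixed centre the derivative in the radius is at most
  \<open>N * t powr (\<beta> - 1)\<close>, which is the derivative of
  \<open>N / \<beta> * t powr \<beta>\<close>. Hence adding or subtracting the mean from this power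
  gives a nondecreasing function.\<close>

lemma Uk_radial_bound:
  fixes H :: "real^'n \<Rightarrow> real^'n"
  assumes \<Omega>: "open \<Omega>" and wg: "weak_gradient \<Omega> F H" and y: "cball y r \<subseteq> \<Omega>" and \<beta>: "0 < \<beta>"
    and N: "0 \<le> N" "\<And>t. 0 < t \<Longrightarrow> t < r \<Longrightarrow> (\<integral>z. norm (H z) \<partial>lebesgue_on (ball y t)) \<le> N * t ^ CARD('n) * t powr (\<beta> - 1)"
    and s: "0 < s1" "s1 \<le> s2" "s2 < r"
  shows "\<bar>Uk \<Omega> F y s2 - Uk \<Omega> F y s1\<bar> \<le> N / \<beta> * s2 powr \<beta>"
proof -
  let ?U = "Uk \<Omega> F y" and ?D = "\<lambda>t. \<integral>z. H z \<bullet> kern_field 0 1 y t z \<partial>lebesgue_on \<Omega>"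
  \<comment> \<open>With \<open>s = 0\<close> and \<open>\<sigma> = 1\<close> the curve parameter is
    the radius. Starting at \<open>s1 / 2\<close> keeps the radius away from 0 and leaves
    \<open>s1\<close> in the interior.\<close>
  have D: "(?U has_real_derivative ?D t) (at t)" if "t \<in> {s1 / 2<..<r}" for t
    using DERIV_Uk[OF \<Omega> wg compact_cball y that, where cc = "s1 / 2" and s = 0 and \<sigma> = 1 and y = y and w = 0] s by (auto simp: subset_iff)
  have g: "((\<lambda>t. N / \<beta> * t powr \<beta>) has_real_derivative N * t powr (\<beta> - 1)) (at t)" if "0 < t" for t
    using that \<beta> by (auto intro!: derivative_eq_intros)
  have b: "\<bar>?D t\<bar> \<le> N * t powr (\<beta> - 1)" if "0 < t" "t < r" for t
  proof -
    have "cball y t \<subseteq> \<Omega>" using y that by (auto simp: subset_iff)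
    then have "\<bar>?D t\<bar> \<le> (1 / t) ^ CARD('n) * (\<integral>z. norm (H z) \<partial>lebesgue_on (ball y t))"
      using integral_kern_field_bound[OF \<Omega> wg that(1), where y = y and w = 0 and \<sigma> = 1] by simp
    also have "\<dots> \<le> (1 / t) ^ CARD('n) * (N * t ^ CARD('n) * t powr (\<beta> - 1))"
      using that by (intro mult_left_mono N) auto
    also have "\<dots> = N * t powr (\<beta> - 1)" using that by (simp add: power_divide)
    finally show ?thesis .
  qed
  have "N / \<beta> * s1 powr \<beta> - ?U s1 \<le> N / \<beta> * s2 powr \<beta> - ?U s2"
  proof (rule DERIV_nonneg_imp_nondecreasing[OF s(2)])
    fix t assume t: "s1 \<le> t" "t \<le> s2"
    show "\<exists>d. ((\<lambda>t. N / \<beta> * t powr \<beta> - ?U t) has_real_derivative d) (at t) \<and> 0 \<le> d"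
      using DERIV_diff[OF g D, of t] b[of t] s t by (intro exI conjI) (assumption | force)+
  qed
  moreover have "N / \<beta> * s1 powr \<beta> + ?U s1 \<le> N / \<beta> * s2 powr \<beta> + ?U s2"
  proof (rule DERIV_nonneg_imp_nondecreasing[OF s(2)])
    fix t assume t: "s1 \<le> t" "t \<le> s2"
    show "\<exists>d. ((\<lambda>t. N / \<beta> * t powr \<beta> + ?U t) has_real_derivative d) (at t) \<and> 0 \<le> d"
      using DERIV_add[OF g D, of t] b[of t] s t by (intro exI conjI) (assumption | force)+
  qed
  moreover have "0 \<le> N / \<beta> * s1 powr \<beta>" using N(1) \<beta> by simp
  ultimately show ?thesis by linarith
qed

text \<open>The centre moves along the segment from \<open>x\<close> to \<open>y\<close> at constant
  radius, so the derivative is a flux of \<open>H\<close> with velocity \<open>y - x\<close>; the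
  mean value theorem gives the claim.\<close>

lemma Uk_translate_bound:
  fixes H :: "real^'n \<Rightarrow> real^'n"
  assumes \<Omega>: "open \<Omega>" and wg: "weak_gradient \<Omega> F H" and x: "cball x (3 * s) \<subseteq> \<Omega>" "0 < s" "dist x y \<le> s"
    and M: "\<And>y'. dist x y' \<le> s \<Longrightarrow> (\<integral>z. norm (H z) \<partial>lebesgue_on (ball y' s)) \<le> M"
  shows "\<bar>Uk \<Omega> F y s - Uk \<Omega> F x s\<bar> \<le> dist x y * ((1 / s) ^ CARD('n) * M)"
proof -
  let ?w = "y - x"
  let ?D = "\<lambda>t. \<integral>z. H z \<bullet> kern_field ?w 0 (x + t *\<^sub>R ?w) s z \<partial>lebesgue_on \<Omega>"
  have w: "norm ?w \<le> s" using x(3) by (simp add: dist_norm norm_minus_commute)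
  \<comment> \<open>The parameter runs through an open interval around \<open>{0..1}\<close>, so
    centres move by up to \<open>2 * s\<close>. Together with the radius \<open>s\<close> this is
    the origin of the enlarged ball of radius \<open>3 * s\<close>.\<close>
  have sub: "cball (x + t *\<^sub>R ?w) s \<subseteq> cball x (3 * s)" if "t \<in> {-1<..<2}" for t
  proof -
    have "\<bar>t\<bar> * norm ?w \<le> 2 * s" using that w by (intro mult_mono) auto
    then show ?thesis by (simp add: cball_subset_cball_iff dist_norm)
  qed
  have D: "((\<lambda>t. Uk \<Omega> F (x + t *\<^sub>R ?w) s) has_real_derivative ?D t) (at t)" if "t \<in> {-1<..<2}" for t
    using DERIV_Uk[OF \<Omega> wg compact_cball x(1) that x(2), where s = s and \<sigma> = 0 and y = x and w = ?w] sub by simp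
  have "norm (Uk \<Omega> F (x + 1 *\<^sub>R ?w) s - Uk \<Omega> F (x + 0 *\<^sub>R ?w) s) \<le> (norm ?w * ((1 / s) ^ CARD('n) * M)) * norm (1 - 0 :: real)"
  proof (rule field_differentiable_bound[of "{0..1::real}" "\<lambda>t. Uk \<Omega> F (x + t *\<^sub>R ?w) s" ?D])
    fix t :: real assume t: "t \<in> {0..1}"
    show "((\<lambda>t. Uk \<Omega> F (x + t *\<^sub>R ?w) s) has_field_derivative ?D t) (at t within {0..1})"
      by (rule has_field_derivative_at_within[OF D]) (use t in auto)
    have d: "dist x (x + t *\<^sub>R ?w) \<le> s"
      using t w mult_mono[of t 1 "norm ?w" s] x(2) by (simp add: dist_norm)
    have "\<bar>?D t\<bar> \<le> (norm ?w + \<bar>0\<bar>) * ((1 / s) ^ CARD('n) * (\<integral>z. norm (H z) \<partial>lebesgue_on (ball (x + t *\<^sub>R ?w) s)))"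
      using sub[of t] x t by (intro integral_kern_field_bound[OF \<Omega> wg]) auto
    also have "\<dots> \<le> (norm ?w + \<bar>0\<bar>) * ((1 / s) ^ CARD('n) * M)"
      using M[OF d] x(2) by (intro mult_left_mono) auto
    finally show "norm (?D t) \<le> norm ?w * ((1 / s) ^ CARD('n) * M)" by simp
  qed auto
  then show ?thesis by (simp add: dist_norm norm_minus_commute)
qed

text \<open>Hoelder's inequality up to a factor 2, from the elementary bound
  \<open>h \<le> l + l powr (1 - p) * h powr p\<close>. The last two factors multiply to
  \<open>t\<close> to the power \<open>n - n / p\<close>; they are kept apart in the form that
  \<open>Uk_radial_bound\<close> expects.\<close>

lemma Lp_growth:
  fixes H :: "real^'n \<Rightarrow> real^'n"
  assumes p: "1 < p" and m: "0 < m" "integrable (lebesgue_on B) (\<lambda>z. norm (H z) powr p)"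
      "(\<integral>z. norm (H z) powr p \<partial>lebesgue_on B) \<le> m"
    and B: "B \<in> sets lebesgue" "ball y t \<subseteq> B" and t: "0 < t"
    and H: "integrable (lebesgue_on (ball y t)) H"
  shows "(\<integral>z. norm (H z) \<partial>lebesgue_on (ball y t)) \<le>
    (2 * m powr (1 / p) * unit_ball_vol CARD('n) powr (1 - 1 / p)) * t ^ CARD('n) * t powr (1 - CARD('n) / p - 1)"
proof -
  define V where "V = measure lebesgue (ball y t)"
  have V: "V = unit_ball_vol CARD('n) * t ^ CARD('n)" "0 < V"
    using t measure_lebesgue_ball[of t y] by (simp_all add: V_def)
  \<comment> \<open>This threshold makes the two terms \<open>l * V\<close> and
    \<open>l powr (1 - p) * m\<close> equal.\<close>
  define l where "l = (m / V) powr (1 / p)"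
  have l: "0 < l" using m V(2) by (simp add: l_def)
  have S: "ball y t \<in> sets lebesgue" by (simp add: borel_open)
  have ip: "integrable (lebesgue_on (ball y t)) (\<lambda>z. norm (H z) powr p)"
    by (rule integrable_lebesgue_on_subset[OF m(2) B(2) S B(1)])
  have ic: "integrable (lebesgue_on (ball y t)) (\<lambda>z. l)"
    by (simp add: finite_measure.integrable_const finite_measure_lebesgue_on)
  have pt: "h \<le> l + l powr (1 - p) * h powr p" if "0 \<le> h" for h
  proof (cases "h \<le> l")
    case False
    have "h = h powr (1 - p) * h powr p" using False l by (simp flip: powr_add)
    also have "\<dots> \<le> l powr (1 - p) * h powr p" using False l p by (intro mult_right_mono powr_mono2') auto
    finally show ?thesis using l by linarith
  qed (use l in \<open>auto intro: add_increasing2\<close>)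
  have "(\<integral>z. norm (H z) \<partial>lebesgue_on (ball y t)) \<le> (\<integral>z. l + l powr (1 - p) * norm (H z) powr p \<partial>lebesgue_on (ball y t))"
    using H ic ip pt by (intro Bochner_Integration.integral_mono) auto
  also have "\<dots> = l * V + l powr (1 - p) * (\<integral>z. norm (H z) powr p \<partial>lebesgue_on (ball y t))"
    using ic ip S by (simp add: V_def measure_restrict_space)
  also have "(\<integral>z. norm (H z) powr p \<partial>lebesgue_on (ball y t)) \<le> (\<integral>z. norm (H z) powr p \<partial>lebesgue_on B)"
    by (rule integral_mono_lebesgue_on_AE) (use m B S in auto)
  also have "\<dots> \<le> m" by (rule m(3))
  also have "l * V + l powr (1 - p) * m = 2 * m powr (1 / p) * V powr (1 - 1 / p)"
  proof -
    have "l * V = m powr (1 / p) * V powr (1 - 1 / p)"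
      using m V(2) by (simp add: l_def powr_divide powr_diff)
    moreover have "l powr (1 - p) * m = m powr (1 / p) * V powr (1 - 1 / p)"
    proof -
      have "l powr (1 - p) = (m / V) powr (1 / p - 1)" using p by (simp add: l_def powr_powr field_simps)
      then show ?thesis using m V(2) by (simp add: powr_divide powr_diff)
    qed
    ultimately show ?thesis by simp
  qed
  also have "V powr (1 - 1 / p) = unit_ball_vol CARD('n) powr (1 - 1 / p) * (t ^ CARD('n) * t powr (1 - CARD('n) / p - 1))"
  proof -
    have "V powr (1 - 1 / p) = unit_ball_vol CARD('n) powr (1 - 1 / p) * (t powr CARD('n)) powr (1 - 1 / p)"
      using t by (simp add: V powr_mult powr_realpow)
    also have "(t powr CARD('n)) powr (1 - 1 / p) = t powr CARD('n) * t powr (1 - CARD('n) / p - 1)"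
      by (simp add: powr_powr powr_add[symmetric] algebra_simps)
    finally show ?thesis using t by (simp add: powr_realpow)
  qed
  finally show ?thesis using l by (simp add: mult.assoc mult_left_mono)
qed

section \<open>The kernel as an approximate identity\<close>

lemma integral_lborel_affine:
  fixes g :: "'a::euclidean_space \<Rightarrow> real"
  assumes "g \<in> borel_measurable borel" "0 < c"
  shows "(\<integral>z. g z \<partial>lborel) = c ^ DIM('a) * (\<integral>z. g (t + c *\<^sub>R z) \<partial>lborel)"
proof -
  have "(\<integral>z. g z \<partial>lborel) = (\<integral>z. g z \<partial>density (distr lborel borel (\<lambda>x. t + c *\<^sub>R x)) (\<lambda>_. ennreal (c ^ DIM('a))))"
    using assms(2) lborel_affine[of c t] by simp
  also have "\<dots> = (\<integral>z. c ^ DIM('a) *\<^sub>R g z \<partial>distr lborel borel (\<lambda>x. t + c *\<^sub>R x))"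
    using assms by (intro integral_density) auto
  also have "\<dots> = (\<integral>z. c ^ DIM('a) *\<^sub>R g (t + c *\<^sub>R z) \<partial>lborel)"
    using assms by (intro integral_distr) auto
  finally show ?thesis by simp
qed

lemma integral_kern:
  fixes y :: "real^'n"
  assumes "0 < s"
  shows "(\<integral>z. kern y s z \<partial>lebesgue) = (\<integral>z. kern (0::real^'n) 1 z \<partial>lebesgue)"
proof -
  have m: "kern y s \<in> borel_measurable borel" for y :: "real^'n" and s
    by (intro borel_measurable_continuous_onI continuous_on_kern)
  have q: "kern y s (y + s *\<^sub>R z) = (1 / s) ^ CARD('n) * kern 0 1 z" for z
  proof -
    have "1 / s\<^sup>2 * (s\<^sup>2 - (y + s *\<^sub>R z - y) \<bullet> (y + s *\<^sub>R z - y)) = 1 - z \<bullet> z"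
      using assms by (simp add: field_simps power2_eq_square)
    then show ?thesis by (simp add: kern_def bump_def)
  qed
  have "(\<integral>z. kern y s z \<partial>lborel) = s ^ CARD('n) * (\<integral>z. (1 / s) ^ CARD('n) * kern (0::real^'n) 1 z \<partial>lborel)"
    using integral_lborel_affine[OF m assms, of y s y] by (simp add: q)
  then show ?thesis
    using assms m by (simp add: integral_completion power_divide)
qed

lemma integrable_kern: "0 < s \<Longrightarrow> integrable lebesgue (kern y s)"
proof -
  assume "0 < s"
  then have "integrable lborel (kern y s)"
    using ball_subset_cball kern_eq_0
    by (intro integrable_continuous_compact_support[OF continuous_on_kern compact_cball[of y s]]) blast
  then show ?thesis
    by (simp add: integrable_completion borel_measurable_continuous_onI continuous_on_kern)
qed

lemma integral_kern_pos: "0 < (\<integral>z. kern (0::real^'n) 1 z \<partial>lebesgue)"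
proof -
  have n: "0 \<le> kern (0::real^'n) 1 z" for z by (rule kern_nonneg) simp
  have "(\<integral>z. kern (0::real^'n) 1 z \<partial>lebesgue) \<noteq> 0"
  proof
    assume "(\<integral>z. kern (0::real^'n) 1 z \<partial>lebesgue) = 0"
    then have "AE z in lebesgue. kern (0::real^'n) 1 z = 0"
      using integral_nonneg_eq_0_iff_AE[OF integrable_kern[of 1 "0::real^'n"]] n by simp
    then have "AE z in lebesgue. z \<notin> ball (0::real^'n) 1"
      by eventually_elim (use bump_pos[of 1 _ "0::real^'n" 1] in \<open>force simp: kern_def\<close>)
    then have "ball (0::real^'n) 1 \<in> null_sets lebesgue"
      by (subst AE_iff_null_sets) (auto simp: borel_open)
    then show False
      using open_not_negligible[of "ball (0::real^'n) 1"] by (simp add: negligible_iff_null_sets)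
  qed
  moreover have "0 \<le> (\<integral>z. kern (0::real^'n) 1 z \<partial>lebesgue)" using n by (intro Bochner_Integration.integral_nonneg)
  ultimately show ?thesis by linarith
qed

text \<open>The kernel is at most \<open>(1 / s) ^ CARD('n)\<close> and supported in the ball of
  radius \<open>s\<close>, so the weighted mean of \<open>F z - F y\<close> is at most a constant
  times the plain mean of its absolute value, which tends to 0.\<close>

lemma Uk_lebesgue_point:
  fixes y :: "real^'n"
  assumes \<Omega>: "open \<Omega>" and li: "locally_integrable \<Omega> F" and y: "y \<in> \<Omega>" and lp: "lebesgue_point 1 F y"
  shows "(Uk \<Omega> F y \<longlongrightarrow> (\<integral>z. kern (0::real^'n) 1 z \<partial>lebesgue) * F y) (at_right 0)"
proof -
  let ?c = "\<integral>z. kern (0::real^'n) 1 z \<partial>lebesgue" and ?u = "unit_ball_vol (real CARD('n))"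
  obtain r where r: "0 < r" "cball y r \<subseteq> \<Omega>" using \<Omega> y open_contains_cball by blast
  have O: "\<Omega> \<in> sets lebesgue" using \<Omega> by (simp add: borel_open)
  have b: "\<bar>Uk \<Omega> F y s - ?c * F y\<bar> \<le> (1 / s) ^ CARD('n) * (\<integral>z. norm (F z - F y) powr 1 \<partial>lebesgue_on (ball y s))"
    if s: "0 < s" "s < r" for s
  proof -
    have sub: "ball y s \<subseteq> cball y s" "cball y s \<subseteq> \<Omega>" "ball y s \<subseteq> \<Omega>" using r s by (auto simp: subset_iff)
    have sets: "ball y s \<in> sets lebesgue" "cball y s \<in> sets lebesgue" by (auto simp: borel_open borel_closed)
    have iF: "integrable (lebesgue_on (cball y s)) F" using li sub by (auto simp: locally_integrable_def)
    have k0: "kern y s z = 0" if "z \<notin> cball y s" for z using that by (intro kern_eq_0[OF s(1)]) auto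
    have i1: "integrable (lebesgue_on \<Omega>) (\<lambda>z. F z * kern y s z)"
      by (rule integrable_times_compact_support[OF iF compact_cball sub(2) O continuous_on_kern k0])
    have i2: "integrable (lebesgue_on \<Omega>) (\<lambda>z. F y * kern y s z)"
      by (rule integrable_times_compact_support[OF _ compact_cball sub(2) O continuous_on_kern k0])
         (auto intro: integrable_on_compact_continuous)
    have "?c = (\<integral>z. kern y s z \<partial>lebesgue)" by (rule integral_kern[OF s(1), symmetric])
    also have "\<dots> = (\<integral>z. (if z \<in> \<Omega> then kern y s z else 0) \<partial>lebesgue)"
      using k0 subsetD[OF sub(2)] by (intro Bochner_Integration.integral_cong if_split[THEN iffD2]) metis+
    also have "\<dots> = (\<integral>z. kern y s z \<partial>lebesgue_on \<Omega>)" by (rule Lebesgue_Measure.integral_restrict_UNIV[OF O])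
    finally have "Uk \<Omega> F y s - ?c * F y = (\<integral>z. F z * kern y s z \<partial>lebesgue_on \<Omega>) - (\<integral>z. F y * kern y s z \<partial>lebesgue_on \<Omega>)"
      by (simp add: Uk_def mult.commute)
    also have "\<dots> = (\<integral>z. F z * kern y s z - F y * kern y s z \<partial>lebesgue_on \<Omega>)"
      by (rule Bochner_Integration.integral_diff[OF i1 i2, symmetric])
    finally have "norm (Uk \<Omega> F y s - ?c * F y) = norm (\<integral>z. F z * kern y s z - F y * kern y s z \<partial>lebesgue_on \<Omega>)"
      by simp
    also have "\<dots> \<le> (\<integral>z. (if z \<in> ball y s then (1 / s) ^ CARD('n) * norm (F z - F y) powr 1 else 0) \<partial>lebesgue_on \<Omega>)"
    proof (rule Bochner_Integration.integral_norm_bound_integral)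
      show "integrable (lebesgue_on \<Omega>) (\<lambda>z. F z * kern y s z - F y * kern y s z)" using i1 i2 by simp
      have "integrable (lebesgue_on (ball y s)) F" by (rule integrable_lebesgue_on_subset[OF iF sub(1) sets])
      then show "integrable (lebesgue_on \<Omega>) (\<lambda>z. if z \<in> ball y s then (1 / s) ^ CARD('n) * norm (F z - F y) powr 1 else 0)"
        by (intro integrable_lebesgue_on_if sub sets O)
          (auto intro!: integrable_mult_right Bochner_Integration.integrable_diff simp: finite_measure.integrable_const finite_measure_lebesgue_on)
      fix z
      show "norm (F z * kern y s z - F y * kern y s z) \<le> (if z \<in> ball y s then (1 / s) ^ CARD('n) * norm (F z - F y) powr 1 else 0)"
        using mult_left_mono[OF kern_le[OF s(1), of y z], of "\<bar>F z - F y\<bar>"] kern_nonneg[OF s(1), of y z] kern_eq_0[OF s(1), of z y]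
        by (auto simp: left_diff_distrib[symmetric] abs_mult mult.commute)
    qed
    also have "\<dots> = (\<integral>z. (1 / s) ^ CARD('n) * norm (F z - F y) powr 1 \<partial>lebesgue_on (ball y s))"
      by (rule Lebesgue_Measure.integral_restrict[OF sub(3) sets(1) O])
    finally show ?thesis by simp
  qed
  show ?thesis
  proof (rule tendstoI)
    fix e :: real assume e: "0 < e"
    \<comment> \<open>The volume \<open>?u\<close> of the unit ball cancels and leaves
      \<open>e / 2\<close>.\<close>
    define \<epsilon> where "\<epsilon> = e / (2 * ?u)"
    have u: "0 < ?u" by simp
    have "\<forall>\<^sub>F s in at_right 0. (\<integral>z. norm (F z - F y) powr 1 \<partial>lebesgue_on (ball y s)) \<le> \<epsilon> * measure lebesgue (ball y s)"
      using lp[unfolded lebesgue_point_def, rule_format, of \<epsilon>] divide_pos_pos[OF e, of "2 * ?u"] u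
      unfolding \<epsilon>_def by simp
    moreover have "\<forall>\<^sub>F s in at_right 0. s \<in> {0<..<r}" using r by (intro eventually_at_right_real)
    ultimately show "\<forall>\<^sub>F s in at_right 0. dist (Uk \<Omega> F y s) (?c * F y) < e"
    proof eventually_elim
      case (elim s)
      then have s: "0 < s" "s < r" by auto
      have "\<bar>Uk \<Omega> F y s - ?c * F y\<bar> \<le> (1 / s) ^ CARD('n) * (\<epsilon> * measure lebesgue (ball y s))"
        by (rule order_trans[OF b[OF s] mult_left_mono[OF elim(1)]]) (use s in auto)
      also have "measure lebesgue (ball y s) = ?u * s ^ CARD('n)" using measure_lebesgue_ball[of s y] s by simp
      also have "(1 / s) ^ CARD('n) * (\<epsilon> * (?u * s ^ CARD('n))) = e / 2"
        using s by (simp add: \<epsilon>_def power_divide order_less_imp_not_eq2[OF u])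
      finally show ?case using e by (simp add: dist_real_def)
    qed
  qed
qed

text \<open>The hypothesis is a Cauchy condition at 0: all values at radii up to \<open>s2\<close>
  differ from that at \<open>s2\<close> by at most \<open>C * s2 powr \<beta>\<close>. The limit is
  found along one sequence and transferred to all radii.\<close>

lemma tendsto_at_right_of_power_bound:
  fixes h :: "real \<Rightarrow> real"
  assumes \<beta>: "0 < \<beta>" and r: "0 < r" and C: "0 \<le> C" and h: "\<And>s1 s2. 0 < s1 \<Longrightarrow> s1 \<le> s2 \<Longrightarrow> s2 < r \<Longrightarrow> \<bar>h s2 - h s1\<bar> \<le> C * s2 powr \<beta>"
  obtains L where "(h \<longlongrightarrow> L) (at_right 0)"
proof -
  \<comment> \<open>The offset 2 makes already the first radius strictly smaller than
    \<open>r\<close>, as \<open>h\<close> demands.\<close>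
  have "Cauchy (\<lambda>k. h (r / real (k + 2)))"
  proof (rule CauchyI')
    fix e :: real assume e: "0 < e"
    have "(\<lambda>k. C * (r / real (k + 2)) powr \<beta>) \<longlonglongrightarrow> C * 0 powr \<beta>"
    proof (intro tendsto_intros tendsto_powr')
      show "(\<lambda>k. r / real (k + 2)) \<longlonglongrightarrow> 0"
        using LIMSEQ_ignore_initial_segment[OF tendsto_divide_0[OF tendsto_const filterlim_compose[OF filterlim_at_top_imp_at_infinity[OF filterlim_real_sequentially] filterlim_ident]], of r 2] by simp
    qed (use \<beta> r in auto)
    then have "\<forall>\<^sub>F k in sequentially. C * (r / real (k + 2)) powr \<beta> < e"
      using e by (intro order_tendstoD) auto
    then obtain M where M: "\<And>k. k \<ge> M \<Longrightarrow> C * (r / real (k + 2)) powr \<beta> < e" by (auto simp: eventually_sequentially)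
    show "\<exists>M. \<forall>m\<ge>M. \<forall>n>m. dist (h (r / real (m + 2))) (h (r / real (n + 2))) < e"
    proof (intro exI[of _ M] allI impI)
      fix m n :: nat assume mn: "M \<le> m" "m < n"
      have "\<bar>h (r / real (m + 2)) - h (r / real (n + 2))\<bar> \<le> C * (r / real (m + 2)) powr \<beta>"
        using r mn by (intro h) (auto simp: field_simps add_pos_nonneg)
      then show "dist (h (r / real (m + 2))) (h (r / real (n + 2))) < e" using M[OF mn(1)] by (simp add: dist_real_def)
    qed
  qed
  then obtain L where L: "(\<lambda>k. h (r / real (k + 2))) \<longlonglongrightarrow> L" by (metis Cauchy_convergent_iff convergent_def)
  have rk: "(\<lambda>k. r / real (k + 2)) \<longlonglongrightarrow> 0"
    using LIMSEQ_ignore_initial_segment[OF tendsto_divide_0[OF tendsto_const filterlim_compose[OF filterlim_at_top_imp_at_infinity[OF filterlim_real_sequentially] filterlim_ident]], of r 2] by simp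
  have b: "\<bar>h s - L\<bar> \<le> C * s powr \<beta>" if s: "0 < s" "s < r" for s
  proof (rule tendsto_upperbound[of "\<lambda>k. \<bar>h s - h (r / real (k + 2))\<bar>" _ sequentially])
    show "(\<lambda>k. \<bar>h s - h (r / real (k + 2))\<bar>) \<longlonglongrightarrow> \<bar>h s - L\<bar>" by (intro tendsto_intros L)
    have "\<forall>\<^sub>F k in sequentially. r / real (k + 2) < s" using rk s by (intro order_tendstoD)
    then show "\<forall>\<^sub>F k in sequentially. \<bar>h s - h (r / real (k + 2))\<bar> \<le> C * s powr \<beta>"
      by eventually_elim (use r s in \<open>auto intro!: h\<close>)
  qed simp
  have "(h \<longlongrightarrow> L) (at_right 0)"
  proof (rule Lim_null_comparison[THEN Lim_null[THEN iffD2]])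
    show "\<forall>\<^sub>F s in at_right 0. norm (h s - L) \<le> C * s powr \<beta>"
      using eventually_at_right_real[OF r] by eventually_elim (use b in auto)
    have "((\<lambda>s. C * s powr \<beta>) \<longlongrightarrow> C * 0 powr \<beta>) (at_right 0)"
      using \<beta> by (intro tendsto_intros tendsto_powr') (auto simp: eventually_at_filter)
    then show "((\<lambda>s. C * s powr \<beta>) \<longlongrightarrow> 0) (at_right 0)" by simp
  qed
  then show ?thesis by (rule that)
qed


text \<open>The set of disagreement is open and null, hence empty.\<close>

lemma continuous_AE_eq_imp_eq:
  fixes f g :: "'a::euclidean_space \<Rightarrow> 'b::real_normed_vector"
  assumes "open \<Omega>" "continuous_on \<Omega> f" "continuous_on \<Omega> g" "AE x in lebesgue. x \<in> \<Omega> \<longrightarrow> f x = g x" "x \<in> \<Omega>"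
  shows "f x = g x"
proof -
  let ?S = "{x \<in> \<Omega>. f x - g x \<in> - {0}}"
  have o: "open ?S"
    using continuous_open_preimage[OF continuous_on_diff[OF assms(2,3)] assms(1), of "- {0}"]
    by (simp add: Int_def vimage_def open_Compl)
  have "AE x in lebesgue. x \<notin> ?S" using assms(4) by eventually_elim auto
  then have "?S \<in> null_sets lebesgue" using o by (subst AE_iff_null_sets) (auto simp: borel_open)
  then have "?S = {}" using open_not_negligible[OF o] by (auto simp: negligible_iff_null_sets)
  then show ?thesis using assms(5) by auto
qed

text \<open>The bound is in terms of any positive \<open>m\<close> above the integral rather than
  the integral itself: \<open>Lp_growth\<close> divides by powers of \<open>m\<close>, and the right
  side is then convenient to specialise. As a predicate it serves both \<open>H\<close> and
  \<open>H\<close> minus a constant.\<close>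

definition Morrey_bound :: "(real^'n) set \<Rightarrow> (real^'n \<Rightarrow> real^'n) \<Rightarrow> real \<Rightarrow> real \<Rightarrow> (real^'n \<Rightarrow> real) \<Rightarrow> bool" where
  "Morrey_bound \<Omega> H p C Ft \<longleftrightarrow> (\<forall>x y s m. 0 < s \<and> cball x (3 * s) \<subseteq> \<Omega> \<and> dist x y \<le> s \<and> 0 < m \<and>
      (\<integral>z. norm (H z) powr p \<partial>lebesgue_on (cball x (3 * s))) \<le> m \<longrightarrow>
      \<bar>Ft y - Ft x\<bar> \<le> C * m powr (1 / p) * s powr (1 - CARD('n) / p))"

text \<open>The function is compared at \<open>x\<close> and \<open>y\<close> through its weighted
  means of radius \<open>s\<close>: two radial limits and one translation at that radius. The limit
  as the radius tends to 0 exists everywhere in \<open>\<Omega>\<close> and agrees with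
  \<open>F\<close> at its Lebesgue points, after division by the total mass \<open>c0\<close> of the
  kernel.\<close>

theorem Morrey:
  fixes H :: "real^'n \<Rightarrow> real^'n"
  assumes \<Omega>: "open \<Omega>" and wg: "weak_gradient \<Omega> F H" and p: "real CARD('n) < p"
    and Hp: "\<And>K. compact K \<Longrightarrow> K \<subseteq> \<Omega> \<Longrightarrow> integrable (lebesgue_on K) (\<lambda>z. norm (H z) powr p)"
  obtains Ft C where "0 \<le> C" "AE x in lebesgue. x \<in> \<Omega> \<longrightarrow> Ft x = F x" "Morrey_bound \<Omega> H p C Ft"
proof -
  define \<beta> where "\<beta> = 1 - CARD('n) / p"
  have n1: "1 \<le> real CARD('n)" using zero_less_card_finite[where 'a='n] by linarith
  have p1: "1 < p" using p n1 by linarith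
  have \<beta>: "0 < \<beta>" using p p1 by (simp add: \<beta>_def)
  define \<kappa> where "\<kappa> = 2 * unit_ball_vol CARD('n) powr (1 - 1 / p)"
  define c0 where "c0 = (\<integral>z. kern (0::real^'n) 1 z \<partial>lebesgue)"
  have c0: "0 < c0" unfolding c0_def by (rule integral_kern_pos)
  have \<kappa>: "0 \<le> \<kappa>" by (simp add: \<kappa>_def)
  have li: "locally_integrable \<Omega> F" "locally_integrable \<Omega> H" using wg by (auto simp: weak_gradient_def)
  have growth: "(\<integral>z. norm (H z) \<partial>lebesgue_on (ball y t)) \<le> (\<kappa> * m powr (1 / p)) * t ^ CARD('n) * t powr (\<beta> - 1)"
    if "cball x R \<subseteq> \<Omega>" "0 < m" "(\<integral>z. norm (H z) powr p \<partial>lebesgue_on (cball x R)) \<le> m" "0 < t" "ball y t \<subseteq> cball x R"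
    for x y R t m
  proof -
    have B: "cball x R \<in> sets lebesgue" "ball y t \<in> sets lebesgue" by (auto simp: borel_open borel_closed)
    have "integrable (lebesgue_on (cball x R)) H" using li(2) that(1) by (auto simp: locally_integrable_def)
    then have "integrable (lebesgue_on (ball y t)) H"
      by (rule integrable_lebesgue_on_subset[OF _ that(5) B(2,1)])
    from Lp_growth[OF p1 that(2) Hp[OF compact_cball that(1)] that(3) B(1) that(5,4) this]
    show ?thesis by (simp add: \<kappa>_def \<beta>_def mult_ac)
  qed
  have radial: "\<bar>Uk \<Omega> F y s2 - Uk \<Omega> F y s1\<bar> \<le> (\<kappa> * m powr (1 / p)) / \<beta> * s2 powr \<beta>"
    if "cball x R \<subseteq> \<Omega>" "0 < m" "(\<integral>z. norm (H z) powr p \<partial>lebesgue_on (cball x R)) \<le> m"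
      "cball y r \<subseteq> cball x R" "0 < s1" "s1 \<le> s2" "s2 < r" for x y R m r s1 s2
  proof (rule Uk_radial_bound[OF \<Omega> wg order_trans[OF that(4,1)] \<beta>])
    show "0 \<le> \<kappa> * m powr (1 / p)" using \<kappa> by simp
    fix t assume "0 < t" "t < r"
    then show "(\<integral>z. norm (H z) \<partial>lebesgue_on (ball y t)) \<le> (\<kappa> * m powr (1 / p)) * t ^ CARD('n) * t powr (\<beta> - 1)"
      using that by (intro growth[of x R]) (auto simp: subset_iff)
  qed (use that in auto)
  define L where "L y = Lim (at_right 0) (Uk \<Omega> F y)" for y
  have lim: "(Uk \<Omega> F y \<longlongrightarrow> L y) (at_right 0)" if "y \<in> \<Omega>" for y
  proof -
    have "\<exists>r>0. cball y r \<subseteq> \<Omega>" using \<Omega> that by (simp add: open_contains_cball)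
    then obtain r where r: "0 < r" "cball y r \<subseteq> \<Omega>" by (elim exE conjE)
    \<comment> \<open>The \<open>+ 1\<close> makes \<open>m\<close> positive even where
      \<open>H\<close> vanishes.\<close>
    define m where "m = (\<integral>z. norm (H z) powr p \<partial>lebesgue_on (cball y r)) + 1"
    have "0 \<le> (\<integral>z. norm (H z) powr p \<partial>lebesgue_on (cball y r))"
      by (rule Bochner_Integration.integral_nonneg) (rule powr_ge_zero)
    then have m: "0 < m" "(\<integral>z. norm (H z) powr p \<partial>lebesgue_on (cball y r)) \<le> m"
      unfolding m_def by linarith+
    have nn: "0 \<le> \<kappa> * m powr (1 / p) / \<beta>" using \<kappa> \<beta> by simp
    have "\<exists>l. (Uk \<Omega> F y \<longlongrightarrow> l) (at_right 0)"
      by (rule tendsto_at_right_of_power_bound[OF \<beta> r(1) nn radial[OF r(2) m order_refl]]) auto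
    then obtain l where "(Uk \<Omega> F y \<longlongrightarrow> l) (at_right 0)" by (rule exE)
    then show ?thesis unfolding L_def by (subst tendsto_Lim) auto
  qed
  define Ft where "Ft y = L y / c0" for y
  have "AE y in lebesgue. y \<in> \<Omega> \<longrightarrow> lebesgue_point 1 F y"
    using li(1) by (intro AE_lebesgue_point[OF \<Omega>]) (auto simp: locally_integrable_def)
  then have AE: "AE y in lebesgue. y \<in> \<Omega> \<longrightarrow> Ft y = F y"
  proof eventually_elim
    case (elim y)
    show ?case
    proof
      assume y: "y \<in> \<Omega>"
      then have "(Uk \<Omega> F y \<longlongrightarrow> c0 * F y) (at_right 0)"
        unfolding c0_def using elim by (intro Uk_lebesgue_point[OF \<Omega> li(1)]) auto
      with lim[OF y] have "L y = c0 * F y" by (intro tendsto_unique[of "at_right 0"]) auto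
      then show "Ft y = F y" using c0 by (simp add: Ft_def)
    qed
  qed
  \<comment> \<open>\<open>2 / \<beta>\<close> stems from the two radial estimates, \<open>1\<close>
    from the translation; \<open>\<kappa>\<close> is the constant of
    \<open>Lp_growth\<close>.\<close>
  define C where "C = (2 / \<beta> + 1) * \<kappa> / c0"
  have est: "\<bar>Ft y - Ft x\<bar> \<le> C * m powr (1 / p) * s powr \<beta>"
    if s: "0 < s" "cball x (3 * s) \<subseteq> \<Omega>" "dist x y \<le> s" and m: "0 < m"
      "(\<integral>z. norm (H z) powr p \<partial>lebesgue_on (cball x (3 * s))) \<le> m" for x y s m
  proof -
    define N where "N = \<kappa> * m powr (1 / p)"
    have N: "0 \<le> N" using \<kappa> by (simp add: N_def)
    have close: "\<bar>Uk \<Omega> F y' s - L y'\<bar> \<le> N / \<beta> * s powr \<beta>" if "dist x y' \<le> s" for y'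
    proof (rule tendsto_upperbound[of "\<lambda>t. \<bar>Uk \<Omega> F y' s - Uk \<Omega> F y' t\<bar>" _ "at_right 0"])
      have "y' \<in> \<Omega>" using s that by (auto simp: subset_iff)
      then show "((\<lambda>t. \<bar>Uk \<Omega> F y' s - Uk \<Omega> F y' t\<bar>) \<longlongrightarrow> \<bar>Uk \<Omega> F y' s - L y'\<bar>) (at_right 0)"
        by (intro tendsto_intros lim)
      \<comment> \<open>The radial estimate requires a ball strictly larger than the radius
        \<open>s\<close> at which it is used; \<open>2 * s\<close> still fits into the enlarged ball
        around \<open>x\<close>.\<close>
      have sub: "cball y' (2 * s) \<subseteq> cball x (3 * s)" using that by (simp add: cball_subset_cball_iff dist_commute)
      show "\<forall>\<^sub>F t in at_right 0. \<bar>Uk \<Omega> F y' s - Uk \<Omega> F y' t\<bar> \<le> N / \<beta> * s powr \<beta>"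
        using eventually_at_right_real[OF s(1)]
        by eventually_elim (use radial[OF s(2) m sub] s(1) in \<open>auto simp: N_def\<close>)
    qed simp
    have "\<bar>Uk \<Omega> F y s - Uk \<Omega> F x s\<bar> \<le> dist x y * ((1 / s) ^ CARD('n) * (N * s ^ CARD('n) * s powr (\<beta> - 1)))"
    proof (rule Uk_translate_bound[OF \<Omega> wg s(2,1,3)])
      fix y' assume "dist x y' \<le> s"
      then have "ball y' s \<subseteq> cball x (3 * s)" using s(1) by (simp add: ball_subset_cball_iff dist_commute)
      then show "(\<integral>z. norm (H z) \<partial>lebesgue_on (ball y' s)) \<le> N * s ^ CARD('n) * s powr (\<beta> - 1)"
        unfolding N_def using growth[OF s(2) m s(1)] by blast
    qed
    also have "\<dots> = dist x y * (N * s powr (\<beta> - 1))" using s(1) by (simp add: power_divide)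
    also have "\<dots> \<le> s * (N * s powr (\<beta> - 1))" using s N by (intro mult_right_mono) auto
    also have "\<dots> = N * s powr \<beta>" using s(1) by (simp add: powr_diff)
    finally have "\<bar>L y - L x\<bar> \<le> 2 * (N / \<beta> * s powr \<beta>) + N * s powr \<beta>"
      using close[OF s(3)] close[of x] s(1) by auto
    then have "\<bar>L y - L x\<bar> / c0 \<le> (2 * (N / \<beta> * s powr \<beta>) + N * s powr \<beta>) / c0"
      using c0 by (intro divide_right_mono) auto
    also have "\<dots> = C * m powr (1 / p) * s powr \<beta>"
      by (simp add: C_def N_def add_divide_distrib algebra_simps)
    also have "\<bar>L y - L x\<bar> / c0 = \<bar>Ft y - Ft x\<bar>" using c0 by (simp add: Ft_def abs_divide flip: diff_divide_distrib)
    finally show ?thesis .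
  qed
  have "0 \<le> C" using \<beta> \<kappa> c0 by (simp add: C_def)
  moreover have "Morrey_bound \<Omega> H p C Ft" unfolding Morrey_bound_def \<beta>_def[symmetric] using est by blast
  ultimately show ?thesis using that[of C Ft] AE by blast
qed

section \<open>Continuity and differentiability of the representative\<close>

lemma weak_gradient_diff:
  assumes "open \<Omega>" "weak_gradient \<Omega> f G" "weak_gradient \<Omega> g H"
  shows "weak_gradient \<Omega> (\<lambda>x. f x - g x) (\<lambda>x. G x - H x)"
  unfolding weak_gradient_def
proof (intro conjI allI impI)
  have li: "locally_integrable \<Omega> f" "locally_integrable \<Omega> G" "locally_integrable \<Omega> g" "locally_integrable \<Omega> H"
    using assms by (auto simp: weak_gradient_def)
  then show "locally_integrable \<Omega> (\<lambda>x. f x - g x)" "locally_integrable \<Omega> (\<lambda>x. G x - H x)"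
    by (auto intro: locally_integrable_diff)
  fix \<phi> j assume \<phi>: "test_function \<Omega> \<phi>"
  note I = integrable_times_test[OF _ assms(1) \<phi>]
  show "(\<integral>x. (f x - g x) * partial_deriv j \<phi> x \<partial>lebesgue_on \<Omega>) = - (\<integral>x. (G x - H x) $ j * \<phi> x \<partial>lebesgue_on \<Omega>)"
    using assms(2,3) \<phi> I(2)[OF li(1)] I(2)[OF li(3)]
      I(1)[OF locally_integrable_nth[OF li(2)]] I(1)[OF locally_integrable_nth[OF li(4)]]
    by (simp add: weak_gradient_def left_diff_distrib)
qed

lemma weak_gradient_affine:
  assumes "open \<Omega>"
  shows "weak_gradient \<Omega> (\<lambda>z. a + l \<bullet> (z - x)) (\<lambda>_. l)"
  using weak_gradient_component[OF weak_derivative_affine[OF assms, of "vec a" "(\<chi> i. l) :: real^_^1" x], of 1]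
  by (simp add: matrix_vector_mult_def inner_vec_def)

lemma integral_cball_mono:
  fixes g :: "'a::euclidean_space \<Rightarrow> real"
  assumes "integrable (lebesgue_on T) g" "\<And>z. 0 \<le> g z" "S \<subseteq> T" "S \<in> sets lebesgue" "T \<in> sets lebesgue"
  shows "(\<integral>z. g z \<partial>lebesgue_on S) \<le> (\<integral>z. g z \<partial>lebesgue_on T)"
  by (rule integral_mono_lebesgue_on_AE) (use assms in auto)

text \<open>With \<open>s = dist x y\<close> the bound is a Hoelder estimate at \<open>x\<close>,
  where \<open>m\<close> can be taken from one fixed ball.\<close>

lemma Morrey_continuous:
  fixes H :: "real^'n \<Rightarrow> real^'n"
  assumes \<Omega>: "open \<Omega>" and p: "real CARD('n) < p" and C: "0 \<le> C"
    and Hp: "\<And>K. compact K \<Longrightarrow> K \<subseteq> \<Omega> \<Longrightarrow> integrable (lebesgue_on K) (\<lambda>z. norm (H z) powr p)"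
    and est: "Morrey_bound \<Omega> H p C Ft"
  shows "continuous_on \<Omega> Ft"
proof (rule continuous_at_imp_continuous_on, rule ballI)
  fix x assume "x \<in> \<Omega>"
  then have "\<exists>r>0. cball x r \<subseteq> \<Omega>" using \<Omega> by (simp add: open_contains_cball)
  then obtain r where r: "0 < r" "cball x r \<subseteq> \<Omega>" by (elim exE conjE)
  define m where "m = (\<integral>z. norm (H z) powr p \<partial>lebesgue_on (cball x r)) + 1"
  have "0 \<le> (\<integral>z. norm (H z) powr p \<partial>lebesgue_on (cball x r))"
    by (rule Bochner_Integration.integral_nonneg) (rule powr_ge_zero)
  then have m: "0 < m" "(\<integral>z. norm (H z) powr p \<partial>lebesgue_on (cball x r)) \<le> m"
    unfolding m_def by linarith+
  define \<beta> where "\<beta> = 1 - CARD('n) / p"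
  have \<beta>: "0 < \<beta>" using p by (simp add: \<beta>_def)
  have b: "\<bar>Ft y - Ft x\<bar> \<le> C * m powr (1 / p) * dist x y powr \<beta>" if y: "y \<noteq> x" "dist x y < r / 3" for y
  proof -
    have s: "0 < dist x y" "cball x (3 * dist x y) \<subseteq> cball x r" using y by auto
    have "(\<integral>z. norm (H z) powr p \<partial>lebesgue_on (cball x (3 * dist x y))) \<le> (\<integral>z. norm (H z) powr p \<partial>lebesgue_on (cball x r))"
      using s r by (intro integral_cball_mono Hp) (auto simp: borel_closed)
    then show ?thesis
      unfolding \<beta>_def using s m r by (intro est[unfolded Morrey_bound_def, rule_format] conjI) auto
  qed
  have "(Ft \<longlongrightarrow> Ft x) (at x)"
  proof (rule Lim_null[THEN iffD2], rule Lim_null_comparison)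
    show "\<forall>\<^sub>F y in at x. norm (Ft y - Ft x) \<le> C * m powr (1 / p) * dist x y powr \<beta>"
      unfolding eventually_at using r b by (intro exI[of _ "r / 3"]) (auto simp: dist_commute)
    have "((\<lambda>y. C * m powr (1 / p) * dist x y powr \<beta>) \<longlongrightarrow> C * m powr (1 / p) * 0 powr \<beta>) (at x)"
    proof (intro tendsto_intros tendsto_powr')
      show "((\<lambda>y. dist x y) \<longlongrightarrow> 0) (at x)"
        using tendsto_dist[OF tendsto_const tendsto_ident_at, of x x UNIV] by simp
    qed (use \<beta> in auto)
    then show "((\<lambda>y. C * m powr (1 / p) * dist x y powr \<beta>) \<longlongrightarrow> 0) (at x)" by simp
  qed
  then show "isCont Ft x" by (simp add: isCont_def)
qed

text \<open>At a Lebesgue point of order \<open>p\<close> the integral of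
  \<open>norm (H z - H x) powr p\<close> over a ball of radius comparable to \<open>s\<close> is a
  small multiple of \<open>s ^ n\<close>. Its \<open>p\<close>-th root contributes
  \<open>s powr (n / p)\<close>, which complements \<open>s powr (1 - n / p)\<close> in the Morrey
  bound to exactly \<open>s\<close>, so the remainder is small against the distance.\<close>

theorem Morrey_representative:
  fixes H :: "real^'n \<Rightarrow> real^'n"
  assumes \<Omega>: "open \<Omega>" and wg: "weak_gradient \<Omega> F H" and p: "real CARD('n) < p"
    and Hp: "\<And>K. compact K \<Longrightarrow> K \<subseteq> \<Omega> \<Longrightarrow> integrable (lebesgue_on K) (\<lambda>z. norm (H z) powr p)"
  obtains Ft where "continuous_on \<Omega> Ft" "AE x in lebesgue. x \<in> \<Omega> \<longrightarrow> Ft x = F x"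
    "\<And>x. x \<in> \<Omega> \<Longrightarrow> lebesgue_point p H x \<Longrightarrow> (Ft has_derivative (\<lambda>h. H x \<bullet> h)) (at x)"
proof -
  obtain Ft C where Ft: "0 \<le> C" "AE x in lebesgue. x \<in> \<Omega> \<longrightarrow> Ft x = F x" "Morrey_bound \<Omega> H p C Ft"
    by (rule Morrey[OF \<Omega> wg p Hp]) blast
  have cF: "continuous_on \<Omega> Ft" by (rule Morrey_continuous[OF \<Omega> p Ft(1) Hp Ft(3)])
  have p0: "0 < p" using p of_nat_0_le_iff[of "CARD('n)"] by linarith
  have "(Ft has_derivative (\<lambda>h. H x \<bullet> h)) (at x)" if x: "x \<in> \<Omega>" and lp: "lebesgue_point p H x" for x
  proof -
    let ?H = "\<lambda>z. H z - H x"
    have liH: "locally_integrable \<Omega> H" using wg by (simp add: weak_gradient_def)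
    have wg': "weak_gradient \<Omega> (\<lambda>z. F z - (0 + H x \<bullet> (z - x))) ?H"
      by (rule weak_gradient_diff[OF \<Omega> wg weak_gradient_affine[OF \<Omega>]])
    have Hp': "integrable (lebesgue_on K) (\<lambda>z. norm (?H z) powr p)" if "compact K" "K \<subseteq> \<Omega>" for K
    proof (rule integrable_powr_diff_const[OF _ Hp[OF that]])
      show "H \<in> borel_measurable (lebesgue_on K)" using liH that by (auto simp: locally_integrable_def)
    qed (use that p0 in \<open>auto intro: lmeasurable_compact\<close>)
    obtain F' C' where F': "0 \<le> C'" "AE z in lebesgue. z \<in> \<Omega> \<longrightarrow> F' z = F z - (0 + H x \<bullet> (z - x))"
      "Morrey_bound \<Omega> ?H p C' F'"
      by (rule Morrey[OF \<Omega> wg' p Hp']) blast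
    have cF': "continuous_on \<Omega> F'" by (rule Morrey_continuous[OF \<Omega> p F'(1) Hp' F'(3)])
    \<comment> \<open>The representative \<open>F'\<close> comes from a second use of
      \<open>Morrey\<close>; only almost everywhere equality and continuity tie it to
      \<open>Ft\<close>.\<close>
    have eq: "F' z = Ft z - H x \<bullet> (z - x)" if "z \<in> \<Omega>" for z
    proof (rule continuous_AE_eq_imp_eq[OF \<Omega> cF' _ _ that])
      show "continuous_on \<Omega> (\<lambda>z. Ft z - H x \<bullet> (z - x))" by (intro continuous_intros cF)
      show "AE z in lebesgue. z \<in> \<Omega> \<longrightarrow> F' z = Ft z - H x \<bullet> (z - x)"
        using F'(2) Ft(2) by eventually_elim simp
    qed
    let ?u = "unit_ball_vol (real CARD('n))"
    have u: "0 < ?u" by simp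
    have "\<exists>r>0. cball x r \<subseteq> \<Omega>" using \<Omega> x by (simp add: open_contains_cball)
    then obtain r where r: "0 < r" "cball x r \<subseteq> \<Omega>" by (elim exE conjE)
    show ?thesis
      unfolding has_derivative_at_alt
    proof (intro conjI allI impI)
      show "bounded_linear (\<lambda>h. H x \<bullet> h)" by (rule bounded_linear_inner_right)
      fix e :: real assume e: "0 < e"
      \<comment> \<open>Chosen so that \<open>m powr (1 / p)\<close> becomes
        \<open>e / (C' + 1) * s powr (n / p)\<close>. The factor \<open>4 ^ CARD('n)\<close> belongs
        to the open ball of radius \<open>4 * s\<close> around the closed one of radius
        \<open>3 * s\<close>; \<open>C' + 1\<close> avoids dividing by 0.\<close>
      define \<epsilon> where "\<epsilon> = (e / (C' + 1)) powr p / (?u * 4 ^ CARD('n))"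
      have "0 < (e / (C' + 1)) powr p" using e F'(1) by simp
      then have \<epsilon>: "0 < \<epsilon>" unfolding \<epsilon>_def using u by (intro divide_pos_pos mult_pos_pos) auto
      from lp[unfolded lebesgue_point_def, rule_format, OF \<epsilon>] obtain d where d: "0 < d"
        "\<And>t. 0 < t \<Longrightarrow> t < d \<Longrightarrow> (\<integral>z. norm (?H z) powr p \<partial>lebesgue_on (ball x t)) \<le> \<epsilon> * measure lebesgue (ball x t)"
        unfolding eventually_at_right_field by blast
      show "\<exists>d>0. \<forall>y. norm (y - x) < d \<longrightarrow> norm (Ft y - Ft x - H x \<bullet> (y - x)) \<le> e * norm (y - x)"
      proof (intro exI[of _ "min d r / 4"] conjI allI impI)
        show "0 < min d r / 4" using d r by simp
        fix y assume y: "norm (y - x) < min d r / 4"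
        define s where "s = norm (y - x)"
        show "norm (Ft y - Ft x - H x \<bullet> (y - x)) \<le> e * norm (y - x)"
        proof (cases "y = x")
          case False
          then have s: "0 < s" "4 * s < d" "4 * s < r" using y by (auto simp: s_def)
          define m where "m = \<epsilon> * (?u * (4 * s) ^ CARD('n))"
          have m: "0 < m" using \<epsilon> u s by (simp add: m_def)
          have sub: "cball x (3 * s) \<subseteq> ball x (4 * s)" "ball x (4 * s) \<subseteq> cball x r" "cball x (3 * s) \<subseteq> \<Omega>"
            using s r(2) by (auto simp: subset_iff)
          have "integrable (lebesgue_on (cball x r)) (\<lambda>z. norm (?H z) powr p)" by (rule Hp'[OF compact_cball r(2)])
          then have "integrable (lebesgue_on (ball x (4 * s))) (\<lambda>z. norm (?H z) powr p)"
            by (rule integrable_lebesgue_on_subset[OF _ sub(2)]) (auto simp: borel_open borel_closed)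
          then have "(\<integral>z. norm (?H z) powr p \<partial>lebesgue_on (cball x (3 * s))) \<le> (\<integral>z. norm (?H z) powr p \<partial>lebesgue_on (ball x (4 * s)))"
            using sub(1) by (intro integral_cball_mono) (auto simp: borel_open borel_closed)
          also have "\<dots> \<le> \<epsilon> * measure lebesgue (ball x (4 * s))" using s by (intro d(2)) auto
          also have "\<dots> = m" using measure_lebesgue_ball[of "4 * s" x] s by (simp add: m_def)
          finally have "\<bar>F' y - F' x\<bar> \<le> C' * m powr (1 / p) * s powr (1 - CARD('n) / p)"
            using s sub(3) m by (intro F'(3)[unfolded Morrey_bound_def, rule_format] conjI) (auto simp: s_def dist_norm norm_minus_commute)
          also have "m powr (1 / p) = e / (C' + 1) * s powr (CARD('n) / p)"
          proof -
            have "m = (e / (C' + 1)) powr p * s powr CARD('n)"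
              using s order_less_imp_not_eq2[OF u] by (simp add: m_def \<epsilon>_def power_mult_distrib powr_realpow)
            then show ?thesis using e F'(1) s p0 by (simp add: powr_mult powr_powr)
          qed
          also have "C' * (e / (C' + 1) * s powr (CARD('n) / p)) * s powr (1 - CARD('n) / p) = C' * (e / (C' + 1)) * s"
            using s by (simp add: mult.assoc flip: powr_add)
          also have "\<dots> \<le> e * s"
            using F'(1) e s by (intro mult_right_mono) (auto simp: field_simps)
          finally have "\<bar>F' y - F' x\<bar> \<le> e * s" .
          moreover have "dist x y \<le> r" using s unfolding dist_norm norm_minus_commute[of x y] s_def by linarith
          then have "y \<in> \<Omega>" using r(2) by auto
          ultimately show ?thesis using eq x by (simp add: s_def algebra_simps)
        qed simp
      qed
    qed
  qed
  then show ?thesis using that[of Ft] cF Ft(2) by blast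
qed

text \<open>A Lebesgue point of the matrix \<open>G\<close> is one of each row, since a component is
  bounded by the norm. Hence a single condition at \<open>x\<close> makes all components
  differentiable.\<close>

theorem Sobolev_representative:
  fixes f :: "real^'n \<Rightarrow> real^'m"
  assumes \<Omega>: "open \<Omega>" and wd: "weak_derivative \<Omega> f G" and p: "real CARD('n) < p"
    and Gp: "\<And>K. compact K \<Longrightarrow> K \<subseteq> \<Omega> \<Longrightarrow> integrable (lebesgue_on K) (\<lambda>z. norm (G z) powr p)"
  obtains ft where "continuous_on \<Omega> ft" "AE x in lebesgue. x \<in> \<Omega> \<longrightarrow> ft x = f x"
    "\<And>x. x \<in> \<Omega> \<Longrightarrow> lebesgue_point p G x \<Longrightarrow> (ft has_derivative (\<lambda>h. G x *v h)) (at x)"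
proof -
  have p0: "0 \<le> p" using p of_nat_0_le_iff[of "CARD('n)"] by linarith
  have liG: "locally_integrable \<Omega> G" using wd by (simp add: weak_derivative_def)
  have Gi: "integrable (lebesgue_on K) (\<lambda>z. norm (G z $ i) powr p)" if "compact K" "K \<subseteq> \<Omega>" for K i
  proof (rule Bochner_Integration.integrable_bound[OF Gp[OF that]])
    have "integrable (lebesgue_on K) (\<lambda>z. G z $ i)"
      using locally_integrable_nth[OF liG] that by (auto simp: locally_integrable_def)
    then show "(\<lambda>z. norm (G z $ i) powr p) \<in> borel_measurable (lebesgue_on K)" by measurable
    show "AE z in lebesgue_on K. norm (norm (G z $ i) powr p) \<le> norm (norm (G z) powr p)"
      using p0 by (auto intro!: AE_I2 powr_mono2 Finite_Cartesian_Product.norm_nth_le)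
  qed
  have "\<forall>i. \<exists>Ft. continuous_on \<Omega> Ft \<and> (AE x in lebesgue. x \<in> \<Omega> \<longrightarrow> Ft x = f x $ i) \<and>
    (\<forall>x\<in>\<Omega>. lebesgue_point p (\<lambda>z. G z $ i) x \<longrightarrow> (Ft has_derivative (\<lambda>h. G x $ i \<bullet> h)) (at x))"
    by (intro allI, rule Morrey_representative[OF \<Omega> weak_gradient_component[OF wd] p Gi]) blast+
  from choice[OF this] obtain Fi where Fi': "\<forall>i. continuous_on \<Omega> (Fi i) \<and> (AE x in lebesgue. x \<in> \<Omega> \<longrightarrow> Fi i x = f x $ i) \<and>
    (\<forall>x\<in>\<Omega>. lebesgue_point p (\<lambda>z. G z $ i) x \<longrightarrow> (Fi i has_derivative (\<lambda>h. G x $ i \<bullet> h)) (at x))"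
    by (rule exE)
  have Fi: "continuous_on \<Omega> (Fi i)" "AE x in lebesgue. x \<in> \<Omega> \<longrightarrow> Fi i x = f x $ i"
    "x \<in> \<Omega> \<Longrightarrow> lebesgue_point p (\<lambda>z. G z $ i) x \<Longrightarrow> (Fi i has_derivative (\<lambda>h. G x $ i \<bullet> h)) (at x)" for i x
    using Fi' by blast+
  have lpi: "lebesgue_point p (\<lambda>z. G z $ i) x" if x: "x \<in> \<Omega>" and lp: "lebesgue_point p G x" for x i
    unfolding lebesgue_point_def
  proof (intro allI impI)
    fix \<epsilon> :: real assume "0 < \<epsilon>"
    then have ev: "\<forall>\<^sub>F r in at_right 0. (\<integral>z. norm (G z - G x) powr p \<partial>lebesgue_on (ball x r)) \<le> \<epsilon> * measure lebesgue (ball x r)"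
      using lp by (simp add: lebesgue_point_def)
    have "\<exists>r>0. cball x r \<subseteq> \<Omega>" using \<Omega> x by (simp add: open_contains_cball)
    then obtain R where R: "0 < R" "cball x R \<subseteq> \<Omega>" by (elim exE conjE)
    show "\<forall>\<^sub>F r in at_right 0. (\<integral>z. norm (G z $ i - G x $ i) powr p \<partial>lebesgue_on (ball x r)) \<le> \<epsilon> * measure lebesgue (ball x r)"
      using ev eventually_at_right_real[OF R(1)]
    proof eventually_elim
      case (elim r)
      have "integrable (lebesgue_on (cball x R)) G"
        using liG R(2) unfolding locally_integrable_def by simp
      then have m: "G \<in> borel_measurable (lebesgue_on (cball x R))" by (rule borel_measurable_integrable)
      have "integrable (lebesgue_on (cball x R)) (\<lambda>z. norm (G z - G x) powr p)"
        by (rule integrable_powr_diff_const[OF m Gp[OF compact_cball R(2)]]) (use p0 in auto)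
      then have "integrable (lebesgue_on (ball x r)) (\<lambda>z. norm (G z - G x) powr p)"
        by (rule integrable_lebesgue_on_subset) (use elim in \<open>auto simp: borel_open borel_closed\<close>)
      then have "(\<integral>z. norm (G z $ i - G x $ i) powr p \<partial>lebesgue_on (ball x r)) \<le> (\<integral>z. norm (G z - G x) powr p \<partial>lebesgue_on (ball x r))"
        by (rule integral_mono_lebesgue_on_AE)
          (use p0 Finite_Cartesian_Product.norm_nth_le[of "G _ - G x" i] in \<open>auto intro!: powr_mono2 simp: borel_open\<close>)
      then show ?case using elim(1) by linarith
    qed
  qed
  define ft where "ft x = (\<chi> i. Fi i x)" for x
  show ?thesis
  proof (rule that[of ft])
    show "continuous_on \<Omega> ft" unfolding ft_def[abs_def] by (intro continuous_on_vec_lambda Fi)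
    have "AE x in lebesgue. \<forall>i. x \<in> \<Omega> \<longrightarrow> Fi i x = f x $ i" using Fi(2) by (subst AE_all_countable) simp
    then show "AE x in lebesgue. x \<in> \<Omega> \<longrightarrow> ft x = f x" by eventually_elim (simp add: ft_def vec_eq_iff)
    fix x assume x: "x \<in> \<Omega>" "lebesgue_point p G x"
    have "((\<lambda>x. ft x $ i) has_derivative (\<lambda>h. (G x *v h) $ i)) (at x)" for i
      using Fi(3)[OF x(1) lpi[OF x]] by (simp add: ft_def matrix_vector_mult_def inner_vec_def)
    then show "(ft has_derivative (\<lambda>h. G x *v h)) (at x)"
      by (subst has_derivative_componentwise_within) (auto simp: Basis_vec_def inner_axis)
  qed
qed

section \<open>Mean values of the weak derivative at points of differentiability\<close>

lemma rho_0_tendsto_1: "0 < t \<Longrightarrow> (\<lambda>k. rho 0 (real (Suc k) * t)) \<longlonglongrightarrow> 1"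
proof -
  assume t: "0 < t"
  have "(\<lambda>k. exp (- (inverse (real (Suc k)) * (1 / t)))) \<longlonglongrightarrow> exp (- (0 * (1 / t)))"
    by (intro tendsto_intros LIMSEQ_inverse_real_of_nat)
  then show ?thesis using t by (simp add: rho_def divide_inverse mult_ac)
qed

text \<open>The cutoff \<open>\<phi>\<close> increases to the indicator of the ball and is radially decreasing, so that
  \<open>\<integral> norm (z - x) * norm (\<nabla>\<phi>) = - \<integral> (z - x) \<bullet> \<nabla>\<phi> = n * \<integral> \<phi>\<close>, whatever its steepness.\<close>

lemma gradient_mean_bound:
  fixes x :: "real^'n"
  assumes \<Omega>: "open \<Omega>" and wg: "weak_gradient \<Omega> F H" and r: "0 < r" "cball x r \<subseteq> \<Omega>" and \<epsilon>: "0 \<le> \<epsilon>"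
    and F: "AE z in lebesgue. z \<in> ball x r \<longrightarrow> \<bar>F z\<bar> \<le> \<epsilon> * norm (z - x)"
  shows "\<bar>\<integral>z. H z $ j \<partial>lebesgue_on (ball x r)\<bar> \<le> \<epsilon> * CARD('n) * measure lebesgue (ball x r)"
proof -
  define \<phi> where "\<phi> k = bump x r (real (Suc k))" for k
  define V where "V = measure lebesgue (ball x r)"
  have li: "locally_integrable \<Omega> F" "locally_integrable \<Omega> H" using wg by (auto simp: weak_gradient_def)
  have sub: "ball x r \<subseteq> \<Omega>" "ball x r \<subseteq> cball x r" using r by (auto simp: subset_iff)
  have sets: "ball x r \<in> sets lebesgue" "\<Omega> \<in> sets lebesgue" "cball x r \<in> sets lebesgue" using \<Omega> by (auto simp: borel_open borel_closed)
  have test: "test_function \<Omega> (\<phi> k)" for k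
    using test_function_times_bump[OF C_times_const[of _ 1] r(1) _ r(2), of "real (Suc k)"] by (simp add: \<phi>_def[abs_def])
  have out: "\<phi> k z = 0" if "z \<notin> ball x r" for k z
    unfolding \<phi>_def by (rule bump_eq_0) (use r that in auto)
  have bd: "0 \<le> \<phi> k z" "\<phi> k z \<le> 1" for k z unfolding \<phi>_def bump_def by (rule rho_0_nonneg rho_0_le)+
  have iH: "integrable (lebesgue_on (ball x r)) (\<lambda>z. H z $ j)"
  proof -
    have "integrable (lebesgue_on (cball x r)) (\<lambda>z. H z $ j)"
      using locally_integrable_nth[OF li(2)] r(2) by (simp add: locally_integrable_def)
    then show ?thesis by (rule integrable_lebesgue_on_subset[OF _ sub(2) sets(1,3)])
  qed
  have pd: "partial_deriv i (\<phi> k) z = - 2 * real (Suc k) * (z $ i - x $ i) * rho 1 (real (Suc k) * (r\<^sup>2 - (z - x) \<bullet> (z - x)))" for i k z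
    unfolding \<phi>_def by (rule partial_deriv_bump)
  \<comment> \<open>This is \<open>norm (z - x)\<close> times the length of the gradient of
    \<open>\<phi> k\<close>, written without absolute values thanks to the sign of
    \<open>rho 1\<close>.\<close>
  define g where "g k z = 2 * real (Suc k) * ((z - x) \<bullet> (z - x)) * rho 1 (real (Suc k) * (r\<^sup>2 - (z - x) \<bullet> (z - x)))" for k z
  have gsum: "g k z = - (\<Sum>i\<in>UNIV. (0 + axis i 1 \<bullet> (z - x)) * partial_deriv i (\<phi> k) z)" for k z
  proof -
    have a: "0 + axis i 1 \<bullet> (z - x) = z $ i - x $ i" for i by (simp add: inner_axis')
    have "- (\<Sum>i\<in>UNIV. u i * (- 2 * c * u i * R)) = 2 * c * (\<Sum>i\<in>UNIV. u i * u i) * R" for c R and u :: "'n \<Rightarrow> real"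
      by (simp add: sum_distrib_left sum_distrib_right sum_negf mult_ac)
    moreover have "(z - x) \<bullet> (z - x) = (\<Sum>i\<in>UNIV. (z $ i - x $ i) * (z $ i - x $ i))" by (simp add: inner_vec_def)
    ultimately show ?thesis unfolding g_def pd a by (simp only:)
  qed
  \<comment> \<open>Coordinate functions have constant gradient, so testing them with
    \<open>\<phi> k\<close> evaluates the integral of \<open>g k\<close> without polar
    coordinates.\<close>
  have wa: "weak_gradient \<Omega> (\<lambda>z. 0 + axis i 1 \<bullet> (z - x)) (\<lambda>_. axis i 1)" for i
    by (rule weak_gradient_affine[OF \<Omega>])
  have la: "locally_integrable \<Omega> (\<lambda>z. 0 + axis i 1 \<bullet> (z - x))" for i using wa by (simp add: weak_gradient_def)
  note ia = integrable_times_test(2)[OF la \<Omega> test]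
  have l1: "locally_integrable \<Omega> (\<lambda>z. 1::real)"
    by (auto simp: locally_integrable_def intro!: integrable_on_compact_continuous)
  have i\<phi>: "integrable (lebesgue_on \<Omega>) (\<phi> k)" for k using integrable_times_test(1)[OF l1 \<Omega> test] by simp
  have ig: "integrable (lebesgue_on \<Omega>) (g k)" for k
    unfolding gsum[abs_def] by (intro Bochner_Integration.integrable_minus Bochner_Integration.integrable_sum ia)
  have one: "(\<integral>z. (0 + axis i 1 \<bullet> (z - x)) * partial_deriv i (\<phi> k) z \<partial>lebesgue_on \<Omega>) = - (\<integral>z. \<phi> k z \<partial>lebesgue_on \<Omega>)" for i k
    using wa[of i] test[of k] unfolding weak_gradient_def by (auto simp: axis_def)
  have "(\<integral>z. g k z \<partial>lebesgue_on \<Omega>) = - (\<Sum>i\<in>UNIV. \<integral>z. (0 + axis i 1 \<bullet> (z - x)) * partial_deriv i (\<phi> k) z \<partial>lebesgue_on \<Omega>)" for k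
    unfolding gsum using ia by (subst Bochner_Integration.integral_minus, subst Bochner_Integration.integral_sum) auto
  then have intg: "(\<integral>z. g k z \<partial>lebesgue_on \<Omega>) = CARD('n) * (\<integral>z. \<phi> k z \<partial>lebesgue_on \<Omega>)" for k
    unfolding one by simp
  have int\<phi>: "(\<integral>z. \<phi> k z \<partial>lebesgue_on \<Omega>) \<le> V" for k
  proof -
    have "(\<integral>z. \<phi> k z \<partial>lebesgue_on \<Omega>) \<le> (\<integral>z. (if z \<in> ball x r then 1 else 0) \<partial>lebesgue_on \<Omega>)"
    proof (rule Bochner_Integration.integral_mono[OF i\<phi>])
      show "integrable (lebesgue_on \<Omega>) (\<lambda>z. if z \<in> ball x r then 1 else 0 :: real)"
        by (intro integrable_lebesgue_on_if sub sets) (simp add: finite_measure.integrable_const finite_measure_lebesgue_on)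
      show "\<phi> k z \<le> (if z \<in> ball x r then 1 else 0)" for z using out[of z k] bd[of k z] by simp
    qed
    also have "\<dots> = (\<integral>z. 1 \<partial>lebesgue_on (ball x r))" by (rule Lebesgue_Measure.integral_restrict[OF sub(1) sets(1,2)])
    also have "\<dots> = V" using sets by (simp add: V_def measure_restrict_space)
    finally show ?thesis .
  qed
  have bk: "\<bar>\<integral>z. H z $ j * \<phi> k z \<partial>lebesgue_on \<Omega>\<bar> \<le> \<epsilon> * CARD('n) * V" for k
  proof -
    note iF = integrable_times_test(2)[OF li(1) \<Omega> test, of j k]
    have "(\<integral>z. H z $ j * \<phi> k z \<partial>lebesgue_on \<Omega>) = - (\<integral>z. F z * partial_deriv j (\<phi> k) z \<partial>lebesgue_on \<Omega>)"
      using wg test by (simp add: weak_gradient_def)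
    then have "\<bar>\<integral>z. H z $ j * \<phi> k z \<partial>lebesgue_on \<Omega>\<bar> = \<bar>\<integral>z. F z * partial_deriv j (\<phi> k) z \<partial>lebesgue_on \<Omega>\<bar>" by simp
    also have "\<dots> \<le> (\<integral>z. \<bar>F z * partial_deriv j (\<phi> k) z\<bar> \<partial>lebesgue_on \<Omega>)" by (rule integral_abs_bound)
    also have "\<dots> \<le> (\<integral>z. \<epsilon> * g k z \<partial>lebesgue_on \<Omega>)"
    proof (rule Bochner_Integration.integral_mono_AE)
      have "AE z in lebesgue. z \<in> \<Omega> \<longrightarrow> \<bar>F z * partial_deriv j (\<phi> k) z\<bar> \<le> \<epsilon> * g k z"
        using F
      proof eventually_elim
        fix z assume Fz: "z \<in> ball x r \<longrightarrow> \<bar>F z\<bar> \<le> \<epsilon> * norm (z - x)"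
        let ?R = "rho 1 (real (Suc k) * (r\<^sup>2 - (z - x) \<bullet> (z - x)))"
        show "z \<in> \<Omega> \<longrightarrow> \<bar>F z * partial_deriv j (\<phi> k) z\<bar> \<le> \<epsilon> * g k z"
        proof (cases "z \<in> ball x r")
          case True
          have "\<bar>z $ j - x $ j\<bar> \<le> norm (z - x)" using component_le_norm_cart[of "z - x" j] by simp
          then have "\<bar>F z\<bar> * \<bar>z $ j - x $ j\<bar> \<le> (\<epsilon> * norm (z - x)) * norm (z - x)"
            using Fz True \<epsilon> by (intro mult_mono) auto
          then have "(\<bar>F z\<bar> * \<bar>z $ j - x $ j\<bar>) * (2 * real (Suc k) * ?R) \<le> ((\<epsilon> * norm (z - x)) * norm (z - x)) * (2 * real (Suc k) * ?R)"
            using rho_1_nonneg by (intro mult_right_mono) auto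
          moreover have "\<bar>F z * partial_deriv j (\<phi> k) z\<bar> = (\<bar>F z\<bar> * \<bar>z $ j - x $ j\<bar>) * (2 * real (Suc k) * ?R)"
            using rho_1_nonneg[of "real (Suc k) * (r\<^sup>2 - (z - x) \<bullet> (z - x))"] unfolding pd by (simp add: abs_mult mult_ac)
          moreover have "\<epsilon> * g k z = ((\<epsilon> * norm (z - x)) * norm (z - x)) * (2 * real (Suc k) * ?R)"
            unfolding g_def power2_norm_eq_inner[symmetric] by (simp add: power2_eq_square mult_ac)
          ultimately have "\<bar>F z * partial_deriv j (\<phi> k) z\<bar> \<le> \<epsilon> * g k z" by (simp only:)
          then show ?thesis by blast
        next
          case False
          then have "r\<^sup>2 \<le> (z - x) \<bullet> (z - x)"
            using r power_mono[of r "norm (z - x)" 2] by (simp add: dist_norm norm_minus_commute flip: power2_norm_eq_inner)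
          then have "?R = 0" by (intro rho_nonpos) (simp add: mult_nonneg_nonpos)
          then show ?thesis by (simp add: pd g_def)
        qed
      qed
      then show "AE z in lebesgue_on \<Omega>. \<bar>F z * partial_deriv j (\<phi> k) z\<bar> \<le> \<epsilon> * g k z"
        by (simp add: AE_restrict_space_iff sets)
    qed (use iF ig in auto)
    also have "\<dots> = \<epsilon> * (CARD('n) * (\<integral>z. \<phi> k z \<partial>lebesgue_on \<Omega>))" by (simp add: intg)
    also have "\<dots> \<le> \<epsilon> * (CARD('n) * V)" using \<epsilon> int\<phi> by (intro mult_left_mono) auto
    finally show ?thesis by (simp add: mult.assoc)
  qed
  have "(\<lambda>k. \<integral>z. H z $ j * \<phi> k z \<partial>lebesgue_on \<Omega>) \<longlonglongrightarrow> (\<integral>z. (if z \<in> ball x r then H z $ j else 0) \<partial>lebesgue_on \<Omega>)"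
  proof (rule integral_dominated_convergence[where w = "\<lambda>z. if z \<in> ball x r then \<bar>H z $ j\<bar> else 0"])
    show "(\<lambda>z. if z \<in> ball x r then H z $ j else 0) \<in> borel_measurable (lebesgue_on \<Omega>)"
      by (rule borel_measurable_integrable, rule integrable_lebesgue_on_if[OF iH sub(1) sets(1,2)])
    show "(\<lambda>z. H z $ j * \<phi> k z) \<in> borel_measurable (lebesgue_on \<Omega>)" for k
      using integrable_times_test(1)[OF locally_integrable_nth[OF li(2)] \<Omega> test] by (rule borel_measurable_integrable)
    show "integrable (lebesgue_on \<Omega>) (\<lambda>z. if z \<in> ball x r then \<bar>H z $ j\<bar> else 0)"
      using iH by (intro integrable_lebesgue_on_if sub sets) auto
    show "AE z in lebesgue_on \<Omega>. norm (H z $ j * \<phi> k z) \<le> (if z \<in> ball x r then \<bar>H z $ j\<bar> else 0)" for k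
    proof (rule AE_I2)
      fix z
      show "norm (H z $ j * \<phi> k z) \<le> (if z \<in> ball x r then \<bar>H z $ j\<bar> else 0)"
        using out[of z k] bd[of k z] mult_left_mono[of "\<phi> k z" 1 "\<bar>H z $ j\<bar>"] by (simp add: abs_mult)
    qed
    have "(\<lambda>k. H z $ j * \<phi> k z) \<longlonglongrightarrow> (if z \<in> ball x r then H z $ j else 0)" for z
    proof (cases "z \<in> ball x r")
      case True
      have "(norm (z - x))\<^sup>2 < r\<^sup>2" using True by (intro power_strict_mono) (auto simp: dist_norm norm_minus_commute)
      then have "(\<lambda>k. H z $ j * \<phi> k z) \<longlonglongrightarrow> H z $ j * 1"
        unfolding \<phi>_def bump_def by (intro tendsto_mult tendsto_const rho_0_tendsto_1) (simp add: power2_norm_eq_inner)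
      then show ?thesis using True by simp
    qed (simp add: out)
    then show "AE z in lebesgue_on \<Omega>. (\<lambda>k. H z $ j * \<phi> k z) \<longlonglongrightarrow> (if z \<in> ball x r then H z $ j else 0)" by simp
  qed
  then have "(\<lambda>k. \<bar>\<integral>z. H z $ j * \<phi> k z \<partial>lebesgue_on \<Omega>\<bar>) \<longlonglongrightarrow> \<bar>\<integral>z. H z $ j \<partial>lebesgue_on (ball x r)\<bar>"
    unfolding Lebesgue_Measure.integral_restrict[OF sub(1) sets(1,2)] by (rule tendsto_rabs)
  then show ?thesis
    unfolding V_def[symmetric] by (rule tendsto_upperbound) (use bk in auto)
qed

text \<open>After subtraction of the first-order Taylor part the function is at most
  \<open>\<epsilon> * norm (z - x)\<close> near \<open>x\<close>, so
  \<open>gradient_mean_bound\<close> controls the mean of \<open>H - l\<close>. Differentiability at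
  the single point \<open>x\<close> is enough.\<close>

lemma gradient_mean_tendsto:
  fixes x :: "real^'n"
  assumes \<Omega>: "open \<Omega>" and wg: "weak_gradient \<Omega> F H" and x: "x \<in> \<Omega>"
    and Ft: "AE z in lebesgue. z \<in> \<Omega> \<longrightarrow> Ft z = F z" "(Ft has_derivative (\<lambda>h. l \<bullet> h)) (at x)"
  shows "((\<lambda>r. (\<integral>z. H z $ j \<partial>lebesgue_on (ball x r)) / measure lebesgue (ball x r)) \<longlongrightarrow> l $ j) (at_right 0)"
proof (rule tendstoI)
  fix e :: real assume e: "0 < e"
  \<comment> \<open>The dimension cancels against the factor in \<open>gradient_mean_bound\<close>,
    leaving \<open>e / 2\<close>.\<close>
  define \<epsilon> where "\<epsilon> = e / (2 * CARD('n))"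
  have \<epsilon>: "0 < \<epsilon>" using e by (simp add: \<epsilon>_def)
  have wg': "weak_gradient \<Omega> (\<lambda>z. F z - (Ft x + l \<bullet> (z - x))) (\<lambda>z. H z - l)"
    by (rule weak_gradient_diff[OF \<Omega> wg weak_gradient_affine[OF \<Omega>]])
  obtain d where d: "0 < d" "\<And>y. norm (y - x) < d \<Longrightarrow> norm (Ft y - Ft x - l \<bullet> (y - x)) \<le> \<epsilon> * norm (y - x)"
    using Ft(2) \<epsilon> unfolding has_derivative_at_alt by blast
  have "\<exists>r>0. cball x r \<subseteq> \<Omega>" using \<Omega> x by (simp add: open_contains_cball)
  then obtain R where R: "0 < R" "cball x R \<subseteq> \<Omega>" by (elim exE conjE)
  have li: "integrable (lebesgue_on (cball x R)) (\<lambda>z. H z $ j)"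
    using locally_integrable_nth[of \<Omega> H j] wg R(2) by (simp add: weak_gradient_def locally_integrable_def)
  have "0 < min d R" using d R by simp
  from eventually_at_right_real[OF this]
  show "\<forall>\<^sub>F r in at_right 0. dist ((\<integral>z. H z $ j \<partial>lebesgue_on (ball x r)) / measure lebesgue (ball x r)) (l $ j) < e"
  proof eventually_elim
    fix r assume "r \<in> {0<..<min d R}"
    then have r: "0 < r" "r < d" "r < R" by auto
    have sub: "cball x r \<subseteq> cball x R" "ball x r \<subseteq> cball x R" using r by (auto simp: subset_iff)
    have V: "0 < measure lebesgue (ball x r)" using measure_lebesgue_ball[of r x] r by simp
    have "AE z in lebesgue. z \<in> ball x r \<longrightarrow> \<bar>F z - (Ft x + l \<bullet> (z - x))\<bar> \<le> \<epsilon> * norm (z - x)"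
      using Ft(1)
    proof eventually_elim
      fix z assume "z \<in> \<Omega> \<longrightarrow> Ft z = F z"
      then show "z \<in> ball x r \<longrightarrow> \<bar>F z - (Ft x + l \<bullet> (z - x))\<bar> \<le> \<epsilon> * norm (z - x)"
        using d(2)[of z] r sub R by (auto simp: dist_norm norm_minus_commute subset_iff algebra_simps)
    qed
    then have b: "\<bar>\<integral>z. (H z - l) $ j \<partial>lebesgue_on (ball x r)\<bar> \<le> \<epsilon> * CARD('n) * measure lebesgue (ball x r)"
      using sub(1) R(2) \<epsilon> by (intro gradient_mean_bound[OF \<Omega> wg' r(1)]) auto
    have iH: "integrable (lebesgue_on (ball x r)) (\<lambda>z. H z $ j)"
      by (rule integrable_lebesgue_on_subset[OF li sub(2)]) (auto simp: borel_open borel_closed)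
    have ic: "integrable (lebesgue_on (ball x r)) (\<lambda>z. l $ j)"
      by (simp add: finite_measure.integrable_const finite_measure_lebesgue_on)
    have "(\<integral>z. (H z - l) $ j \<partial>lebesgue_on (ball x r)) = (\<integral>z. H z $ j \<partial>lebesgue_on (ball x r)) - l $ j * measure lebesgue (ball x r)"
      using iH ic by (simp add: measure_restrict_space borel_open mult.commute)
    moreover have "\<bar>I / V - c\<bar> \<le> k" if "\<bar>J\<bar> \<le> k * V" "J = I - c * V" "0 < V" for I J c k V :: real
    proof -
      have "I / V - c = J / V" using that by (simp add: field_simps)
      then show ?thesis using that by (simp add: abs_divide field_simps)
    qed
    ultimately have "\<bar>(\<integral>z. H z $ j \<partial>lebesgue_on (ball x r)) / measure lebesgue (ball x r) - l $ j\<bar> \<le> \<epsilon> * CARD('n)"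
      using b V by blast
    also have "\<dots> = e / 2" by (simp add: \<epsilon>_def)
    finally show "dist ((\<integral>z. H z $ j \<partial>lebesgue_on (ball x r)) / measure lebesgue (ball x r)) (l $ j) < e"
      using e by (simp add: dist_real_def)
  qed
qed

theorem has_star_value_weak_derivative:
  fixes f :: "real^'n \<Rightarrow> real^'m"
  assumes \<Omega>: "open \<Omega>" and wd: "weak_derivative \<Omega> f G" and x: "x \<in> \<Omega>"
    and ft: "AE z in lebesgue. z \<in> \<Omega> \<longrightarrow> ft z = f z" "(ft has_derivative (\<lambda>h. L *v h)) (at x)"
  shows "has_star_value \<Omega> G x L"
  unfolding has_star_value_def
proof
  show li: "locally_integrable \<Omega> G" using wd by (simp add: weak_derivative_def)
  have "\<exists>r>0. cball x r \<subseteq> \<Omega>" using \<Omega> x by (simp add: open_contains_cball)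
  then obtain R where R: "0 < R" "cball x R \<subseteq> \<Omega>" by (elim exE conjE)
  have iR: "integrable (lebesgue_on (cball x R)) G" using li R by (simp add: locally_integrable_def)
  show "((\<lambda>\<delta>. (1 / measure lebesgue (ball x \<delta> \<inter> \<Omega>)) *\<^sub>R integral\<^sup>L (lebesgue_on (ball x \<delta> \<inter> \<Omega>)) G) \<longlongrightarrow> L) (at_right 0)"
  proof (intro vec_tendstoI)
    fix i j
    have "AE z in lebesgue. z \<in> \<Omega> \<longrightarrow> ft z $ i = f z $ i" using ft(1) by eventually_elim simp
    moreover have "((\<lambda>z. ft z $ i) has_derivative (\<lambda>h. L $ i \<bullet> h)) (at x)"
      using bounded_linear.has_derivative[OF bounded_linear_vec_nth[of i] ft(2)]
      by (simp add: matrix_vector_mult_def inner_vec_def)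
    ultimately have "((\<lambda>r. (\<integral>z. G z $ i $ j \<partial>lebesgue_on (ball x r)) / measure lebesgue (ball x r)) \<longlongrightarrow> L $ i $ j) (at_right 0)"
      by (rule gradient_mean_tendsto[OF \<Omega> weak_gradient_component[OF wd] x])
    then show "((\<lambda>\<delta>. ((1 / measure lebesgue (ball x \<delta> \<inter> \<Omega>)) *\<^sub>R integral\<^sup>L (lebesgue_on (ball x \<delta> \<inter> \<Omega>)) G) $ i $ j) \<longlongrightarrow> L $ i $ j) (at_right 0)"
    proof (rule Lim_transform_eventually)
      show "\<forall>\<^sub>F r in at_right 0. (\<integral>z. G z $ i $ j \<partial>lebesgue_on (ball x r)) / measure lebesgue (ball x r) =
         ((1 / measure lebesgue (ball x r \<inter> \<Omega>)) *\<^sub>R integral\<^sup>L (lebesgue_on (ball x r \<inter> \<Omega>)) G) $ i $ j"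
        using eventually_at_right_real[OF R(1)]
      proof eventually_elim
        case (elim r)
        then have sub: "ball x r \<subseteq> cball x R" "ball x r \<inter> \<Omega> = ball x r" using R(2) by (auto simp: subset_iff)
        have iG: "integrable (lebesgue_on (ball x r)) G"
          by (rule integrable_lebesgue_on_subset[OF iR sub(1)]) (auto simp: borel_open borel_closed)
        have "(\<integral>z. G z \<partial>lebesgue_on (ball x r)) $ i $ j = (\<integral>z. G z $ i $ j \<partial>lebesgue_on (ball x r))"
          using integral_bounded_linear[OF bounded_linear_compose[OF bounded_linear_vec_nth[of j] bounded_linear_vec_nth[of i]] iG] by simp
        then show ?case by (simp add: sub(2))
      qed
    qed
  qed
qed

lemma borel_measurable_lebesgue_on_AE:
  fixes f g :: "'a::euclidean_space \<Rightarrow> 'b::euclidean_space"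
  assumes "f \<in> borel_measurable (lebesgue_on S)" "S \<in> sets lebesgue" "AE x in lebesgue. x \<in> S \<longrightarrow> f x = g x"
  shows "g \<in> borel_measurable (lebesgue_on S)"
proof -
  have "(\<lambda>x. if x \<in> S then f x else 0) \<in> borel_measurable lebesgue" by (rule borel_measurable_if_I[OF assms(1,2)])
  moreover have "AE x in lebesgue. (if x \<in> S then f x else 0) = (if x \<in> S then g x else 0)"
    using assms(3) by eventually_elim simp
  ultimately have "(\<lambda>x. if x \<in> S then g x else 0) \<in> borel_measurable lebesgue" by (rule borel_measurable_AE)
  then show ?thesis by (rule borel_measurable_if_D)
qed

lemma locally_integrable_AE:
  assumes "locally_integrable \<Omega> f" "AE x in lebesgue. x \<in> \<Omega> \<longrightarrow> f x = g x"
  shows "locally_integrable \<Omega> g"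
  unfolding locally_integrable_def
proof (intro allI impI)
  fix K assume K: "compact K \<and> K \<subseteq> \<Omega>"
  have i: "integrable (lebesgue_on K) f" using assms(1) K by (simp add: locally_integrable_def)
  have s: "K \<in> sets lebesgue" using K by (simp add: borel_compact)
  have ae: "AE x in lebesgue. x \<in> K \<longrightarrow> f x = g x" using assms(2) by eventually_elim (use K in auto)
  have "g \<in> borel_measurable (lebesgue_on K)"
    by (rule borel_measurable_lebesgue_on_AE[OF borel_measurable_integrable[OF i] s ae])
  moreover have "AE x in lebesgue_on K. f x = g x" using ae s by (simp add: AE_restrict_space_iff)
  ultimately show "integrable (lebesgue_on K) g" using i integrable_cong_AE_imp by blast
qed

text \<open>Lets \<open>precise_derivative\<close>, which agrees with \<open>G\<close> almost
  everywhere, take over the role of the weak derivative.\<close>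

lemma weak_derivative_AE:
  assumes \<Omega>: "open \<Omega>" and wd: "weak_derivative \<Omega> f G" and ae: "AE x in lebesgue. x \<in> \<Omega> \<longrightarrow> G x = G' x"
  shows "weak_derivative \<Omega> f G'"
proof -
  have li: "locally_integrable \<Omega> G" using wd by (simp add: weak_derivative_def)
  note li' = locally_integrable_AE[OF li ae]
  have O: "\<Omega> \<in> sets lebesgue" using \<Omega> by (simp add: borel_open)
  have "(\<integral>x. G x $ i $ j * \<phi> x \<partial>lebesgue_on \<Omega>) = (\<integral>x. G' x $ i $ j * \<phi> x \<partial>lebesgue_on \<Omega>)"
    if "test_function \<Omega> \<phi>" for \<phi> i j
  proof (rule Bochner_Integration.integral_cong_AE)
    show "(\<lambda>x. G x $ i $ j * \<phi> x) \<in> borel_measurable (lebesgue_on \<Omega>)" "(\<lambda>x. G' x $ i $ j * \<phi> x) \<in> borel_measurable (lebesgue_on \<Omega>)"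
      using integrable_times_test(1)[OF locally_integrable_nth[OF locally_integrable_nth[OF li]] \<Omega> that]
        integrable_times_test(1)[OF locally_integrable_nth[OF locally_integrable_nth[OF li']] \<Omega> that]
      by (auto intro: borel_measurable_integrable)
    have "AE x in lebesgue_on \<Omega>. G x = G' x" using ae O by (simp add: AE_restrict_space_iff)
    then show "AE x in lebesgue_on \<Omega>. G x $ i $ j * \<phi> x = G' x $ i $ j * \<phi> x" by eventually_elim simp
  qed
  then show ?thesis using wd li' by (simp add: weak_derivative_def)
qed

section \<open>Integration with respect to finitely additive set functions\<close>

text \<open>What step integrals need, and no more: it holds for the elements of \<open>Dens\<close>
  and also for the density ratios at a fixed radius, so the same calculus applies to both.\<close>

definition pos_charge :: "'a::euclidean_space set \<Rightarrow> ('a set \<Rightarrow> real) \<Rightarrow> bool" where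
  "pos_charge \<Omega> \<mu> \<longleftrightarrow> (\<forall>A\<in>borel_subsets \<Omega>. 0 \<le> \<mu> A) \<and> additive (borel_subsets \<Omega>) \<mu>"

abbreviation simple_on :: "'a::euclidean_space set \<Rightarrow> ('a \<Rightarrow> 'b) \<Rightarrow> bool" where
  "simple_on \<Omega> \<equiv> simple_function (restrict_space borel \<Omega>)"

lemma borel_subsets_iff: "\<Omega> \<in> sets borel \<Longrightarrow> A \<in> borel_subsets \<Omega> \<longleftrightarrow> A \<in> sets borel \<and> A \<subseteq> \<Omega>"
  by (auto simp: sets_restrict_space_iff)

lemma space_restrict_borel: "space (restrict_space borel \<Omega>) = \<Omega>"
  by (simp add: space_restrict_space)

lemma simple_on_vimage: "simple_on \<Omega> k \<Longrightarrow> k -` {w} \<inter> \<Omega> \<in> borel_subsets \<Omega>"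
  and simple_on_finite: "simple_on \<Omega> k \<Longrightarrow> finite (k ` \<Omega>)"
  using simple_functionD[of "restrict_space borel \<Omega>" k] by (auto simp: space_restrict_borel)

lemma pos_charge_nonneg: "pos_charge \<Omega> \<mu> \<Longrightarrow> A \<in> borel_subsets \<Omega> \<Longrightarrow> 0 \<le> \<mu> A"
  by (simp add: pos_charge_def)

lemma pos_charge_Un:
  "pos_charge \<Omega> \<mu> \<Longrightarrow> A \<in> borel_subsets \<Omega> \<Longrightarrow> B \<in> borel_subsets \<Omega> \<Longrightarrow> A \<inter> B = {} \<Longrightarrow> \<mu> (A \<union> B) = \<mu> A + \<mu> B"
  by (simp add: pos_charge_def additive_def)

lemma pos_charge_empty: "pos_charge \<Omega> \<mu> \<Longrightarrow> \<mu> {} = 0"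
  using pos_charge_Un[of \<Omega> \<mu> "{}" "{}"] by simp

lemma pos_charge_mono:
  assumes "pos_charge \<Omega> \<mu>" "A \<in> borel_subsets \<Omega>" "B \<in> borel_subsets \<Omega>" "A \<subseteq> B"
  shows "\<mu> A \<le> \<mu> B"
proof -
  have "\<mu> (A \<union> (B - A)) = \<mu> A + \<mu> (B - A)" using assms by (intro pos_charge_Un) auto
  moreover have "0 \<le> \<mu> (B - A)" using assms by (intro pos_charge_nonneg) auto
  moreover have "A \<union> (B - A) = B" using assms(4) by blast
  ultimately show ?thesis by simp
qed

lemma pos_charge_subadd:
  assumes "pos_charge \<Omega> \<mu>" "A \<in> borel_subsets \<Omega>" "B \<in> borel_subsets \<Omega>"
  shows "\<mu> (A \<union> B) \<le> \<mu> A + \<mu> B"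
proof -
  have "\<mu> (A \<union> (B - A)) = \<mu> A + \<mu> (B - A)" using assms by (intro pos_charge_Un) auto
  moreover have "\<mu> (B - A) \<le> \<mu> B" using assms by (intro pos_charge_mono) auto
  ultimately show ?thesis by simp
qed

lemma pos_charge_UN:
  assumes "pos_charge \<Omega> \<mu>" "finite I" "\<And>i. i \<in> I \<Longrightarrow> A i \<in> borel_subsets \<Omega>" "disjoint_family_on A I"
  shows "\<mu> (\<Union>i\<in>I. A i) = (\<Sum>i\<in>I. \<mu> (A i))"
  using assms(2-4)
proof (induction I rule: finite_induct)
  case empty
  then show ?case using pos_charge_empty[OF assms(1)] by simp
next
  case (insert i I)
  have "(\<Union>i\<in>I. A i) \<in> borel_subsets \<Omega>" using insert by (intro sets.finite_UN) auto
  moreover have "A i \<inter> (\<Union>i\<in>I. A i) = {}"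
    using insert(2) insert(5) unfolding disjoint_family_on_def by fastforce
  moreover have "disjoint_family_on A I" using insert(5) by (simp add: disjoint_family_on_def)
  ultimately show ?case using insert pos_charge_Un[OF assms(1), of "A i" "\<Union>i\<in>I. A i"] by simp
qed

text \<open>Evaluates the integral of \<open>h\<close> on the possibly finer partition of
  \<open>k\<close>. With \<open>k\<close> the pair of two step functions, both are written on a
  common partition, which yields additivity and monotonicity.\<close>

lemma step_integral_refine:
  assumes \<mu>: "pos_charge \<Omega> \<mu>" and k: "simple_on \<Omega> k" and h: "\<And>x. x \<in> \<Omega> \<Longrightarrow> h x = \<phi> (k x)"
  shows "step_integral \<Omega> \<mu> h = (\<Sum>w\<in>k ` \<Omega>. \<phi> w * \<mu> (k -` {w} \<inter> \<Omega>))"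
proof -
  have fin: "finite (k ` \<Omega>)" by (rule simple_on_finite[OF k])
  have im: "h ` \<Omega> = \<phi> ` (k ` \<Omega>)" using h by (auto simp: image_iff)
  have "h -` {v} \<inter> \<Omega> = (\<Union>w\<in>{w \<in> k ` \<Omega>. \<phi> w = v}. k -` {w} \<inter> \<Omega>)" for v using h by auto
  moreover have "\<mu> (\<Union>w\<in>{w \<in> k ` \<Omega>. \<phi> w = v}. k -` {w} \<inter> \<Omega>) = (\<Sum>w\<in>{w \<in> k ` \<Omega>. \<phi> w = v}. \<mu> (k -` {w} \<inter> \<Omega>))" for v
    using fin by (intro pos_charge_UN[OF \<mu>] simple_on_vimage[OF k]) (auto simp: disjoint_family_on_def)
  ultimately have "step_integral \<Omega> \<mu> h = (\<Sum>v\<in>\<phi> ` (k ` \<Omega>). v * (\<Sum>w\<in>{w \<in> k ` \<Omega>. \<phi> w = v}. \<mu> (k -` {w} \<inter> \<Omega>)))"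
    by (simp add: step_integral_def im)
  also have "\<dots> = (\<Sum>v\<in>\<phi> ` (k ` \<Omega>). \<Sum>w\<in>{w \<in> k ` \<Omega>. \<phi> w = v}. \<phi> w * \<mu> (k -` {w} \<inter> \<Omega>))"
    by (simp add: sum_distrib_left)
  also have "\<dots> = (\<Sum>w\<in>k ` \<Omega>. \<phi> w * \<mu> (k -` {w} \<inter> \<Omega>))"
    by (rule sum.image_gen[OF fin, symmetric])
  finally show ?thesis .
qed

lemma step_integral_add:
  assumes \<mu>: "pos_charge \<Omega> \<mu>" and h: "simple_on \<Omega> h" "simple_on \<Omega> g"
  shows "step_integral \<Omega> \<mu> (\<lambda>x. h x + g x) = step_integral \<Omega> \<mu> h + step_integral \<Omega> \<mu> g"
proof -
  have k: "simple_on \<Omega> (\<lambda>x. (h x, g x))" by (rule simple_function_Pair[OF h])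
  have "step_integral \<Omega> \<mu> (\<lambda>x. h x + g x) = (\<Sum>w\<in>(\<lambda>x. (h x, g x)) ` \<Omega>. (fst w + snd w) * \<mu> ((\<lambda>x. (h x, g x)) -` {w} \<inter> \<Omega>))"
    by (rule step_integral_refine[OF \<mu> k]) simp
  moreover have "step_integral \<Omega> \<mu> h = (\<Sum>w\<in>(\<lambda>x. (h x, g x)) ` \<Omega>. fst w * \<mu> ((\<lambda>x. (h x, g x)) -` {w} \<inter> \<Omega>))"
    by (rule step_integral_refine[OF \<mu> k]) simp
  moreover have "step_integral \<Omega> \<mu> g = (\<Sum>w\<in>(\<lambda>x. (h x, g x)) ` \<Omega>. snd w * \<mu> ((\<lambda>x. (h x, g x)) -` {w} \<inter> \<Omega>))"
    by (rule step_integral_refine[OF \<mu> k]) simp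
  ultimately show ?thesis by (simp add: distrib_right sum.distrib)
qed

lemma step_integral_cmult:
  assumes \<mu>: "pos_charge \<Omega> \<mu>" and h: "simple_on \<Omega> h"
  shows "step_integral \<Omega> \<mu> (\<lambda>x. c * h x) = c * step_integral \<Omega> \<mu> h"
  using step_integral_refine[OF \<mu> h, of "\<lambda>x. c * h x" "\<lambda>v. c * v"]
  by (simp add: step_integral_def sum_distrib_left mult.assoc)

lemma step_integral_mono:
  assumes \<mu>: "pos_charge \<Omega> \<mu>" and h: "simple_on \<Omega> h" "simple_on \<Omega> g" and le: "\<And>x. x \<in> \<Omega> \<Longrightarrow> h x \<le> g x"
  shows "step_integral \<Omega> \<mu> h \<le> step_integral \<Omega> \<mu> g"
proof -
  have k: "simple_on \<Omega> (\<lambda>x. (h x, g x))" by (rule simple_function_Pair[OF h])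
  have "step_integral \<Omega> \<mu> h = (\<Sum>w\<in>(\<lambda>x. (h x, g x)) ` \<Omega>. fst w * \<mu> ((\<lambda>x. (h x, g x)) -` {w} \<inter> \<Omega>))"
    by (rule step_integral_refine[OF \<mu> k]) simp
  also have "\<dots> \<le> (\<Sum>w\<in>(\<lambda>x. (h x, g x)) ` \<Omega>. snd w * \<mu> ((\<lambda>x. (h x, g x)) -` {w} \<inter> \<Omega>))"
    using le by (intro sum_mono mult_right_mono pos_charge_nonneg[OF \<mu>] simple_on_vimage[OF k]) auto
  also have "\<dots> = step_integral \<Omega> \<mu> g"
    by (rule step_integral_refine[OF \<mu> k, symmetric]) simp
  finally show ?thesis .
qed

lemma step_integral_indicator:
  assumes \<mu>: "pos_charge \<Omega> \<mu>" and A: "A \<in> borel_subsets \<Omega>" "\<Omega> \<in> sets borel"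
  shows "step_integral \<Omega> \<mu> (indicator A) = \<mu> A"
proof -
  have A': "A \<subseteq> \<Omega>" using A by (simp add: borel_subsets_iff)
  have s: "simple_on \<Omega> (\<lambda>x. x \<in> A)"
    unfolding simple_function_def space_restrict_borel
  proof (intro conjI ballI)
    show "finite ((\<lambda>x. x \<in> A) ` \<Omega>)" by (rule finite_subset[of _ UNIV]) auto
    fix b
    have "(\<lambda>x. x \<in> A) -` {b} \<inter> \<Omega> = (if b then A else \<Omega> - A)" using A' by auto
    then show "(\<lambda>x. x \<in> A) -` {b} \<inter> \<Omega> \<in> borel_subsets \<Omega>" using A by (auto simp: borel_subsets_iff)
  qed
  have "step_integral \<Omega> \<mu> (indicator A) = (\<Sum>b\<in>(\<lambda>x. x \<in> A) ` \<Omega>. of_bool b * \<mu> ((\<lambda>x. x \<in> A) -` {b} \<inter> \<Omega>))"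
    by (rule step_integral_refine[OF \<mu> s]) (simp add: indicator_def)
  also have "\<dots> = (\<Sum>b\<in>UNIV. of_bool b * \<mu> ((\<lambda>x. x \<in> A) -` {b} \<inter> \<Omega>))"
  proof (rule sum.mono_neutral_left)
    show "\<forall>b\<in>UNIV - (\<lambda>x. x \<in> A) ` \<Omega>. of_bool b * \<mu> ((\<lambda>x. x \<in> A) -` {b} \<inter> \<Omega>) = 0"
    proof
      fix b assume "b \<in> UNIV - (\<lambda>x. x \<in> A) ` \<Omega>"
      then have "(\<lambda>x. x \<in> A) -` {b} \<inter> \<Omega> = {}" by auto
      then show "of_bool b * \<mu> ((\<lambda>x. x \<in> A) -` {b} \<inter> \<Omega>) = 0" using pos_charge_empty[OF \<mu>] by simp
    qed
  qed auto
  also have "\<dots> = \<mu> ((\<lambda>x. x \<in> A) -` {True} \<inter> \<Omega>)" by (simp add: UNIV_bool)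
  also have "(\<lambda>x. x \<in> A) -` {True} \<inter> \<Omega> = A" using A' by auto
  finally show ?thesis .
qed

lemma step_integral_const:
  assumes \<mu>: "pos_charge \<Omega> \<mu>"
  shows "step_integral \<Omega> \<mu> (\<lambda>_. c) = c * \<mu> \<Omega>"
proof (cases "\<Omega> = {}")
  case False
  then show ?thesis by (simp add: step_integral_def vimage_def image_constant_conv)
qed (simp add: step_integral_def pos_charge_empty[OF \<mu>])

lemma simple_on_indicator: "A \<in> borel_subsets \<Omega> \<Longrightarrow> simple_on \<Omega> (indicator A :: _ \<Rightarrow> real)"
  by (rule simple_function_indicator)

lemma simple_on_abs_diff: "simple_on \<Omega> h \<Longrightarrow> simple_on \<Omega> g \<Longrightarrow> simple_on \<Omega> (\<lambda>x. \<bar>h x - g x\<bar> :: real)"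
  using simple_function_compose1[of _ "\<lambda>x. h x - g x" abs] simple_function_diff by blast

lemma step_integral_abs_diff:
  assumes \<mu>: "pos_charge \<Omega> \<mu>" and h: "simple_on \<Omega> h" "simple_on \<Omega> g"
  shows "\<bar>step_integral \<Omega> \<mu> h - step_integral \<Omega> \<mu> g\<bar> \<le> step_integral \<Omega> \<mu> (\<lambda>x. \<bar>h x - g x\<bar>)"
proof -
  have d: "simple_on \<Omega> (\<lambda>x. \<bar>h x - g x\<bar>)" by (rule simple_on_abs_diff[OF h])
  have "step_integral \<Omega> \<mu> h \<le> step_integral \<Omega> \<mu> (\<lambda>x. g x + \<bar>h x - g x\<bar>)"
    using h d by (intro step_integral_mono[OF \<mu>] simple_function_add) auto
  moreover have "step_integral \<Omega> \<mu> g \<le> step_integral \<Omega> \<mu> (\<lambda>x. h x + \<bar>h x - g x\<bar>)"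
    using h d by (intro step_integral_mono[OF \<mu>] simple_function_add) auto
  ultimately show ?thesis using step_integral_add[OF \<mu> h(1) d] step_integral_add[OF \<mu> h(2) d] by linarith
qed

section \<open>The outer set function and uniqueness of the integral\<close>

lemma ba_outer_le:
  assumes \<mu>: "pos_charge \<Omega> \<mu>" and "B \<in> borel_subsets \<Omega>" "S \<subseteq> B"
  shows "ba_outer \<Omega> \<mu> S \<le> \<mu> B"
  unfolding ba_outer_def using assms(2,3) pos_charge_nonneg[OF \<mu>]
  by (intro cINF_lower bdd_belowI2[of _ 0]) auto

lemma ba_outer_nonneg:
  assumes \<mu>: "pos_charge \<Omega> \<mu>" and "S \<subseteq> \<Omega>" "\<Omega> \<in> sets borel"
  shows "0 \<le> ba_outer \<Omega> \<mu> S"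
  unfolding ba_outer_def using assms pos_charge_nonneg[OF \<mu>] borel_subsets_iff[OF assms(3)]
  by (intro cINF_greatest) auto

lemma ba_outer_lessD:
  assumes "ba_outer \<Omega> \<mu> S < d" "S \<subseteq> \<Omega>" "\<Omega> \<in> sets borel" and \<mu>: "pos_charge \<Omega> \<mu>"
  obtains B where "B \<in> borel_subsets \<Omega>" "S \<subseteq> B" "\<mu> B < d"
proof -
  let ?F = "{B \<in> borel_subsets \<Omega>. S \<subseteq> B}"
  have "\<Omega> \<in> ?F" using assms(2,3) by (simp add: borel_subsets_iff)
  moreover have "bdd_below (\<mu> ` ?F)" using pos_charge_nonneg[OF \<mu>] by (intro bdd_belowI2[of _ 0]) blast
  ultimately have "\<exists>B\<in>?F. \<mu> B < d"
    using assms(1) cINF_less_iff[of ?F \<mu> d] unfolding ba_outer_def by blast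
  then show ?thesis using that by blast
qed

text \<open>Two approximating sequences are both close to \<open>g\<close> off a set
  \<open>?E\<close> of small charge. On \<open>?E\<close> their difference is controlled by
  comparison with fixed members \<open>h N1\<close> and \<open>h' N2\<close>: the deviations from
  these are small in the mean by the Cauchy condition, and the fixed difference is bounded.\<close>

lemma has_ba_integral_real_unique:
  assumes \<mu>: "pos_charge \<Omega> \<mu>" and \<Omega>: "\<Omega> \<in> sets borel"
    and I: "has_ba_integral_real \<Omega> \<mu> g I" and J: "has_ba_integral_real \<Omega> \<mu> g J"
  shows "I = J"
proof -
  obtain h where h: "\<And>k. simple_on \<Omega> (h k)"
    "\<And>\<epsilon>. 0 < \<epsilon> \<Longrightarrow> (\<lambda>k. ba_outer \<Omega> \<mu> {x\<in>\<Omega>. \<bar>h k x - g x\<bar> > \<epsilon>}) \<longlonglongrightarrow> 0"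
    "((\<lambda>(k, l). step_integral \<Omega> \<mu> (\<lambda>x. \<bar>h k x - h l x\<bar>)) \<longlongrightarrow> 0) (sequentially \<times>\<^sub>F sequentially)"
    "(\<lambda>k. step_integral \<Omega> \<mu> (h k)) \<longlonglongrightarrow> I"
    using I unfolding has_ba_integral_real_def by blast
  obtain h' where h': "\<And>k. simple_on \<Omega> (h' k)"
    "\<And>\<epsilon>. 0 < \<epsilon> \<Longrightarrow> (\<lambda>k. ba_outer \<Omega> \<mu> {x\<in>\<Omega>. \<bar>h' k x - g x\<bar> > \<epsilon>}) \<longlonglongrightarrow> 0"
    "((\<lambda>(k, l). step_integral \<Omega> \<mu> (\<lambda>x. \<bar>h' k x - h' l x\<bar>)) \<longlongrightarrow> 0) (sequentially \<times>\<^sub>F sequentially)"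
    "(\<lambda>k. step_integral \<Omega> \<mu> (h' k)) \<longlonglongrightarrow> J"
    using J unfolding has_ba_integral_real_def by blast
  have cauchy: "\<exists>N. \<forall>k\<ge>N. step_integral \<Omega> \<mu> (\<lambda>x. \<bar>w k x - w N x\<bar>) < \<epsilon>"
    if "((\<lambda>(k, l). step_integral \<Omega> \<mu> (\<lambda>x. \<bar>w k x - w l x\<bar>)) \<longlongrightarrow> 0) (sequentially \<times>\<^sub>F sequentially)" "0 < \<epsilon>"
    for w :: "nat \<Rightarrow> 'a \<Rightarrow> real" and \<epsilon>
  proof -
    have "\<forall>\<^sub>F (k, l) in sequentially \<times>\<^sub>F sequentially. step_integral \<Omega> \<mu> (\<lambda>x. \<bar>w k x - w l x\<bar>) < \<epsilon>"
      using order_tendstoD(2)[OF that] by (simp add: case_prod_unfold)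
    then show ?thesis by (auto simp: eventually_prod_sequentially)
  qed
  have small: "\<bar>I - J\<bar> \<le> \<epsilon> * (\<mu> \<Omega> + 3)" if \<epsilon>: "0 < \<epsilon>" for \<epsilon>
  proof -
    obtain N1 where N1: "\<forall>k\<ge>N1. step_integral \<Omega> \<mu> (\<lambda>x. \<bar>h k x - h N1 x\<bar>) < \<epsilon>" using cauchy[OF h(3) \<epsilon>] by blast
    obtain N2 where N2: "\<forall>k\<ge>N2. step_integral \<Omega> \<mu> (\<lambda>x. \<bar>h' k x - h' N2 x\<bar>) < \<epsilon>" using cauchy[OF h'(3) \<epsilon>] by blast
    have "finite ((\<lambda>x. \<bar>h N1 x - h' N2 x\<bar>) ` \<Omega>)" by (intro simple_on_finite simple_on_abs_diff h h')
    then obtain M0 where M0: "\<forall>y\<in>(\<lambda>x. \<bar>h N1 x - h' N2 x\<bar>) ` \<Omega>. y \<le> M0" by (meson bdd_above.E bdd_above_finite)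
    define M where "M = max M0 0 + 1"
    have M: "0 < M" "\<And>x. x \<in> \<Omega> \<Longrightarrow> \<bar>h N1 x - h' N2 x\<bar> \<le> M" using M0 by (force simp: M_def)+
    \<comment> \<open>The set \<open>?E\<close> is a union of two sets of charge below
      \<open>d\<close>, so \<open>M * \<mu> ?E \<le> \<epsilon>\<close>. Together with the two tails
      this gives the 3 in \<open>\<mu> \<Omega> + 3\<close>.\<close>
    define d where "d = \<epsilon> / (2 * M)"
    have d: "0 < d" using \<epsilon> M by (simp add: d_def)
    have "\<forall>\<^sub>F k in sequentially. ba_outer \<Omega> \<mu> {x\<in>\<Omega>. \<bar>h k x - g x\<bar> > \<epsilon> / 2} < d"
      "\<forall>\<^sub>F k in sequentially. ba_outer \<Omega> \<mu> {x\<in>\<Omega>. \<bar>h' k x - g x\<bar> > \<epsilon> / 2} < d"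
      using order_tendstoD(2)[OF h(2) d, of "\<epsilon> / 2"] order_tendstoD(2)[OF h'(2) d, of "\<epsilon> / 2"] half_gt_zero[OF \<epsilon>] by blast+
    then have "\<forall>\<^sub>F k in sequentially. \<bar>step_integral \<Omega> \<mu> (h k) - step_integral \<Omega> \<mu> (h' k)\<bar> \<le> \<epsilon> * (\<mu> \<Omega> + 3)"
      using eventually_ge_at_top[of N1] eventually_ge_at_top[of N2]
    proof eventually_elim
      fix k assume o: "ba_outer \<Omega> \<mu> {x\<in>\<Omega>. \<bar>h k x - g x\<bar> > \<epsilon> / 2} < d" "ba_outer \<Omega> \<mu> {x\<in>\<Omega>. \<bar>h' k x - g x\<bar> > \<epsilon> / 2} < d"
        and k: "N1 \<le> k" "N2 \<le> k"
      obtain B where B: "B \<in> borel_subsets \<Omega>" "{x\<in>\<Omega>. \<bar>h k x - g x\<bar> > \<epsilon> / 2} \<subseteq> B" "\<mu> B < d"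
        by (rule ba_outer_lessD[OF o(1) _ \<Omega> \<mu>]) auto
      obtain B' where B': "B' \<in> borel_subsets \<Omega>" "{x\<in>\<Omega>. \<bar>h' k x - g x\<bar> > \<epsilon> / 2} \<subseteq> B'" "\<mu> B' < d"
        by (rule ba_outer_lessD[OF o(2) _ \<Omega> \<mu>]) auto
      let ?E = "B \<union> B'"
      have E: "?E \<in> borel_subsets \<Omega>" "\<mu> ?E \<le> 2 * d"
        using B B' pos_charge_subadd[OF \<mu> B(1) B'(1)] by auto
      let ?a = "\<lambda>x. \<bar>h k x - h N1 x\<bar>" and ?b = "\<lambda>x. \<bar>h' k x - h' N2 x\<bar>"
      have s: "simple_on \<Omega> ?a" "simple_on \<Omega> ?b" "simple_on \<Omega> (indicator ?E :: 'a \<Rightarrow> real)" "simple_on \<Omega> (\<lambda>x. M * indicator ?E x)"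
        "simple_on \<Omega> (\<lambda>x. \<epsilon>)"
        using E(1) by (auto intro!: simple_on_abs_diff h h' simple_function_mult simple_function_const simple_function_indicator)
      have "\<bar>step_integral \<Omega> \<mu> (h k) - step_integral \<Omega> \<mu> (h' k)\<bar> \<le> step_integral \<Omega> \<mu> (\<lambda>x. \<bar>h k x - h' k x\<bar>)"
        by (rule step_integral_abs_diff[OF \<mu> h(1) h'(1)])
      also have "\<dots> \<le> step_integral \<Omega> \<mu> (\<lambda>x. \<epsilon> + (?a x + (?b x + M * indicator ?E x)))"
      proof (rule step_integral_mono[OF \<mu>])
        show "simple_on \<Omega> (\<lambda>x. \<bar>h k x - h' k x\<bar>)" by (rule simple_on_abs_diff[OF h(1) h'(1)])
        show "simple_on \<Omega> (\<lambda>x. \<epsilon> + (?a x + (?b x + M * indicator ?E x)))" by (intro simple_function_add s)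
        fix x assume x: "x \<in> \<Omega>"
        show "\<bar>h k x - h' k x\<bar> \<le> \<epsilon> + (?a x + (?b x + M * indicator ?E x))"
        proof (cases "x \<in> ?E")
          case True
          then show ?thesis using M(2)[OF x] \<epsilon> by simp
        next
          case False
          then have "\<bar>h k x - g x\<bar> \<le> \<epsilon> / 2" "\<bar>h' k x - g x\<bar> \<le> \<epsilon> / 2" using B(2) B'(2) x by (auto simp: not_less[symmetric])
          then have "\<bar>h k x - h' k x\<bar> \<le> \<epsilon>" by linarith
          moreover have "0 \<le> ?a x" "0 \<le> ?b x" by (rule abs_ge_zero)+
          moreover have "M * indicator ?E x = 0" using False by simp
          ultimately show ?thesis by linarith
        qed
      qed
      also have "\<dots> = \<epsilon> * \<mu> \<Omega> + (step_integral \<Omega> \<mu> ?a + (step_integral \<Omega> \<mu> ?b + M * \<mu> ?E))"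
        using s by (simp add: step_integral_add[OF \<mu>] simple_function_add step_integral_const[OF \<mu>] step_integral_cmult[OF \<mu>]
            step_integral_indicator[OF \<mu> E(1) \<Omega>])
      also have "\<dots> \<le> \<epsilon> * \<mu> \<Omega> + (\<epsilon> + (\<epsilon> + M * (2 * d)))"
        using N1 N2 k E(2) M(1) \<epsilon> by (intro add_mono mult_left_mono) (auto intro: less_imp_le)
      also have "M * (2 * d) = \<epsilon>" using M(1) by (simp add: d_def)
      finally show "\<bar>step_integral \<Omega> \<mu> (h k) - step_integral \<Omega> \<mu> (h' k)\<bar> \<le> \<epsilon> * (\<mu> \<Omega> + 3)" by (simp add: algebra_simps)
    qed
    moreover have "(\<lambda>k. \<bar>step_integral \<Omega> \<mu> (h k) - step_integral \<Omega> \<mu> (h' k)\<bar>) \<longlonglongrightarrow> \<bar>I - J\<bar>"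
      by (intro tendsto_intros h h')
    ultimately show ?thesis by (intro tendsto_upperbound[of _ _ sequentially]) auto
  qed
  have nn: "0 \<le> \<mu> \<Omega>" using \<Omega> by (intro pos_charge_nonneg[OF \<mu>]) (simp add: borel_subsets_iff)
  show "I = J"
  proof (rule ccontr)
    assume "I \<noteq> J"
    then have "0 < \<bar>I - J\<bar> / (2 * (\<mu> \<Omega> + 3))" using nn by simp
    moreover have "a / (2 * c) * c = a / 2" if "0 < c" for a c :: real using that by simp
    ultimately have "\<bar>I - J\<bar> \<le> \<bar>I - J\<bar> / 2" using small nn by (metis add_nonneg_pos zero_less_numeral)
    then show False using \<open>I \<noteq> J\<close> by simp
  qed
qed

lemma has_ba_integral_eq:
  assumes "pos_charge \<Omega> \<mu>" "\<Omega> \<in> sets borel" "has_ba_integral \<Omega> \<mu> g I"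
  shows "ba_integrable \<Omega> \<mu> g \<and> ba_integral \<Omega> \<mu> g = I"
proof
  show "ba_integrable \<Omega> \<mu> g" using assms(3) by (auto simp: ba_integrable_def)
  show "ba_integral \<Omega> \<mu> g = I"
    unfolding ba_integral_def
  proof (rule the_equality)
    show "has_ba_integral \<Omega> \<mu> g I" by (rule assms(3))
    fix J assume "has_ba_integral \<Omega> \<mu> g J"
    then have "J \<bullet> b = I \<bullet> b" if "b \<in> Basis" for b
      using assms that by (auto simp: has_ba_integral_def intro: has_ba_integral_real_unique)
    then show "J = I" by (rule euclidean_eqI)
  qed
qed

text \<open>The constant step functions with value \<open>c\<close> form an approximating sequence.
  Since \<open>\<mu>\<close> need not be countably additive, \<open>g\<close> may differ from
  \<open>c\<close> everywhere although it deviates by more than \<open>\<epsilon>\<close> only on a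
  null set, for every \<open>\<epsilon>\<close>.\<close>

lemma has_ba_integral_essentially_const:
  fixes g :: "'a::euclidean_space \<Rightarrow> 'b::euclidean_space"
  assumes \<mu>: "pos_charge \<Omega> \<mu>" "\<mu> \<Omega> = 1" and \<Omega>: "\<Omega> \<in> sets borel"
    and g: "\<And>\<epsilon>. 0 < \<epsilon> \<Longrightarrow> \<exists>B\<in>borel_subsets \<Omega>. {x\<in>\<Omega>. norm (g x - c) > \<epsilon>} \<subseteq> B \<and> \<mu> B = 0"
  shows "has_ba_integral \<Omega> \<mu> g c"
  unfolding has_ba_integral_def has_ba_integral_real_def
proof (rule ballI, rule exI, intro conjI allI impI)
  fix b :: 'b assume b: "b \<in> Basis"
  let ?h = "\<lambda>(k::nat) (x::'a). c \<bullet> b"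
  show "simple_on \<Omega> (?h k)" for k by (rule simple_function_const)
  show "(\<lambda>k. step_integral \<Omega> \<mu> (?h k)) \<longlonglongrightarrow> c \<bullet> b" using \<mu> by (simp add: step_integral_const)
  show "((\<lambda>(k, l). step_integral \<Omega> \<mu> (\<lambda>x. \<bar>?h k x - ?h l x\<bar>)) \<longlongrightarrow> 0) (sequentially \<times>\<^sub>F sequentially)"
    using \<mu> by (simp add: step_integral_const case_prod_unfold)
  fix \<epsilon> :: real assume "0 < \<epsilon>"
  from g[OF this] obtain B where B: "B \<in> borel_subsets \<Omega>" "{x\<in>\<Omega>. norm (g x - c) > \<epsilon>} \<subseteq> B" "\<mu> B = 0" by blast
  have "{x\<in>\<Omega>. \<bar>c \<bullet> b - g x \<bullet> b\<bar> > \<epsilon>} \<subseteq> B"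
  proof
    fix x assume x: "x \<in> {x\<in>\<Omega>. \<bar>c \<bullet> b - g x \<bullet> b\<bar> > \<epsilon>}"
    then have "norm (g x - c) > \<epsilon>"
      using Basis_le_norm[OF b, of "g x - c"] by (simp add: inner_diff_left abs_minus_commute)
    then show "x \<in> B" using B(2) x by auto
  qed
  then have "ba_outer \<Omega> \<mu> {x\<in>\<Omega>. \<bar>c \<bullet> b - g x \<bullet> b\<bar> > \<epsilon>} \<le> 0" using ba_outer_le[OF \<mu>(1) B(1)] B(3) by simp
  then have "ba_outer \<Omega> \<mu> {x\<in>\<Omega>. \<bar>c \<bullet> b - g x \<bullet> b\<bar> > \<epsilon>} = 0"
    by (intro antisym ba_outer_nonneg[OF \<mu>(1) _ \<Omega>]) auto
  then show "(\<lambda>k. ba_outer \<Omega> \<mu> {x\<in>\<Omega>. \<bar>?h k x - g x \<bullet> b\<bar> > \<epsilon>}) \<longlonglongrightarrow> 0" by simp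
qed

section \<open>Density measures\<close>

lemma closed_cluster_point:
  assumes "inf (nhds x) F \<noteq> bot" "closed C" "\<forall>\<^sub>F y in F. y \<in> C"
  shows "x \<in> C"
proof (rule ccontr)
  assume "x \<notin> C"
  then have "\<forall>\<^sub>F y in nhds x. y \<in> - C" using assms(2) by (intro eventually_nhds_in_open) auto
  then have "\<forall>\<^sub>F y in inf (nhds x) F. False"
    unfolding eventually_inf using assms(3) by (intro exI[of _ "\<lambda>y. y \<in> - C"] exI[of _ "\<lambda>y. y \<in> C"]) auto
  then show False using assms(1) by (simp add: trivial_limit_def)
qed

text \<open>Tychonoff's theorem. The index type will be the type of all sets, so that set functions
  are points of a compact space.\<close>

lemma compact_PiE_Icc: "compact (PiE UNIV (\<lambda>_::'i. {a..b::real}))"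
proof -
  have "compactin (product_topology (\<lambda>_::'i. euclidean) UNIV) (PiE UNIV (\<lambda>_. {a..b}))"
    unfolding compactin_PiE by (simp add: compactin_euclidean_iff)
  then show ?thesis by (simp add: euclidean_product_topology compactin_euclidean_iff)
qed

section \<open>Density ratios and the density measures they generate\<close>

lemma ball_fmeasurable: "ball x \<delta> \<in> fmeasurable lborel" for x :: "'a::euclidean_space"
  by (rule fmeasurableI) (use emeasure_lborel_ball_finite[of x \<delta>] in simp_all)

lemma inter_ball_fmeasurable: "A \<in> sets borel \<Longrightarrow> A \<inter> ball x \<delta> \<in> fmeasurable lborel" for x :: "'a::euclidean_space"
  by (rule fmeasurableI2[OF ball_fmeasurable]) auto

lemma density_ratio_bounds: "0 \<le> density_ratio \<Omega> x A \<delta>" "density_ratio \<Omega> x A \<delta> \<le> 1" if "\<Omega> \<in> sets borel"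
proof -
  show "0 \<le> density_ratio \<Omega> x A \<delta>" by (simp add: density_ratio_def)
  have f: "\<Omega> \<inter> ball x \<delta> \<in> fmeasurable lborel"
    using that by (rule inter_ball_fmeasurable)
  have "measure lborel (A \<inter> \<Omega> \<inter> ball x \<delta>) \<le> measure lborel (\<Omega> \<inter> ball x \<delta>)"
  \<comment> \<open>Nonmeasurable \<open>A\<close> have to be covered because the compactness
    argument ranges over all sets; their \<open>measure\<close> is 0 by convention.\<close>
  proof (cases "A \<inter> \<Omega> \<inter> ball x \<delta> \<in> sets lborel")
    case True
    then show ?thesis using f by (intro measure_mono_fmeasurable) auto
  qed (simp add: measure_notin_sets)
  then show "density_ratio \<Omega> x A \<delta> \<le> 1" unfolding density_ratio_def by (intro divide_le_eq_1[THEN iffD2]) (auto simp: zero_less_measure_iff less_le)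
qed

lemma measure_ball_inter_pos:
  fixes x :: "'a::euclidean_space"
  assumes "open \<Omega>" "x \<in> \<Omega>" "0 < \<delta>"
  shows "0 < measure lborel (\<Omega> \<inter> ball x \<delta>)"
proof -
  have "x \<in> \<Omega> \<inter> ball x \<delta>" using assms by simp
  then have o: "open (\<Omega> \<inter> ball x \<delta>)" "\<Omega> \<inter> ball x \<delta> \<noteq> {}" using assms(1) by (blast intro: open_Int open_ball)+
  have f: "\<Omega> \<inter> ball x \<delta> \<in> lmeasurable"
    by (rule lmeasurable_open[OF _ o(1)]) (rule bounded_subset[OF bounded_ball Int_lower2])
  have "measure lebesgue (\<Omega> \<inter> ball x \<delta>) \<noteq> 0"
    using negligible_iff_measure0[OF f] open_not_negligible[OF o] by simp
  then show ?thesis using o by (simp add: borel_open less_le)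
qed

lemma measure_Un_disjoint_fm:
  "A \<in> fmeasurable M \<Longrightarrow> B \<in> fmeasurable M \<Longrightarrow> A \<inter> B = {} \<Longrightarrow> measure M (A \<union> B) = measure M A + measure M B"
  by (rule measure_Union) (auto simp: fmeasurable_def)

lemma pos_charge_density_ratio:
  assumes "\<Omega> \<in> sets borel"
  shows "pos_charge \<Omega> (\<lambda>A. density_ratio \<Omega> x A \<delta>)"
  unfolding pos_charge_def additive_def
proof (intro conjI ballI impI)
  show "0 \<le> density_ratio \<Omega> x A \<delta>" for A by (rule density_ratio_bounds[OF assms])
  fix A B assume AB: "A \<in> borel_subsets \<Omega>" "B \<in> borel_subsets \<Omega>" "A \<inter> B = {}"
  have f: "S \<inter> \<Omega> \<inter> ball x \<delta> \<in> fmeasurable lborel" if "S \<in> borel_subsets \<Omega>" for S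
    using that assms by (intro inter_ball_fmeasurable) (auto simp: borel_subsets_iff)
  have "measure lborel ((A \<inter> \<Omega> \<inter> ball x \<delta>) \<union> (B \<inter> \<Omega> \<inter> ball x \<delta>)) = measure lborel (A \<inter> \<Omega> \<inter> ball x \<delta>) + measure lborel (B \<inter> \<Omega> \<inter> ball x \<delta>)"
    using f[OF AB(1)] f[OF AB(2)] AB(3) by (intro measure_Un_disjoint_fm) auto
  moreover have "(A \<union> B) \<inter> \<Omega> \<inter> ball x \<delta> = (A \<inter> \<Omega> \<inter> ball x \<delta>) \<union> (B \<inter> \<Omega> \<inter> ball x \<delta>)" by blast
  ultimately show "density_ratio \<Omega> x (A \<union> B) \<delta> = density_ratio \<Omega> x A \<delta> + density_ratio \<Omega> x B \<delta>"
    by (simp add: density_ratio_def add_divide_distrib)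
qed

text \<open>A cluster point, as \<open>\<delta>\<close> tends to \<open>0\<close>, of the density ratios in the compact space of all
  functions from sets to the unit interval.\<close>

lemma Ln_Dens_nonempty:
  assumes \<Omega>: "open \<Omega>"
  shows "Ln_Dens \<Omega> x \<noteq> {}"
proof -
  have O: "\<Omega> \<in> sets borel" using \<Omega> by simp
  define F where "F = filtermap (\<lambda>\<delta> A. density_ratio \<Omega> x A \<delta>) (at_right 0)"
  have "F \<noteq> bot" by (simp add: F_def filtermap_bot_iff)
  moreover have "\<forall>\<^sub>F m in F. m \<in> PiE UNIV (\<lambda>_. {0..1})"
    by (auto simp: F_def eventually_filtermap PiE_iff density_ratio_bounds[OF O] intro!: always_eventually)
  ultimately obtain \<mu> where \<mu>: "\<mu> \<in> PiE UNIV (\<lambda>_. {0..1})" "inf (nhds \<mu>) F \<noteq> bot"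
    using compact_PiE_Icc[of 0 1, unfolded compact_filter, rule_format, of F] by (auto elim!: bexE)
  have c: "continuous_on UNIV (\<lambda>m::'a set \<Rightarrow> real. m A)" for A by (rule continuous_on_product_coordinates)
  \<comment> \<open>An identity between continuous functions of the set function defines a closed
    set; if it holds for all density ratios, it holds for the cluster point.\<close>
  have eq: "\<phi> \<mu> = \<psi> \<mu>" if "continuous_on UNIV \<phi>" "continuous_on UNIV \<psi>" "\<And>\<delta>. \<phi> (\<lambda>A. density_ratio \<Omega> x A \<delta>) = \<psi> (\<lambda>A. density_ratio \<Omega> x A \<delta>)"
    for \<phi> \<psi> :: "('a set \<Rightarrow> real) \<Rightarrow> real"
    using closed_cluster_point[OF \<mu>(2) closed_Collect_eq[OF that(1,2)]] that(3) by (simp add: F_def eventually_filtermap)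
  have "additive (borel_subsets \<Omega>) \<mu>"
    unfolding additive_def
  proof (intro ballI impI)
    fix A B assume "A \<in> borel_subsets \<Omega>" "B \<in> borel_subsets \<Omega>" "A \<inter> B = {}"
    then show "\<mu> (A \<union> B) = \<mu> A + \<mu> B"
      using pos_charge_Un[OF pos_charge_density_ratio[OF O]]
      by (intro eq[of "\<lambda>m. m (A \<union> B)" "\<lambda>m. m A + m B"] continuous_on_add c) auto
  qed
  moreover have "\<mu> A = 0" if "A \<in> borel_subsets \<Omega>" "emeasure lborel A = 0" for A
  proof (rule eq[of "\<lambda>m. m A" "\<lambda>_. 0"])
    fix \<delta>
    have "emeasure lborel (A \<inter> \<Omega> \<inter> ball x \<delta>) \<le> emeasure lborel A"
      using that O by (intro emeasure_mono) (auto simp: borel_subsets_iff)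
    then show "density_ratio \<Omega> x A \<delta> = 0" using that(2) by (simp add: density_ratio_def measure_def)
  qed (auto intro: c)
  moreover have "\<bar>\<mu> A\<bar> \<le> 1" for A using \<mu>(1) by (auto simp: PiE_iff abs_le_iff intro: order_trans[of _ 0])
  ultimately have "\<mu> \<in> ba \<Omega>" by (auto simp: ba_def)
  moreover have "Liminf (at_right 0) (\<lambda>\<delta>. ereal (density_ratio \<Omega> x A \<delta>)) \<le> ereal (\<mu> A)" for A
  proof (rule ccontr)
    assume "\<not> ?thesis"
    \<comment> \<open>A number strictly in between turns the strict inequality for the ratios into
      the closed condition \<open>c \<le> m A\<close>, which passes to the cluster point.\<close>
    then obtain c where c': "ereal (\<mu> A) < ereal c" "ereal c < Liminf (at_right 0) (\<lambda>\<delta>. ereal (density_ratio \<Omega> x A \<delta>))"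
      using ereal_dense2 not_le by metis
    have "\<forall>\<^sub>F \<delta> in at_right 0. c < density_ratio \<Omega> x A \<delta>" using less_LiminfD[OF c'(2)] by simp
    then have "\<forall>\<^sub>F m in F. m \<in> {m. c \<le> m A}"
      unfolding F_def eventually_filtermap by eventually_elim simp
    moreover have "closed {m. c \<le> m A}" by (intro closed_Collect_le continuous_on_const c)
    ultimately have "c \<le> \<mu> A" using closed_cluster_point[OF \<mu>(2)] by blast
    then show False using c'(1) by simp
  qed
  moreover have "ereal (\<mu> A) \<le> Limsup (at_right 0) (\<lambda>\<delta>. ereal (density_ratio \<Omega> x A \<delta>))" for A
  proof (rule ccontr)
    assume "\<not> ?thesis"
    then obtain c where c': "ereal c < ereal (\<mu> A)" "Limsup (at_right 0) (\<lambda>\<delta>. ereal (density_ratio \<Omega> x A \<delta>)) < ereal c"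
      using ereal_dense2 not_le by metis
    have "\<forall>\<^sub>F \<delta> in at_right 0. density_ratio \<Omega> x A \<delta> < c" using Limsup_lessD[OF c'(2)] by simp
    then have "\<forall>\<^sub>F m in F. m \<in> {m. m A \<le> c}"
      unfolding F_def eventually_filtermap by eventually_elim simp
    moreover have "closed {m. m A \<le> c}" by (intro closed_Collect_le continuous_on_const c)
    ultimately have "\<mu> A \<le> c" using closed_cluster_point[OF \<mu>(2)] by blast
    then show False using c'(1) by simp
  qed
  ultimately have "\<mu> \<in> Ln_Dens \<Omega> x" by (simp add: Ln_Dens_def)
  then show ?thesis by blast
qed

lemma Ln_Dens_le:
  assumes "\<mu> \<in> Ln_Dens \<Omega> x" "A \<in> borel_subsets \<Omega>" "\<And>\<epsilon>. 0 < \<epsilon> \<Longrightarrow> \<forall>\<^sub>F \<delta> in at_right 0. density_ratio \<Omega> x A \<delta> \<le> c + \<epsilon>"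
  shows "\<mu> A \<le> c"
proof (rule field_le_epsilon)
  fix \<epsilon> :: real assume "0 < \<epsilon>"
  have "ereal (\<mu> A) \<le> Limsup (at_right 0) (\<lambda>\<delta>. ereal (density_ratio \<Omega> x A \<delta>))"
    using assms by (simp add: Ln_Dens_def)
  also have "\<dots> \<le> ereal (c + \<epsilon>)" using assms(3)[OF \<open>0 < \<epsilon>\<close>] by (intro Limsup_bounded) simp
  finally show "\<mu> A \<le> c + \<epsilon>" by simp
qed

lemma Ln_Dens_ge:
  assumes "\<mu> \<in> Ln_Dens \<Omega> x" "A \<in> borel_subsets \<Omega>" "\<forall>\<^sub>F \<delta> in at_right 0. c \<le> density_ratio \<Omega> x A \<delta>"
  shows "c \<le> \<mu> A"
proof -
  have "ereal c \<le> Liminf (at_right 0) (\<lambda>\<delta>. ereal (density_ratio \<Omega> x A \<delta>))" using assms(3) by (intro Liminf_bounded) simp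
  also have "\<dots> \<le> ereal (\<mu> A)" using assms by (simp add: Ln_Dens_def)
  finally show ?thesis by simp
qed

text \<open>A set containing a neighbourhood of \<open>x\<close> within \<open>\<Omega>\<close> has
  density ratio 1 for small radii, so the lower and upper bounds force the value 1; nonnegative
  ratios force nonnegative values. What is proved for \<open>Dens\<close> thereby holds for
  \<open>Ln_Dens\<close>.\<close>

lemma Ln_Dens_subset_Dens:
  assumes \<Omega>: "open \<Omega>" "x \<in> \<Omega>"
  shows "Ln_Dens \<Omega> x \<subseteq> Dens \<Omega> x"
proof
  fix \<mu> assume \<mu>: "\<mu> \<in> Ln_Dens \<Omega> x"
  have O: "\<Omega> \<in> sets borel" using \<Omega> by simp
  have one: "\<mu> A = 1" if A: "A \<in> borel_subsets \<Omega>" and r: "0 < r" "ball x r \<inter> \<Omega> \<subseteq> A" for A r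
  proof (rule antisym)
    show "\<mu> A \<le> 1" by (rule Ln_Dens_le[OF \<mu> A]) (use density_ratio_bounds(2)[OF O] in \<open>auto intro!: always_eventually order_trans[OF density_ratio_bounds(2)[OF O]]\<close>)
    show "1 \<le> \<mu> A"
    proof (rule Ln_Dens_ge[OF \<mu> A])
      show "\<forall>\<^sub>F \<delta> in at_right 0. 1 \<le> density_ratio \<Omega> x A \<delta>"
        using eventually_at_right_real[OF r(1)]
      proof eventually_elim
        case (elim \<delta>)
        then have "A \<inter> \<Omega> \<inter> ball x \<delta> = \<Omega> \<inter> ball x \<delta>" using r(2) by auto
        then show ?case using measure_ball_inter_pos[OF \<Omega>, of \<delta>] elim by (simp add: density_ratio_def)
      qed
    qed
  qed
  have "0 \<le> \<mu> A" if "A \<in> borel_subsets \<Omega>" for A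
    by (rule Ln_Dens_ge[OF \<mu> that]) (use density_ratio_bounds(1)[OF O] in \<open>auto intro: always_eventually\<close>)
  moreover have "\<mu> (ball x \<delta> \<inter> \<Omega>) = 1" if "0 < \<delta>" for \<delta>
    using one[of "ball x \<delta> \<inter> \<Omega>" \<delta>] that O by (auto simp: borel_subsets_iff)
  moreover have "\<mu> \<Omega> = 1" using one[of \<Omega> 1] O by (auto simp: borel_subsets_iff)
  moreover have "\<mu> \<in> ba \<Omega>" using \<mu> by (simp add: Ln_Dens_def)
  ultimately show "\<mu> \<in> Dens \<Omega> x" by (simp add: Dens_def)
qed

lemma Dens_pos_charge: "\<mu> \<in> Dens \<Omega> x \<Longrightarrow> pos_charge \<Omega> \<mu>"
  by (simp add: Dens_def pos_charge_def ba_def)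

lemma Dens_null_outside_ball:
  assumes \<mu>: "\<mu> \<in> Dens \<Omega> x" and \<Omega>: "\<Omega> \<in> sets borel" and d: "0 < d"
  shows "\<mu> (\<Omega> - ball x d) = 0"
proof -
  have "\<mu> ((ball x d \<inter> \<Omega>) \<union> (\<Omega> - ball x d)) = \<mu> (ball x d \<inter> \<Omega>) + \<mu> (\<Omega> - ball x d)"
    using \<Omega> by (intro pos_charge_Un[OF Dens_pos_charge[OF \<mu>]]) (auto simp: borel_subsets_iff)
  moreover have "(ball x d \<inter> \<Omega>) \<union> (\<Omega> - ball x d) = \<Omega>" by blast
  moreover have "\<mu> (ball x d \<inter> \<Omega>) = 1" "\<mu> \<Omega> = 1" using \<mu> d by (auto simp: Dens_def)
  ultimately show ?thesis by simp
qed

text \<open>Exceptional sets need to be controlled only near \<open>x\<close>, as the complement of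
  any ball around \<open>x\<close> has charge 0.\<close>

lemma Dens_null_cover:
  assumes \<mu>: "\<mu> \<in> Dens \<Omega> x" and \<Omega>: "\<Omega> \<in> sets borel" and d: "0 < d"
    and S: "S \<subseteq> \<Omega>" "S \<inter> ball x d \<subseteq> B" "B \<in> borel_subsets \<Omega>" "\<mu> B = 0"
  shows "\<exists>B'\<in>borel_subsets \<Omega>. S \<subseteq> B' \<and> \<mu> B' = 0"
proof (intro bexI conjI)
  let ?B = "B \<union> (\<Omega> - ball x d)"
  have b: "\<Omega> - ball x d \<in> borel_subsets \<Omega>" using \<Omega> by (auto simp: borel_subsets_iff)
  show m: "?B \<in> borel_subsets \<Omega>" using b S(3) by blast
  show "S \<subseteq> ?B" using S by blast
  have "\<mu> ?B \<le> \<mu> B + \<mu> (\<Omega> - ball x d)" by (rule pos_charge_subadd[OF Dens_pos_charge[OF \<mu>] S(3) b])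
  then have "\<mu> ?B \<le> 0" using S(4) Dens_null_outside_ball[OF \<mu> \<Omega> d] by simp
  then show "\<mu> ?B = 0" using pos_charge_nonneg[OF Dens_pos_charge[OF \<mu>] m] by simp
qed

text \<open>Near \<open>x\<close> the values of \<open>f\<close> are within
  \<open>\<epsilon>\<close> of \<open>ft x\<close> off a Borel null set, on which
  \<open>\<mu>\<close> vanishes; the rest of \<open>\<Omega>\<close> has charge 0.\<close>

lemma Dens_integral_continuous:
  fixes f ft :: "'a::euclidean_space \<Rightarrow> 'b::euclidean_space"
  assumes \<mu>: "\<mu> \<in> Dens \<Omega> x" and \<Omega>: "open \<Omega>" "x \<in> \<Omega>" and ft: "continuous_on \<Omega> ft" "AE z in lebesgue. z \<in> \<Omega> \<longrightarrow> ft z = f z"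
  shows "has_ba_integral \<Omega> \<mu> f (ft x)"
proof (rule has_ba_integral_essentially_const[OF Dens_pos_charge[OF \<mu>]])
  show O: "\<Omega> \<in> sets borel" using \<Omega> by simp
  show "\<mu> \<Omega> = 1" using \<mu> by (simp add: Dens_def)
  obtain N where N: "N \<in> null_sets lborel" "{z. \<not> (z \<in> \<Omega> \<longrightarrow> ft z = f z)} \<subseteq> N"
    using ft(2) unfolding AE_completion_iff by (auto simp: eventually_ae_filter)
  fix \<epsilon> :: real assume \<epsilon>: "0 < \<epsilon>"
  have "isCont ft x" using ft(1) \<Omega> by (simp add: continuous_on_eq_continuous_at)
  then obtain d where d: "0 < d" "\<And>z. dist z x < d \<Longrightarrow> dist (ft z) (ft x) < \<epsilon>"
    using \<epsilon> unfolding continuous_at_eps_delta by metis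
  have NB: "N \<inter> \<Omega> \<in> borel_subsets \<Omega>" using N(1) O by (auto simp: borel_subsets_iff)
  have "emeasure lborel (N \<inter> \<Omega>) = 0" using N(1) O by (metis null_setsD1 null_set_Int2 sets_lborel)
  then have "\<mu> (N \<inter> \<Omega>) = 0" using \<mu> NB by (auto simp: Dens_def ba_def)
  moreover have "{z \<in> \<Omega>. norm (f z - ft x) > \<epsilon>} \<inter> ball x d \<subseteq> N \<inter> \<Omega>"
  proof
    fix z assume z: "z \<in> {z \<in> \<Omega>. norm (f z - ft x) > \<epsilon>} \<inter> ball x d"
    then have "ft z \<noteq> f z" using d(2)[of z] by (auto simp: dist_norm norm_minus_commute)
    then show "z \<in> N \<inter> \<Omega>" using N(2) z by auto
  qed
  ultimately show "\<exists>B\<in>borel_subsets \<Omega>. {z \<in> \<Omega>. norm (f z - ft x) > \<epsilon>} \<subseteq> B \<and> \<mu> B = 0"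
    using NB by (intro Dens_null_cover[OF \<mu> O d(1)]) auto
qed

text \<open>By Chebyshev's inequality the set where \<open>G\<close> deviates from
  \<open>G x\<close> by more than \<open>\<epsilon>\<close> has density 0 at \<open>x\<close>, so
  the upper density bound gives it charge 0. The integrand \<open>g\<close> is any function almost
  everywhere equal to \<open>G\<close>.\<close>

lemma Ln_Dens_integral_lebesgue_point:
  fixes G g :: "'a::euclidean_space \<Rightarrow> 'b::euclidean_space"
  assumes \<mu>: "\<mu> \<in> Ln_Dens \<Omega> x" and \<Omega>: "open \<Omega>" "x \<in> \<Omega>" and lp: "lebesgue_point q G x" and q: "0 < q"
    and G: "\<And>K. compact K \<Longrightarrow> K \<subseteq> \<Omega> \<Longrightarrow> G \<in> borel_measurable (lebesgue_on K)"
      "\<And>K. compact K \<Longrightarrow> K \<subseteq> \<Omega> \<Longrightarrow> integrable (lebesgue_on K) (\<lambda>z. norm (G z) powr q)"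
    and g: "AE z in lebesgue. z \<in> \<Omega> \<longrightarrow> g z = G z"
  shows "has_ba_integral \<Omega> \<mu> g (G x)"
proof -
  have \<mu>': "\<mu> \<in> Dens \<Omega> x" using \<mu> Ln_Dens_subset_Dens[OF \<Omega>] by blast
  have O: "\<Omega> \<in> sets borel" using \<Omega> by simp
  have "\<exists>r>0. cball x r \<subseteq> \<Omega>" using \<Omega> by (simp add: open_contains_cball)
  then obtain R where R: "0 < R" "cball x R \<subseteq> \<Omega>" by (elim exE conjE)
  have m: "G \<in> borel_measurable (lebesgue_on (cball x R))" by (rule G(1)[OF compact_cball R(2)])
  have int: "integrable (lebesgue_on (cball x R)) (\<lambda>z. norm (G z - G x) powr q)"
    by (rule integrable_powr_diff_const[OF m G(2)[OF compact_cball R(2)]]) (use q in auto)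
  show ?thesis
  proof (rule has_ba_integral_essentially_const[OF Dens_pos_charge[OF \<mu>'] _ O])
    show "\<mu> \<Omega> = 1" using \<mu>' by (simp add: Dens_def)
    fix \<epsilon> :: real assume \<epsilon>: "0 < \<epsilon>"
    define S where "S = {z \<in> cball x R. norm (G z - G x) > \<epsilon>} \<union> {z \<in> \<Omega>. g z \<noteq> G z}"
    let ?S1 = "{z \<in> cball x R. norm (G z - G x) > \<epsilon>}" and ?S2 = "{z \<in> \<Omega>. g z \<noteq> G z}"
    have "{z \<in> space (lebesgue_on (cball x R)). norm (G z - G x) > \<epsilon>} \<in> sets (lebesgue_on (cball x R))"
      using m by measurable
    then have S1: "?S1 \<in> sets lebesgue" by (simp add: sets_restrict_space_iff borel_closed)
    have S2: "?S2 \<in> null_sets lebesgue"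
    proof -
      have "AE z in lebesgue. z \<notin> ?S2" using g by eventually_elim auto
      then show ?thesis by (simp add: AE_iff_null_sets negligible_iff_null_sets eventually_ae_filter_negligible completion.AE_iff_null_sets)
    qed
    \<comment> \<open>\<open>\<mu>\<close> is meaningful on Borel sets only, while
      \<open>?S1\<close> is merely Lebesgue measurable; a Borel hull of the same measure replaces
      it.\<close>
    obtain B1 where B1: "?S1 \<subseteq> B1" "B1 \<in> sets borel" "B1 - ?S1 \<in> null_sets lebesgue"
      using completion_upper[OF S1] by auto
    obtain N where N: "N \<in> null_sets lborel" "?S2 \<subseteq> N"
      using S2 by (auto simp: null_sets_completion_iff2)
    let ?B = "(B1 \<union> N) \<inter> \<Omega>"
    have B: "?B \<in> borel_subsets \<Omega>" using B1 N O by (auto simp: borel_subsets_iff)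
    have "\<mu> ?B \<le> 0"
    proof (rule Ln_Dens_le[OF \<mu> B])
      fix \<eta> :: real assume \<eta>: "0 < \<eta>"
      have "0 < \<eta> * \<epsilon> powr q" using \<eta> \<epsilon> by simp
      then have "\<forall>\<^sub>F r in at_right 0. (\<integral>z. norm (G z - G x) powr q \<partial>lebesgue_on (ball x r)) \<le> \<eta> * \<epsilon> powr q * measure lebesgue (ball x r)"
        using lp unfolding lebesgue_point_def by blast
      then show "\<forall>\<^sub>F r in at_right 0. density_ratio \<Omega> x ?B r \<le> 0 + \<eta>"
        using eventually_at_right_real[OF R(1)]
      proof eventually_elim
        fix r assume L: "(\<integral>z. norm (G z - G x) powr q \<partial>lebesgue_on (ball x r)) \<le> \<eta> * \<epsilon> powr q * measure lebesgue (ball x r)"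
          and "r \<in> {0<..<R}"
        then have r: "0 < r" "r < R" by auto
        have sub: "ball x r \<subseteq> cball x R" "ball x r \<subseteq> \<Omega>" using r R(2) by (auto simp: subset_iff)
        have br: "ball x r \<in> sets lebesgue" by (simp add: borel_open)
        have ir: "integrable (lebesgue_on (ball x r)) (\<lambda>z. norm (G z - G x) powr q)"
          by (rule integrable_lebesgue_on_subset[OF int sub(1) br]) (simp add: borel_closed)
        let ?T = "?S1 \<inter> ball x r"
        have T: "?T \<in> sets lebesgue" by (rule sets.Int[OF S1 br])
        have T': "?T \<in> lmeasurable" by (rule fmeasurableI2[OF lmeasurable_ball Int_lower2 T])
        have "\<epsilon> powr q * measure lebesgue ?T = (\<integral>z. \<epsilon> powr q \<partial>lebesgue_on ?T)"
          using T by (simp add: measure_restrict_space)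
        also have "\<dots> \<le> (\<integral>z. norm (G z - G x) powr q \<partial>lebesgue_on (ball x r))"
        proof (rule integral_mono_lebesgue_on_AE[OF ir _ _ Int_lower2 T br])
          show "AE z in lebesgue_on ?T. \<epsilon> powr q \<le> norm (G z - G x) powr q"
          proof (rule AE_I2)
            fix z assume "z \<in> space (lebesgue_on ?T)"
            then have "\<epsilon> \<le> norm (G z - G x)" by (simp add: space_restrict_space)
            then show "\<epsilon> powr q \<le> norm (G z - G x) powr q" using \<epsilon> q by (intro powr_mono2) auto
          qed
        qed simp
        also note L
        finally have le: "measure lebesgue ?T \<le> \<eta> * measure lebesgue (ball x r)" using \<epsilon> by (simp add: mult_ac)
        have eq: "measure lborel (?B \<inter> \<Omega> \<inter> ball x r) = measure lebesgue ?T"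
        proof -
          have "measure lborel (?B \<inter> \<Omega> \<inter> ball x r) = measure lebesgue (?B \<inter> \<Omega> \<inter> ball x r)"
            using B1(2) N(1) O by (intro measure_completion[symmetric]) auto
          also have "\<dots> = measure lebesgue ?T"
          proof (rule measure_negligible_symdiff)
            have "negligible ((B1 - ?S1) \<union> N)"
              unfolding negligible_iff_null_sets by (rule null_sets.Un[OF B1(3) null_sets_completionI[OF N(1)]])
            then show "negligible (?T - ?B \<inter> \<Omega> \<inter> ball x r \<union> (?B \<inter> \<Omega> \<inter> ball x r - ?T))"
              by (rule negligible_subset) (use B1(1) sub in auto)
          qed (rule T')
          finally show ?thesis .
        qed
        have ob: "\<Omega> \<inter> ball x r = ball x r" using sub(2) by blast
        have "0 < measure lborel (ball x r)" using r(1) by simp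
        moreover have "measure lebesgue ?T \<le> \<eta> * measure lborel (ball x r)" using le by simp
        ultimately show "density_ratio \<Omega> x ?B r \<le> 0 + \<eta>"
          unfolding density_ratio_def eq ob add_0 by (subst pos_divide_le_eq)
      qed
    qed
    moreover have "0 \<le> \<mu> ?B" by (rule pos_charge_nonneg[OF Dens_pos_charge[OF \<mu>'] B])
    ultimately have "\<mu> ?B = 0" by simp
    then show "\<exists>B\<in>borel_subsets \<Omega>. {z \<in> \<Omega>. norm (g z - G x) > \<epsilon>} \<subseteq> B \<and> \<mu> B = 0"
    proof (intro Dens_null_cover[OF \<mu>' O R(1) _ _ B])
      show "{z \<in> \<Omega>. norm (g z - G x) > \<epsilon>} \<inter> ball x R \<subseteq> ?B"
        using B1(1) N(2) by force
    qed auto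
  qed
qed

section \<open>Bounded functions and density measures\<close>

lemma measure_inter_ball_mono_diff:
  fixes A :: "'a::euclidean_space set"
  assumes A: "A \<in> sets borel" and st: "0 \<le> s" "s \<le> t"
  shows "measure lborel (A \<inter> ball x t) - measure lborel (A \<inter> ball x s) \<in> {0..unit_ball_vol (real DIM('a)) * (t ^ DIM('a) - s ^ DIM('a))}"
proof -
  let ?D = "ball x t - ball x s"
  have sub: "ball x s \<subseteq> ball x t" using st by (rule_tac subset_ball)
  have D: "?D \<in> fmeasurable lborel" by (rule fmeasurable.Diff[OF ball_fmeasurable ball_fmeasurable])
  have f: "A \<inter> ?D \<in> fmeasurable lborel" by (rule fmeasurableI2[OF D]) (use A in auto)
  have "A \<inter> ball x t = (A \<inter> ball x s) \<union> (A \<inter> ?D)" using sub by blast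
  then have "measure lborel (A \<inter> ball x t) = measure lborel (A \<inter> ball x s) + measure lborel (A \<inter> ?D)"
    using measure_Un_disjoint_fm[OF inter_ball_fmeasurable[OF A] f, of x s] by auto
  moreover have "measure lborel (A \<inter> ?D) \<le> measure lborel ?D" using f D by (intro measure_mono_fmeasurable) auto
  moreover have "ball x t = ball x s \<union> ?D" using sub by blast
  then have "measure lborel (ball x t) = measure lborel (ball x s) + measure lborel ?D"
    using measure_Un_disjoint_fm[OF ball_fmeasurable D, of x s] by auto
  moreover have "measure lborel (ball x t) = unit_ball_vol (real DIM('a)) * t ^ DIM('a)"
    "measure lborel (ball x s) = unit_ball_vol (real DIM('a)) * s ^ DIM('a)"
    using st by (simp_all add: content_ball)
  moreover have "0 \<le> measure lborel (A \<inter> ?D)" by simp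
  ultimately show ?thesis unfolding atLeastAtMost_iff right_diff_distrib by linarith
qed

lemma continuous_on_measure_inter_ball:
  fixes A :: "'a::euclidean_space set"
  assumes A: "A \<in> sets borel"
  shows "continuous_on {0..} (\<lambda>t. measure lborel (A \<inter> ball x t))"
  unfolding continuous_on_def
proof
  fix t :: real assume t: "t \<in> {0..}"
  let ?u = "unit_ball_vol (real DIM('a))"
  show "((\<lambda>t. measure lborel (A \<inter> ball x t)) \<longlongrightarrow> measure lborel (A \<inter> ball x t)) (at t within {0..})"
  proof (rule Lim_null[THEN iffD2], rule Lim_null_comparison)
    have b: "norm (measure lborel (A \<inter> ball x s) - measure lborel (A \<inter> ball x t)) \<le> ?u * \<bar>s ^ DIM('a) - t ^ DIM('a)\<bar>" if "0 \<le> s" for s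
    proof (cases "s \<le> t")
      case True
      have "\<bar>s ^ DIM('a) - t ^ DIM('a)\<bar> = t ^ DIM('a) - s ^ DIM('a)" using power_mono[OF True that, of "DIM('a)"] by simp
      then show ?thesis using measure_inter_ball_mono_diff[OF A that True, of x] by (simp only: atLeastAtMost_iff real_norm_def) linarith
    next
      case False
      then have le: "t \<le> s" "0 \<le> t" using t by auto
      have "\<bar>s ^ DIM('a) - t ^ DIM('a)\<bar> = s ^ DIM('a) - t ^ DIM('a)" using power_mono[OF le, of "DIM('a)"] by simp
      then show ?thesis using measure_inter_ball_mono_diff[OF A le(2,1), of x] by (simp only: atLeastAtMost_iff real_norm_def) linarith
    qed
    then show "\<forall>\<^sub>F s in at t within {0..}. norm (measure lborel (A \<inter> ball x s) - measure lborel (A \<inter> ball x t)) \<le> ?u * \<bar>s ^ DIM('a) - t ^ DIM('a)\<bar>"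
      unfolding eventually_at_topological by (intro exI[of _ UNIV]) simp
    have "((\<lambda>s. ?u * \<bar>s ^ DIM('a) - t ^ DIM('a)\<bar>) \<longlongrightarrow> ?u * \<bar>t ^ DIM('a) - t ^ DIM('a)\<bar>) (at t within {0..})"
      by (intro tendsto_intros)
    then show "((\<lambda>s. ?u * \<bar>s ^ DIM('a) - t ^ DIM('a)\<bar>) \<longlongrightarrow> 0) (at t within {0..})" by simp
  qed
qed

text \<open>The balls of radii \<open>1 / (j + 1)\<close> cut out annuli whose volume is asymptotically negligible
  against that of the ball; in each of them the set is split into two halves by an intermediate radius.\<close>

lemma asymptotic_halving:
  fixes A :: "'a::euclidean_space set"
  assumes A: "A \<in> sets borel"
  obtains H where "H \<in> sets borel" "H \<subseteq> A"
    "((\<lambda>\<delta>. (measure lborel (H \<inter> ball x \<delta>) - measure lborel (A \<inter> ball x \<delta>) / 2) / measure lborel (ball x \<delta>)) \<longlongrightarrow> 0) (at_right 0)"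
proof -
  let ?n = "DIM('a)" and ?u = "unit_ball_vol (real DIM('a))"
  define F where "F t = measure lborel (A \<inter> ball x t)" for t
  define a where "a j = 1 / real (Suc j)" for j
  have a: "0 < a j" "a (Suc j) < a j" for j by (auto simp: a_def field_simps)
  have adec: "decseq a" using a(2) by (intro decseq_SucI less_imp_le)
  have alim: "a \<longlonglongrightarrow> 0" unfolding a_def using LIMSEQ_inverse_real_of_nat by (simp add: inverse_eq_divide)
  have Fmono: "F s \<le> F t" "F t - F s \<le> ?u * (t ^ ?n - s ^ ?n)" if "0 \<le> s" "s \<le> t" for s t
    using measure_inter_ball_mono_diff[OF A that, of x] by (auto simp: F_def)
  have "\<exists>c. a (Suc j) \<le> c \<and> c \<le> a j \<and> F c = (F (a (Suc j)) + F (a j)) / 2" for j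
  proof (rule IVT')
    have m: "F (a (Suc j)) \<le> F (a j)" using a[of j] a(1)[of "Suc j"] by (intro Fmono) auto
    then show "F (a (Suc j)) \<le> (F (a (Suc j)) + F (a j)) / 2" "(F (a (Suc j)) + F (a j)) / 2 \<le> F (a j)" by auto
    show "a (Suc j) \<le> a j" using a(2)[of j] by simp
    show "continuous_on {a (Suc j)..a j} F"
      unfolding F_def[abs_def] using a(1)[of "Suc j"] by (intro continuous_on_subset[OF continuous_on_measure_inter_ball[OF A]]) auto
  qed
  then obtain c where c: "\<And>j. a (Suc j) \<le> c j" "\<And>j. c j \<le> a j" "\<And>j. F (c j) = (F (a (Suc j)) + F (a j)) / 2" by metis
  define H where "H = A \<inter> (\<Union>j. ball x (c j) - ball x (a (Suc j)))"
  have H: "H \<in> sets borel" "H \<subseteq> A" unfolding H_def using A by auto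
  define G where "G t = measure lborel (H \<inter> ball x t)" for t
  define E where "E t = G t - F t / 2" for t
  have Gdiff: "0 \<le> G t - G s" "G t - G s \<le> F t - F s" if st: "0 \<le> s" "s \<le> t" for s t
  proof -
    show "0 \<le> G t - G s" using measure_inter_ball_mono_diff[OF H(1) st, of x] by (simp add: G_def)
    have "A - H \<in> sets borel" using A H by auto
    from measure_inter_ball_mono_diff[OF this st, of x]
    have "measure lborel ((A - H) \<inter> ball x s) \<le> measure lborel ((A - H) \<inter> ball x t)" by simp
    moreover have "F r = G r + measure lborel ((A - H) \<inter> ball x r)" for r
    proof -
      have "A \<inter> ball x r = (H \<inter> ball x r) \<union> ((A - H) \<inter> ball x r)" using H(2) by blast
      moreover have "(H \<inter> ball x r) \<inter> ((A - H) \<inter> ball x r) = {}" by blast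
      ultimately show ?thesis unfolding F_def G_def
        using measure_Un_disjoint_fm[OF inter_ball_fmeasurable[OF H(1)] inter_ball_fmeasurable[OF \<open>A - H \<in> sets borel\<close>]] by metis
    qed
    ultimately show "G t - G s \<le> F t - F s" by simp
  qed
  \<comment> \<open>Within the annulus \<open>H\<close> is the part of \<open>A\<close> inside
    radius \<open>c j\<close>, which has half the measure by the choice of \<open>c j\<close>;
    \<open>G\<close> and \<open>F / 2\<close> thus grow by the same amount.\<close>
  have Estep: "E (a j) = E (a (Suc j))" for j
  proof -
    have bsub: "ball x (a (Suc j)) \<subseteq> ball x (c j)" "ball x (c j) \<subseteq> ball x (a j)" by (rule subset_ball[OF c(1)], rule subset_ball[OF c(2)])
    have eq: "H \<inter> ball x (a j) = (H \<inter> ball x (a (Suc j))) \<union> (A \<inter> (ball x (c j) - ball x (a (Suc j))))"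
    proof (intro equalityI subsetI)
      fix y assume y: "y \<in> H \<inter> ball x (a j)"
      then obtain k where k: "y \<in> A" "y \<in> ball x (c k)" "y \<notin> ball x (a (Suc k))" by (auto simp: H_def)
      show "y \<in> (H \<inter> ball x (a (Suc j))) \<union> (A \<inter> (ball x (c j) - ball x (a (Suc j))))"
      proof (cases "y \<in> ball x (a (Suc j))")
        case False
        have "a (Suc j) < a k"
          using False k(2) c(2)[of k] by (auto simp: not_less)
        then have "k \<le> j" using decseqD[OF adec, of "Suc j" k] by (meson not_less not_less_eq_eq)
        moreover have "a (Suc k) < a j" using k(3) y by (auto simp: not_less)
        then have "j \<le> k" using decseqD[OF adec, of "Suc k" j] by (meson not_less not_less_eq_eq)
        ultimately have "k = j" by simp
        then show ?thesis using k by blast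
      qed (use y in blast)
    qed (use bsub subset_ball[OF less_imp_le[OF a(2)[of j]], of x] in \<open>unfold H_def, blast\<close>)
    have m2: "A \<inter> (ball x (c j) - ball x (a (Suc j))) \<in> fmeasurable lborel"
      by (rule fmeasurableI2[OF ball_fmeasurable[of x "c j"]]) (use A in auto)
    have "G (a j) = G (a (Suc j)) + measure lborel (A \<inter> (ball x (c j) - ball x (a (Suc j))))"
      unfolding G_def eq by (rule measure_Un_disjoint_fm[OF inter_ball_fmeasurable[OF H(1)] m2]) blast
    moreover have "F (c j) = F (a (Suc j)) + measure lborel (A \<inter> (ball x (c j) - ball x (a (Suc j))))"
    proof -
      have "A \<inter> ball x (c j) = (A \<inter> ball x (a (Suc j))) \<union> (A \<inter> (ball x (c j) - ball x (a (Suc j))))" using bsub by blast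
      then show ?thesis unfolding F_def
        using measure_Un_disjoint_fm[OF inter_ball_fmeasurable[OF A, of x "a (Suc j)"] m2] by auto
    qed
    ultimately show ?thesis using c(3)[of j] by (simp add: E_def field_simps)
  qed
  have F0: "F 0 = 0" "G 0 = 0" by (simp_all add: F_def G_def)
  have Ebd: "\<bar>E t\<bar> \<le> F t" if "0 \<le> t" for t
    using Gdiff[of 0 t] Fmono(1)[of 0 t] that F0 by (simp add: E_def abs_le_iff)
  \<comment> \<open>\<open>E\<close> is constant along the radii and dominated by the volume of the
    ball, which tends to 0 along them.\<close>
  have E0: "E (a j) = 0" for j
  proof -
    have const: "E (a (j + k)) = E (a j)" for k by (induction k) (auto simp: Estep[symmetric])
    have Flim: "(\<lambda>k. ?u * (a (k + j)) ^ ?n) \<longlonglongrightarrow> ?u * 0 ^ ?n"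
      by (intro tendsto_intros LIMSEQ_ignore_initial_segment alim)
    have "\<bar>E (a j)\<bar> \<le> 0"
    proof (rule tendsto_lowerbound)
      have "?u * 0 ^ ?n = 0" by (simp add: power_0_left)
      with Flim show "(\<lambda>k. ?u * (a (k + j)) ^ ?n) \<longlonglongrightarrow> 0" by (simp only:)
      show "\<forall>\<^sub>F k in sequentially. \<bar>E (a j)\<bar> \<le> ?u * (a (k + j)) ^ ?n"
      proof (rule always_eventually, rule allI)
        fix k
        have ak: "0 \<le> a (j + k)" using a(1)[of "j + k"] by simp
        have "\<bar>E (a (j + k))\<bar> \<le> F (a (j + k))" by (rule Ebd[OF ak])
        also have "\<dots> \<le> ?u * a (j + k) ^ ?n" using Fmono(2)[OF order_refl ak] F0 by (simp add: power_0_left)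
        finally show "\<bar>E (a j)\<bar> \<le> ?u * (a (k + j)) ^ ?n" by (simp add: const add.commute)
      qed
    qed simp
    then show ?thesis by simp
  qed
  have "((\<lambda>\<delta>. E \<delta> / measure lborel (ball x \<delta>)) \<longlongrightarrow> 0) (at_right 0)"
  proof (rule tendstoI)
    fix e :: real assume e: "0 < e"
    have "(\<lambda>j. (1 + a j) ^ ?n - 1) \<longlonglongrightarrow> (1 + 0) ^ ?n - 1" by (intro tendsto_intros alim)
    then have "\<forall>\<^sub>F j in sequentially. (1 + a j) ^ ?n - 1 < e / 2" using e by (intro order_tendstoD) auto
    then obtain J where J: "\<And>j. j \<ge> J \<Longrightarrow> (1 + a j) ^ ?n - 1 < e / 2" unfolding eventually_sequentially by blast
    show "\<forall>\<^sub>F \<delta> in at_right 0. dist (E \<delta> / measure lborel (ball x \<delta>)) 0 < e"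
      using eventually_at_right_real[OF a(1)[of J]]
    proof eventually_elim
      fix \<delta> assume "\<delta> \<in> {0<..<a J}"
      then have \<delta>: "0 < \<delta>" "\<delta> < a J" by auto
      have "\<exists>j. a j \<le> \<delta>"
        using order_tendstoD(2)[OF alim \<delta>(1)] unfolding eventually_sequentially by (meson less_imp_le order_refl)
      define k where "k = (LEAST j. a j \<le> \<delta>)"
      have k: "a k \<le> \<delta>" unfolding k_def using \<open>\<exists>j. a j \<le> \<delta>\<close> by (rule LeastI_ex)
      have "k \<noteq> 0"
      proof
        assume "k = 0"
        then have "a 0 \<le> \<delta>" using k by simp
        then show False using \<delta>(2) decseqD[OF adec, of 0 J] by simp
      qed
      then obtain j where j: "k = Suc j" using not0_implies_Suc by blast
      have dj: "\<delta> < a j" using not_less_Least[of j "\<lambda>j. a j \<le> \<delta>"] j unfolding k_def[symmetric] by simp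
      have "J \<le> j"
      proof (rule ccontr)
        assume "\<not> J \<le> j"
        then have "a J \<le> a (Suc j)" using decseqD[OF adec, of "Suc j" J] by simp
        then show False using k \<delta>(2) j by simp
      qed
      have kj: "a (Suc j) \<le> \<delta>" "0 \<le> a (Suc j)" using k j a(1)[of "Suc j"] by auto
      have "\<bar>E \<delta>\<bar> = \<bar>E \<delta> - E (a (Suc j))\<bar>" by (simp add: E0)
      also have "\<dots> \<le> F \<delta> - F (a (Suc j))"
        using Gdiff[OF kj(2,1)] Fmono(1)[OF kj(2,1)] unfolding E_def by (simp add: abs_le_iff field_simps)
      also have "\<dots> \<le> ?u * (\<delta> ^ ?n - a (Suc j) ^ ?n)" by (rule Fmono(2)[OF kj(2,1)])
      also have "\<dots> \<le> ?u * (e / 2 * \<delta> ^ ?n)"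
      proof (rule mult_left_mono)
        \<comment> \<open>In fact \<open>a j = (1 + a j) * a (Suc j)\<close>, so the ratio of
          consecutive radii tends to 1 and the annulus around \<open>\<delta>\<close> is negligible
          against the ball. Geometric radii would not achieve this.\<close>
        have "\<delta> \<le> (1 + a j) * a (Suc j)"
        proof -
          have "(1 + a j) * a (Suc j) = a j" by (simp add: a_def field_simps)
          then show ?thesis using dj by simp
        qed
        then have "\<delta> ^ ?n \<le> ((1 + a j) * a (Suc j)) ^ ?n" using \<delta>(1) by (intro power_mono) auto
        then have "\<delta> ^ ?n - a (Suc j) ^ ?n \<le> ((1 + a j) ^ ?n - 1) * a (Suc j) ^ ?n"
          unfolding power_mult_distrib left_diff_distrib by simp
        also have "\<dots> \<le> e / 2 * \<delta> ^ ?n"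
          using J[OF \<open>J \<le> j\<close>] kj e by (intro mult_mono power_mono) auto
        finally show "\<delta> ^ ?n - a (Suc j) ^ ?n \<le> e / 2 * \<delta> ^ ?n" .
      qed simp
      finally have "\<bar>E \<delta>\<bar> \<le> e / 2 * measure lborel (ball x \<delta>)" using \<delta>(1) by (simp add: content_ball mult_ac)
      moreover have V: "0 < measure lborel (ball x \<delta>)" using \<delta>(1) by simp
      ultimately have "\<bar>E \<delta>\<bar> / measure lborel (ball x \<delta>) \<le> e / 2" by (subst pos_divide_le_eq)
      moreover have "dist (E \<delta> / measure lborel (ball x \<delta>)) 0 = \<bar>E \<delta>\<bar> / measure lborel (ball x \<delta>)"
        using V by (simp add: dist_real_def abs_divide)
      ultimately show "dist (E \<delta> / measure lborel (ball x \<delta>)) 0 < e" using e by linarith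
    qed
  qed
  then show ?thesis by (intro that[OF H]) (simp add: E_def G_def F_def)
qed


lemma Ln_Dens_halving:
  assumes \<Omega>: "open \<Omega>" "x \<in> \<Omega>" and A: "A \<in> borel_subsets \<Omega>"
  obtains H where "H \<in> borel_subsets \<Omega>" "H \<subseteq> A"
    "((\<lambda>\<delta>. density_ratio \<Omega> x H \<delta> - density_ratio \<Omega> x A \<delta> / 2) \<longlongrightarrow> 0) (at_right 0)"
proof -
  have O: "\<Omega> \<in> sets borel" using \<Omega> by simp
  have A': "A \<in> sets borel" "A \<subseteq> \<Omega>" using A borel_subsets_iff[OF O] by auto
  obtain H where H: "H \<in> sets borel" "H \<subseteq> A"
    "((\<lambda>\<delta>. (measure lborel (H \<inter> ball x \<delta>) - measure lborel (A \<inter> ball x \<delta>) / 2) / measure lborel (ball x \<delta>)) \<longlongrightarrow> 0) (at_right 0)"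
    by (rule asymptotic_halving[OF A'(1), of x])
  have HO: "H \<in> borel_subsets \<Omega>" using H(1,2) A'(2) borel_subsets_iff[OF O] by blast
  have "\<exists>r>0. ball x r \<subseteq> \<Omega>" using \<Omega> by (simp add: open_contains_ball)
  then obtain R where R: "0 < R" "ball x R \<subseteq> \<Omega>" by (elim exE conjE)
  have "((\<lambda>\<delta>. density_ratio \<Omega> x H \<delta> - density_ratio \<Omega> x A \<delta> / 2) \<longlongrightarrow> 0) (at_right 0)"
  proof (rule Lim_transform_eventually[OF H(3)])
    show "\<forall>\<^sub>F \<delta> in at_right 0. (measure lborel (H \<inter> ball x \<delta>) - measure lborel (A \<inter> ball x \<delta>) / 2) / measure lborel (ball x \<delta>)
       = density_ratio \<Omega> x H \<delta> - density_ratio \<Omega> x A \<delta> / 2"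
      using eventually_at_right_real[OF R(1)]
    proof eventually_elim
      fix \<delta> assume "\<delta> \<in> {0<..<R}"
      then have "ball x \<delta> \<subseteq> ball x R" by (intro subset_ball) simp
      then have "\<Omega> \<inter> ball x \<delta> = ball x \<delta>" using R(2) by blast
      moreover have "H \<inter> \<Omega> \<inter> ball x \<delta> = H \<inter> ball x \<delta>" "A \<inter> \<Omega> \<inter> ball x \<delta> = A \<inter> ball x \<delta>" using H(2) A'(2) by blast+
      ultimately show "(measure lborel (H \<inter> ball x \<delta>) - measure lborel (A \<inter> ball x \<delta>) / 2) / measure lborel (ball x \<delta>)
         = density_ratio \<Omega> x H \<delta> - density_ratio \<Omega> x A \<delta> / 2"
        unfolding density_ratio_def by (simp add: diff_divide_distrib)
    qed
  qed
  then show ?thesis by (rule that[OF HO H(2)])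
qed

section \<open>From sets to dyadic step functions to bounded functions\<close>

lemma step_integral_cong:
  assumes "\<And>z. z \<in> \<Omega> \<Longrightarrow> h z = g z"
  shows "step_integral \<Omega> \<nu> h = step_integral \<Omega> \<nu> g"
proof -
  have "h ` \<Omega> = g ` \<Omega>" by (rule image_cong[OF refl assms])
  moreover have "h -` {v} \<inter> \<Omega> = g -` {v} \<inter> \<Omega>" for v using assms by auto
  ultimately show ?thesis unfolding step_integral_def by simp
qed

text \<open>Means over small balls are written as step integrals with respect to the density ratio,
  so that one computation covers both these means and the integral with respect to
  \<open>\<mu>\<close>.\<close>

abbreviation mean_step :: "'a::euclidean_space set \<Rightarrow> 'a \<Rightarrow> ('a \<Rightarrow> real) \<Rightarrow> real \<Rightarrow> real" where
  "mean_step \<Omega> x h \<delta> \<equiv> step_integral \<Omega> (\<lambda>A. density_ratio \<Omega> x A \<delta>) h"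

text \<open>The defining inequality of \<open>Ln_Dens\<close> concerns indicators only. A dyadic step function is the
  mean of two step functions of the next coarser level with asymptotically the same mean values,
  which are obtained by rounding its odd numerators up on one half and down on the other half.\<close>

lemma Ln_Dens_dyadic_le:
  assumes \<Omega>: "open \<Omega>" "x \<in> \<Omega>" and \<mu>: "\<mu> \<in> Ln_Dens \<Omega> x" and h: "simple_on \<Omega> h"
    and dy: "\<And>z. z \<in> \<Omega> \<Longrightarrow> \<exists>i::nat. i \<le> 2 ^ m \<and> h z = real i / 2 ^ m"
    and le: "\<And>\<epsilon>. 0 < \<epsilon> \<Longrightarrow> \<forall>\<^sub>F \<delta> in at_right 0. mean_step \<Omega> x h \<delta> \<le> c + \<epsilon>"
  shows "step_integral \<Omega> \<mu> h \<le> c"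
  using h dy le
proof (induction m arbitrary: h)
  case (0 h)
  have O: "\<Omega> \<in> sets borel" using \<Omega> by simp
  have pc: "pos_charge \<Omega> \<mu>" using \<mu> Ln_Dens_subset_Dens[OF \<Omega>] Dens_pos_charge by blast
  let ?A = "h -` {1} \<inter> \<Omega>"
  have A: "?A \<in> borel_subsets \<Omega>" by (rule simple_on_vimage[OF 0(1)])
  have eq: "h z = indicator ?A z" if z: "z \<in> \<Omega>" for z
  proof -
    obtain i :: nat where "i \<le> 2 ^ 0" "h z = real i / 2 ^ 0" using 0(2)[OF z] by blast
    then have "h z = 0 \<or> h z = 1" by (cases i) auto
    then show ?thesis using z by (auto simp: indicator_def)
  qed
  have "step_integral \<Omega> \<nu> h = \<nu> ?A" if \<nu>: "pos_charge \<Omega> \<nu>" for \<nu>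
  proof -
    have "step_integral \<Omega> \<nu> h = step_integral \<Omega> \<nu> (indicator ?A)"
      by (rule step_integral_cong[OF eq])
    then show ?thesis using step_integral_indicator[OF \<nu> A O] by simp
  qed
  then have "step_integral \<Omega> \<mu> h = \<mu> ?A" "\<And>\<delta>. mean_step \<Omega> x h \<delta> = density_ratio \<Omega> x ?A \<delta>"
    using pc pos_charge_density_ratio[OF O] by blast+
  then show ?case using Ln_Dens_le[OF \<mu> A] 0(3) by simp
next
  case (Suc m h)
  have O: "\<Omega> \<in> sets borel" using \<Omega> by simp
  have pc: "pos_charge \<Omega> \<mu>" using \<mu> Ln_Dens_subset_Dens[OF \<Omega>] Dens_pos_charge by blast
  let ?d = "1 / 2 ^ Suc m :: real"
  \<comment> \<open>Even numerators of level \<open>Suc m\<close> already are values of level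
    \<open>m\<close>. As \<open>odds\<close> is a set of values, \<open>A\<close> is a preimage
    under the step function and therefore Borel.\<close>
  define odds where "odds = (\<lambda>i::nat. real i / 2 ^ Suc m) ` {i. i \<le> 2 ^ Suc m \<and> odd i}"
  define A where "A = h -` odds \<inter> \<Omega>"
  have A: "A \<in> borel_subsets \<Omega>"
    using simple_functionD(2)[OF Suc.prems(1), of odds] by (simp add: A_def space_restrict_borel)
  obtain H where H: "H \<in> borel_subsets \<Omega>" "H \<subseteq> A"
    "((\<lambda>\<delta>. density_ratio \<Omega> x H \<delta> - density_ratio \<Omega> x A \<delta> / 2) \<longlongrightarrow> 0) (at_right 0)"
    by (rule Ln_Dens_halving[OF \<Omega> A])
  \<comment> \<open>For \<open>s = 1\<close> the two corrections add up to \<open>?d\<close> on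
    \<open>H\<close> and to \<open>- ?d\<close> on \<open>A - H\<close>; \<open>s = - 1\<close>
    exchanges the roles of the halves.\<close>
  have step: "step_integral \<Omega> \<nu> (\<lambda>z. h z + (s * 2 * ?d) * indicator H z + (- s * ?d) * indicator A z) = step_integral \<Omega> \<nu> h + s * ?d * (2 * \<nu> H - \<nu> A)"
    if \<nu>: "pos_charge \<Omega> \<nu>" for \<nu> s
  proof -
    have sH: "simple_on \<Omega> (\<lambda>z. (s * 2 * ?d) * indicator H z)" "simple_on \<Omega> (\<lambda>z. (- s * ?d) * indicator A z)"
      by (intro simple_function_mult simple_function_const simple_on_indicator H A)+
    have "step_integral \<Omega> \<nu> (\<lambda>z. h z + (s * 2 * ?d) * indicator H z + (- s * ?d) * indicator A z)
      = step_integral \<Omega> \<nu> h + step_integral \<Omega> \<nu> (\<lambda>z. (s * 2 * ?d) * indicator H z) + step_integral \<Omega> \<nu> (\<lambda>z. (- s * ?d) * indicator A z)"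
      by (subst step_integral_add[OF \<nu> simple_function_add[OF Suc.prems(1) sH(1)] sH(2)])
        (subst step_integral_add[OF \<nu> Suc.prems(1) sH(1)], rule refl)
    also have "\<dots> = step_integral \<Omega> \<nu> h + (s * 2 * ?d) * \<nu> H + (- s * ?d) * \<nu> A"
      by (simp only: step_integral_cmult[OF \<nu> simple_on_indicator[OF H(1)]] step_integral_cmult[OF \<nu> simple_on_indicator[OF A]]
          step_integral_indicator[OF \<nu> H(1) O] step_integral_indicator[OF \<nu> A O])
    also have "\<dots> = step_integral \<Omega> \<nu> h + s * ?d * (2 * \<nu> H - \<nu> A)"
    proof -
      have "a + (s * 2 * d) * u + (- s * d) * v = a + s * d * (2 * u - v)" for a d u v :: real by (simp add: algebra_simps)
      then show ?thesis .
    qed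
    finally show ?thesis .
  qed
  have main: "step_integral \<Omega> \<mu> h + s * ?d * (2 * \<mu> H - \<mu> A) \<le> c" if s: "s = 1 \<or> s = -1" for s :: real
  proof -
    let ?h = "\<lambda>z. h z + (s * 2 * ?d) * indicator H z + (- s * ?d) * indicator A z"
    have "step_integral \<Omega> \<mu> ?h \<le> c"
    proof (rule Suc.IH)
      show "simple_on \<Omega> ?h"
        by (intro simple_function_add simple_function_mult simple_function_const simple_on_indicator H A Suc.prems(1))
      show "\<exists>i::nat. i \<le> 2 ^ m \<and> ?h z = real i / 2 ^ m" if z: "z \<in> \<Omega>" for z
      proof -
        obtain i :: nat where i: "i \<le> 2 ^ Suc m" "h z = real i / 2 ^ Suc m" using Suc.prems(2)[OF z] by blast
        show ?thesis
        proof (cases "odd i")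
          case True
          then have zA: "z \<in> A" using i z by (auto simp: A_def odds_def)
          obtain l where l: "i = 2 * l + 1" using True oddE by blast
          have lm: "l + 1 \<le> 2 ^ m" using i(1) l by simp
          have "?h z = real i / 2 ^ Suc m + (if z \<in> H then s else - s) / 2 ^ Suc m"
            using zA i(2) by (auto simp: indicator_def field_simps)
          then consider "?h z = (real i + 1) / 2 ^ Suc m" | "?h z = (real i - 1) / 2 ^ Suc m"
            using s by (cases "z \<in> H") (auto simp: add_divide_distrib diff_divide_distrib)
          then show ?thesis
          proof cases
            case 1
            then have "?h z = real (l + 1) / 2 ^ m" using l by (simp add: field_simps)
            then show ?thesis using lm by blast
          next
            case 2
            then have "?h z = real l / 2 ^ m" using l by (simp add: field_simps)
            moreover have "l \<le> 2 ^ m" using lm by simp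
            ultimately show ?thesis by blast
          qed
        next
          case False
          have "h z \<notin> odds"
          proof
            assume "h z \<in> odds"
            then obtain k :: nat where "odd k" "real k / 2 ^ Suc m = real i / 2 ^ Suc m" using i(2) by (auto simp: odds_def)
            then have "odd k" "k = i" by auto
            then show False using False by simp
          qed
          then have "z \<notin> A" "z \<notin> H" using H(2) by (auto simp: A_def)
          moreover obtain l where l: "i = 2 * l" using False by blast
          ultimately have "?h z = real l / 2 ^ m" "l \<le> 2 ^ m" using i by auto
          then show ?thesis by blast
        qed
      qed
      fix \<epsilon> :: real assume \<epsilon>: "0 < \<epsilon>"
      \<comment> \<open>The mean of the rounded function differs from that of \<open>h\<close> by a
        multiple of the halving error, so the asymptotic bound \<open>c\<close> is
        inherited.\<close>
      have "((\<lambda>\<delta>. s * ?d * 2 * (density_ratio \<Omega> x H \<delta> - density_ratio \<Omega> x A \<delta> / 2)) \<longlongrightarrow> s * ?d * 2 * 0) (at_right 0)"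
        by (intro tendsto_mult tendsto_const H(3))
      then have "\<forall>\<^sub>F \<delta> in at_right 0. s * ?d * 2 * (density_ratio \<Omega> x H \<delta> - density_ratio \<Omega> x A \<delta> / 2) < \<epsilon> / 2"
        using \<epsilon> by (intro order_tendstoD) auto
      moreover have "\<forall>\<^sub>F \<delta> in at_right 0. mean_step \<Omega> x h \<delta> \<le> c + \<epsilon> / 2" using \<epsilon> by (intro Suc.prems(3)) simp
      ultimately show "\<forall>\<^sub>F \<delta> in at_right 0. mean_step \<Omega> x ?h \<delta> \<le> c + \<epsilon>"
      proof eventually_elim
        fix \<delta> assume "s * ?d * 2 * (density_ratio \<Omega> x H \<delta> - density_ratio \<Omega> x A \<delta> / 2) < \<epsilon> / 2" "mean_step \<Omega> x h \<delta> \<le> c + \<epsilon> / 2"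
        moreover have "s * ?d * (2 * density_ratio \<Omega> x H \<delta> - density_ratio \<Omega> x A \<delta>) = s * ?d * 2 * (density_ratio \<Omega> x H \<delta> - density_ratio \<Omega> x A \<delta> / 2)"
          by (simp add: algebra_simps)
        ultimately show "mean_step \<Omega> x ?h \<delta> \<le> c + \<epsilon>"
          unfolding step[OF pos_charge_density_ratio[OF O]] by linarith
      qed
    qed
    then show ?thesis unfolding step[OF pc] .
  qed
  \<comment> \<open>Adding the two inequalities cancels \<open>2 * \<mu> H - \<mu> A\<close>, whose
    value is unknown at this point: the density bounds for \<open>H\<close> and \<open>A\<close>
    separately do not relate the two charges.\<close>
  from main[of 1] main[of "-1"] show ?case by simp
qed

lemma mean_step_eq_integral:
  assumes \<Omega>: "open \<Omega>" and h: "simple_on \<Omega> h" and \<delta>: "ball x \<delta> \<subseteq> \<Omega>"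
  shows "mean_step \<Omega> x h \<delta> = (\<integral>z. h z \<partial>lebesgue_on (ball x \<delta>)) / measure lebesgue (ball x \<delta>)"
proof -
  let ?S = "\<lambda>v. h -` {v} \<inter> \<Omega>" and ?B = "ball x \<delta>"
  have O: "\<Omega> \<in> sets borel" using \<Omega> by simp
  have B: "?B \<in> sets lebesgue" by (simp add: borel_open)
  have S: "?S v \<in> sets borel" for v using simple_on_vimage[OF h] borel_subsets_iff[OF O] by blast
  have iS: "integrable (lebesgue_on ?B) (indicator (?S v) :: _ \<Rightarrow> real)"
    "(\<integral>z. indicator (?S v) z \<partial>lebesgue_on ?B) = measure lborel (?S v \<inter> \<Omega> \<inter> ?B)" for v
  proof -
    have "?S v \<inter> ?B \<in> sets lebesgue" by (rule sets.Int[OF sets_completionI_sets B]) (use S[of v] in simp)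
    then have s: "?S v \<inter> ?B \<in> sets (lebesgue_on ?B)" using B by (simp add: sets_restrict_space_iff)
    have fin: "finite_measure (lebesgue_on ?B)" by (rule finite_measure_lebesgue_on[OF lmeasurable_ball])
    have eq: "indicator (?S v) z = (indicator (?S v \<inter> ?B) z :: real)" if "z \<in> space (lebesgue_on ?B)" for z
      using that by (simp add: space_restrict_space indicator_def)
    have "integrable (lebesgue_on ?B) (indicator (?S v \<inter> ?B) :: _ \<Rightarrow> real)"
      using s finite_measure.emeasure_finite[OF fin] by (intro integrable_real_indicator) (auto simp: less_top)
    then show "integrable (lebesgue_on ?B) (indicator (?S v) :: _ \<Rightarrow> real)"
      using Bochner_Integration.integrable_cong[of "lebesgue_on ?B" "lebesgue_on ?B" "indicator (?S v)" "indicator (?S v \<inter> ?B) :: _ \<Rightarrow> real"] eq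
      by simp
    have "(\<integral>z. indicator (?S v) z \<partial>lebesgue_on ?B) = (\<integral>z. indicator (?S v \<inter> ?B) z \<partial>lebesgue_on ?B :: real)"
      by (rule Bochner_Integration.integral_cong) (simp_all add: eq)
    also have "\<dots> = measure (lebesgue_on ?B) (?S v \<inter> ?B)"
      by (simp add: space_restrict_space Int_assoc)
    also have "\<dots> = measure lebesgue (?S v \<inter> ?B)" using B by (intro measure_restrict_space) auto
    also have "\<dots> = measure lborel (?S v \<inter> ?B)" using S[of v] by (intro measure_completion) auto
    also have "?S v \<inter> ?B = ?S v \<inter> \<Omega> \<inter> ?B" by blast
    finally show "(\<integral>z. indicator (?S v) z \<partial>lebesgue_on ?B) = measure lborel (?S v \<inter> \<Omega> \<inter> ?B)" .
  qed
  have "(\<integral>z. h z \<partial>lebesgue_on ?B) = (\<integral>z. (\<Sum>v\<in>h ` \<Omega>. v * indicator (?S v) z) \<partial>lebesgue_on ?B)"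
  proof (rule Bochner_Integration.integral_cong[OF refl])
    fix z assume "z \<in> space (lebesgue_on ?B)"
    then have z: "z \<in> \<Omega>" using \<delta> by (auto simp: space_restrict_space)
    have "(\<Sum>v\<in>h ` \<Omega>. v * indicator (?S v) z) = (\<Sum>v\<in>h ` \<Omega>. if v = h z then v else 0)"
      using z by (intro sum.cong) (auto simp: indicator_def)
    also have "\<dots> = h z" using z simple_on_finite[OF h] by simp
    finally show "h z = (\<Sum>v\<in>h ` \<Omega>. v * indicator (?S v) z)" by simp
  qed
  also have "\<dots> = (\<Sum>v\<in>h ` \<Omega>. v * measure lborel (?S v \<inter> \<Omega> \<inter> ?B))"
    using iS by (subst Bochner_Integration.integral_sum) auto
  finally have "(\<integral>z. h z \<partial>lebesgue_on ?B) = (\<Sum>v\<in>h ` \<Omega>. v * measure lborel (?S v \<inter> \<Omega> \<inter> ?B))" .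
  moreover have "\<Omega> \<inter> ?B = ?B" using \<delta> by blast
  ultimately show ?thesis
    by (simp add: step_integral_def density_ratio_def sum_divide_distrib)
qed

text \<open>Rescaled to values in the unit interval, \<open>g\<close> is approximated uniformly from
  below by dyadic step functions, whose means are asymptotically at most \<open>l\<close>.
  \<open>Ln_Dens_dyadic_le\<close> gives the upper bound for their integrals and, applied to their
  complements to 1, the lower bound up to the step width.\<close>

lemma bounded_Ln_Dens_integral:
  fixes g :: "'a::euclidean_space \<Rightarrow> real"
  assumes \<Omega>: "open \<Omega>" "x \<in> \<Omega>" and \<mu>: "\<mu> \<in> Ln_Dens \<Omega> x" and d: "0 < d" "ball x d \<subseteq> \<Omega>"
    and g: "g \<in> borel_measurable (lebesgue_on (ball x d))" "AE z in lebesgue. z \<in> ball x d \<longrightarrow> \<bar>g z\<bar> \<le> M"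
    and L: "((\<lambda>\<delta>. (\<integral>z. g z \<partial>lebesgue_on (ball x \<delta>)) / measure lebesgue (ball x \<delta>)) \<longlongrightarrow> L) (at_right 0)"
    and M: "0 < M"
  shows "has_ba_integral_real \<Omega> \<mu> g L"
proof -
  have O: "\<Omega> \<in> sets borel" using \<Omega> by simp
  have \<mu>': "\<mu> \<in> Dens \<Omega> x" using \<mu> Ln_Dens_subset_Dens[OF \<Omega>] by blast
  have pc: "pos_charge \<Omega> \<mu>" "\<mu> \<Omega> = 1" using Dens_pos_charge[OF \<mu>'] \<mu>' by (auto simp: Dens_def)
  let ?g0 = "\<lambda>z. if z \<in> ball x d then (g z + M) / (2 * M) else 0"
  have "(\<lambda>z. (g z + M) / (2 * M)) \<in> borel_measurable (lebesgue_on (ball x d))" using g(1) by measurable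
  then have "?g0 \<in> borel_measurable lebesgue" by (rule borel_measurable_if_I) (simp add: borel_open)
  then obtain g1 where g1: "g1 \<in> borel_measurable lborel" "AE z in lborel. ?g0 z = g1 z"
    using completion_ex_borel_measurable_real by blast
  \<comment> \<open>Truncation of a Borel version: the bounds, known for \<open>g\<close> only
    almost everywhere near \<open>x\<close>, now hold everywhere, and the step functions become
    Borel.\<close>
  define gh where "gh z = min 1 (max 0 (g1 z))" for z
  have gm: "gh \<in> borel_measurable borel" unfolding gh_def[abs_def] using g1(1) by measurable
  have gb: "0 \<le> gh z" "gh z \<le> 1" for z by (auto simp: gh_def)
  have gAE: "AE z in lebesgue. z \<in> ball x d \<longrightarrow> gh z = (g z + M) / (2 * M)"
    using g(2) AE_completion[OF g1(2)]
  proof eventually_elim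
    fix z assume a: "z \<in> ball x d \<longrightarrow> \<bar>g z\<bar> \<le> M" "?g0 z = g1 z"
    show "z \<in> ball x d \<longrightarrow> gh z = (g z + M) / (2 * M)"
    proof
      assume z: "z \<in> ball x d"
      then have "0 \<le> (g z + M) / (2 * M)" "(g z + M) / (2 * M) \<le> 1" using a(1) M by (auto simp: divide_le_eq_1)
      then show "gh z = (g z + M) / (2 * M)" using a(2) z by (simp add: gh_def)
    qed
  qed
  obtain N where N: "N \<in> null_sets lborel" "{z. \<not> (z \<in> ball x d \<longrightarrow> gh z = (g z + M) / (2 * M))} \<subseteq> N"
    using gAE unfolding AE_completion_iff by (auto simp: eventually_ae_filter)
  define h where "h k z = real_of_int \<lfloor>2 ^ k * gh z\<rfloor> / 2 ^ k" for k :: nat and z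
  have happ: "gh z - 1 / 2 ^ k \<le> h k z" "h k z \<le> gh z" for k z
  proof -
    have "2 ^ k * gh z - 1 \<le> real_of_int \<lfloor>2 ^ k * gh z\<rfloor>" "real_of_int \<lfloor>2 ^ k * gh z\<rfloor> \<le> 2 ^ k * gh z" by linarith+
    then have "(2 ^ k * gh z - 1) / 2 ^ k \<le> h k z" "h k z \<le> (2 ^ k * gh z) / 2 ^ k"
      unfolding h_def by (intro divide_right_mono; simp)+
    then show "gh z - 1 / 2 ^ k \<le> h k z" "h k z \<le> gh z" by (simp_all add: diff_divide_distrib)
  qed
  have hdy: "\<exists>i::nat. i \<le> 2 ^ k \<and> h k z = real i / 2 ^ k" for k z
  proof (intro exI conjI)
    have "2 ^ k * gh z \<le> 2 ^ k" using gb[of z] by simp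
    from order_trans[OF of_int_floor_le this]
    have "real_of_int \<lfloor>2 ^ k * gh z\<rfloor> \<le> real_of_int (2 ^ k)" by simp
    then have "\<lfloor>2 ^ k * gh z\<rfloor> \<le> 2 ^ k" by (simp only: of_int_le_iff)
    then show "nat \<lfloor>2 ^ k * gh z\<rfloor> \<le> 2 ^ k" by (simp add: nat_le_iff)
    show "h k z = real (nat \<lfloor>2 ^ k * gh z\<rfloor>) / 2 ^ k" using gb[of z] by (simp add: h_def)
  qed
  have hsimple: "simple_on \<Omega> (h k)" for k
  proof (rule simple_function_borel_measurable)
    have "h k \<in> borel_measurable borel" unfolding h_def[abs_def] using gm by measurable
    then show "h k \<in> borel_measurable (restrict_space borel \<Omega>)" by (rule measurable_restrict_space1)
    have "h k ` \<Omega> \<subseteq> (\<lambda>i::nat. real i / 2 ^ k) ` {..2 ^ k}" using hdy[of k] by blast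
    then show "finite (h k ` space (restrict_space borel \<Omega>))"
      unfolding space_restrict_borel by (rule finite_subset) simp
  qed
  have p1: "1 / 2 ^ k \<le> (1::real)" for k by simp
  define l where "l = (L + M) / (2 * M)"
  have int: "integrable (lebesgue_on (ball x \<delta>)) u" if "u \<in> borel_measurable borel" "\<And>z. \<bar>u z\<bar> \<le> 2" for u :: "'a \<Rightarrow> real" and \<delta>
  proof (rule finite_measure.integrable_const_bound[where B = 2])
    show "finite_measure (lebesgue_on (ball x \<delta>))" by (rule finite_measure_lebesgue_on[OF lmeasurable_ball])
    have "u \<in> borel_measurable lebesgue" using that(1) by (intro measurable_completion) simp
    then show "u \<in> borel_measurable (lebesgue_on (ball x \<delta>))" by (rule measurable_restrict_space1)
  qed (use that in simp)
  have igh: "integrable (lebesgue_on (ball x \<delta>)) gh" for \<delta>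
  proof (rule int[OF gm])
    show "\<bar>gh z\<bar> \<le> 2" for z using gb[of z] by linarith
  qed
  have cst: "integrable (lebesgue_on (ball x \<delta>)) (\<lambda>z. c)" for c :: real and \<delta>
    by (rule finite_measure.integrable_const[OF finite_measure_lebesgue_on[OF lmeasurable_ball]])
  have icst: "(\<integral>z. c \<partial>lebesgue_on (ball x \<delta>)) = c * measure lebesgue (ball x \<delta>)" for c :: real and \<delta>
    by (simp add: measure_restrict_space borel_open)
  have mean: "((\<lambda>\<delta>. (\<integral>z. gh z \<partial>lebesgue_on (ball x \<delta>)) / measure lebesgue (ball x \<delta>)) \<longlongrightarrow> l) (at_right 0)"
  proof (rule Lim_transform_eventually)
    show "((\<lambda>\<delta>. ((\<integral>z. g z \<partial>lebesgue_on (ball x \<delta>)) / measure lebesgue (ball x \<delta>) + M) / (2 * M)) \<longlongrightarrow> l) (at_right 0)"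
      unfolding l_def using M by (intro tendsto_intros L) auto
    show "\<forall>\<^sub>F \<delta> in at_right 0. ((\<integral>z. g z \<partial>lebesgue_on (ball x \<delta>)) / measure lebesgue (ball x \<delta>) + M) / (2 * M)
        = (\<integral>z. gh z \<partial>lebesgue_on (ball x \<delta>)) / measure lebesgue (ball x \<delta>)"
      using eventually_at_right_real[OF d(1)]
    proof eventually_elim
      fix \<delta> assume "\<delta> \<in> {0<..<d}"
      then have \<delta>: "0 < \<delta>" "ball x \<delta> \<subseteq> ball x d" by (auto intro: subset_ball)
      have V: "0 < measure lebesgue (ball x \<delta>)" using \<delta>(1) by simp
      have ae: "AE z in lebesgue. z \<in> ball x \<delta> \<longrightarrow> 2 * M * gh z - M = g z"
        using gAE by eventually_elim (use \<delta>(2) M in auto)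
      have m1: "(\<lambda>z. 2 * M * gh z - M) \<in> borel_measurable (lebesgue_on (ball x \<delta>))" using igh by measurable
      have m2: "g \<in> borel_measurable (lebesgue_on (ball x \<delta>))"
        by (rule borel_measurable_lebesgue_on_AE[OF m1 _ ae]) (simp add: borel_open)
      have "(\<integral>z. g z \<partial>lebesgue_on (ball x \<delta>)) = (\<integral>z. 2 * M * gh z - M \<partial>lebesgue_on (ball x \<delta>))"
        by (rule Bochner_Integration.integral_cong_AE[OF m2 m1])
          (use ae in \<open>simp add: AE_restrict_space_iff borel_open eq_commute\<close>)
      also have "\<dots> = 2 * M * (\<integral>z. gh z \<partial>lebesgue_on (ball x \<delta>)) - M * measure lebesgue (ball x \<delta>)"
        using igh[of \<delta>] cst[of \<delta> M] by (simp only: Bochner_Integration.integral_diff Bochner_Integration.integrable_mult_right Bochner_Integration.integral_mult_right_zero icst)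
      finally have "(\<integral>z. gh z \<partial>lebesgue_on (ball x \<delta>)) = ((\<integral>z. g z \<partial>lebesgue_on (ball x \<delta>)) + M * measure lebesgue (ball x \<delta>)) / (2 * M)"
        using M by (simp add: field_simps)
      moreover have "(I / V + M) / (2 * M) = (I + M * V) / (2 * M) / V" if "0 < V" for I V :: real
        using that M by (simp add: field_simps)
      ultimately show "((\<integral>z. g z \<partial>lebesgue_on (ball x \<delta>)) / measure lebesgue (ball x \<delta>) + M) / (2 * M)
        = (\<integral>z. gh z \<partial>lebesgue_on (ball x \<delta>)) / measure lebesgue (ball x \<delta>)"
        using V by (simp only:)
    qed
  qed
  have up: "step_integral \<Omega> \<mu> (h k) \<le> l" for k
  proof (rule Ln_Dens_dyadic_le[OF \<Omega> \<mu> hsimple hdy])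
    fix \<epsilon> :: real assume "0 < \<epsilon>"
    then have "\<forall>\<^sub>F \<delta> in at_right 0. (\<integral>z. gh z \<partial>lebesgue_on (ball x \<delta>)) / measure lebesgue (ball x \<delta>) < l + \<epsilon>"
      by (intro order_tendstoD(2)[OF mean]) simp
    then show "\<forall>\<^sub>F \<delta> in at_right 0. mean_step \<Omega> x (h k) \<delta> \<le> l + \<epsilon>"
      using eventually_at_right_real[OF d(1)]
    proof eventually_elim
      fix \<delta> assume e: "(\<integral>z. gh z \<partial>lebesgue_on (ball x \<delta>)) / measure lebesgue (ball x \<delta>) < l + \<epsilon>" and "\<delta> \<in> {0<..<d}"
      then have "ball x \<delta> \<subseteq> ball x d" by (intro subset_ball) simp
      then have "ball x \<delta> \<subseteq> \<Omega>" using d(2) by (rule order_trans)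
      note ms = mean_step_eq_integral[OF \<Omega>(1) hsimple this, of k]
      have ih: "integrable (lebesgue_on (ball x \<delta>)) (h k)"
      proof (rule int)
        show "h k \<in> borel_measurable borel" unfolding h_def[abs_def] using gm by measurable
        show "\<bar>h k z\<bar> \<le> 2" for z using happ[where k=k and z=z] gb[of z] p1[of k] by linarith
      qed
      have "(\<integral>z. h k z \<partial>lebesgue_on (ball x \<delta>)) \<le> (\<integral>z. gh z \<partial>lebesgue_on (ball x \<delta>))"
        by (rule Bochner_Integration.integral_mono[OF ih igh happ(2)])
      then have "(\<integral>z. h k z \<partial>lebesgue_on (ball x \<delta>)) / measure lebesgue (ball x \<delta>) \<le> (\<integral>z. gh z \<partial>lebesgue_on (ball x \<delta>)) / measure lebesgue (ball x \<delta>)"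
        by (rule divide_right_mono) simp
      then show "mean_step \<Omega> x (h k) \<delta> \<le> l + \<epsilon>" using e unfolding ms by linarith
    qed
  qed
  have s1: "simple_on \<Omega> (\<lambda>z. 1 + (- 1) * h k z)" for k
    by (intro simple_function_add simple_function_mult simple_function_const hsimple)
  have step1: "step_integral \<Omega> \<mu> (\<lambda>z. a + b * h k z) = a + b * step_integral \<Omega> \<mu> (h k)" for a b k
  proof -
    have "simple_on \<Omega> (\<lambda>z. b * h k z)" by (intro simple_function_mult simple_function_const hsimple)
    from step_integral_add[OF pc(1) simple_function_const this]
    show ?thesis using pc(2) by (simp add: step_integral_const[OF pc(1)] step_integral_cmult[OF pc(1) hsimple])
  qed
  have low: "l - 1 / 2 ^ k \<le> step_integral \<Omega> \<mu> (h k)" for k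
  proof -
    \<comment> \<open>The complement of a dyadic step function is dyadic of the same level. Since
      \<open>h k\<close> lies below \<open>gh\<close> by at most \<open>1 / 2 ^ k\<close>, its
      complement exceeds \<open>1 - gh\<close> by no more than that.\<close>
    have "step_integral \<Omega> \<mu> (\<lambda>z. 1 + (- 1) * h k z) \<le> 1 - l + 1 / 2 ^ k"
    proof (rule Ln_Dens_dyadic_le[OF \<Omega> \<mu> s1])
      show "\<exists>i::nat. i \<le> 2 ^ k \<and> 1 + (- 1) * h k z = real i / 2 ^ k" for z
      proof -
        obtain i :: nat where i: "i \<le> 2 ^ k" "h k z = real i / 2 ^ k" using hdy by blast
        then have "1 + (- 1) * h k z = real (2 ^ k - i) / 2 ^ k" by (simp add: of_nat_diff diff_divide_distrib)
        then show ?thesis by (intro exI[of _ "2 ^ k - i"]) simp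
      qed
      fix \<epsilon> :: real assume "0 < \<epsilon>"
      then have "\<forall>\<^sub>F \<delta> in at_right 0. (\<integral>z. gh z \<partial>lebesgue_on (ball x \<delta>)) / measure lebesgue (ball x \<delta>) > l - \<epsilon>"
        by (intro order_tendstoD(1)[OF mean]) simp
      then show "\<forall>\<^sub>F \<delta> in at_right 0. mean_step \<Omega> x (\<lambda>z. 1 + (- 1) * h k z) \<delta> \<le> 1 - l + 1 / 2 ^ k + \<epsilon>"
        using eventually_at_right_real[OF d(1)]
      proof eventually_elim
        fix \<delta> assume e: "(\<integral>z. gh z \<partial>lebesgue_on (ball x \<delta>)) / measure lebesgue (ball x \<delta>) > l - \<epsilon>" and \<delta>: "\<delta> \<in> {0<..<d}"
        then have "ball x \<delta> \<subseteq> ball x d" by (intro subset_ball) simp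
        then have "ball x \<delta> \<subseteq> \<Omega>" using d(2) by (rule order_trans)
        note ms = mean_step_eq_integral[OF \<Omega>(1) s1 this, of k]
        have V: "0 < measure lebesgue (ball x \<delta>)" using \<delta> by simp
        have ih: "integrable (lebesgue_on (ball x \<delta>)) (\<lambda>z. 1 + (- 1) * h k z)"
        proof (rule int)
          show "(\<lambda>z. 1 + (- 1) * h k z) \<in> borel_measurable borel" unfolding h_def[abs_def] using gm by measurable
          show "\<bar>1 + (- 1) * h k z\<bar> \<le> 2" for z using happ[where k=k and z=z] gb[of z] p1[of k] by linarith
        qed
        have "(\<integral>z. 1 + (- 1) * h k z \<partial>lebesgue_on (ball x \<delta>)) \<le> (\<integral>z. (1 + 1 / 2 ^ k) - gh z \<partial>lebesgue_on (ball x \<delta>))"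
        proof (rule Bochner_Integration.integral_mono[OF ih])
          show "integrable (lebesgue_on (ball x \<delta>)) (\<lambda>z. (1 + 1 / 2 ^ k) - gh z)" by (rule Bochner_Integration.integrable_diff[OF cst igh])
          show "1 + (- 1) * h k z \<le> (1 + 1 / 2 ^ k) - gh z" for z using happ(1)[where k=k and z=z] by linarith
        qed
        also have "\<dots> = (1 + 1 / 2 ^ k) * measure lebesgue (ball x \<delta>) - (\<integral>z. gh z \<partial>lebesgue_on (ball x \<delta>))"
          unfolding Bochner_Integration.integral_diff[OF cst igh] icst ..
        finally have "(\<integral>z. 1 + (- 1) * h k z \<partial>lebesgue_on (ball x \<delta>)) / measure lebesgue (ball x \<delta>)
            \<le> ((1 + 1 / 2 ^ k) * measure lebesgue (ball x \<delta>) - (\<integral>z. gh z \<partial>lebesgue_on (ball x \<delta>))) / measure lebesgue (ball x \<delta>)"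
          using V by (intro divide_right_mono) auto
        also have "\<dots> = (1 + 1 / 2 ^ k) - (\<integral>z. gh z \<partial>lebesgue_on (ball x \<delta>)) / measure lebesgue (ball x \<delta>)"
          using V by (simp add: diff_divide_distrib)
        finally show "mean_step \<Omega> x (\<lambda>z. 1 + (- 1) * h k z) \<delta> \<le> 1 - l + 1 / 2 ^ k + \<epsilon>"
          using e unfolding ms by linarith
      qed
    qed
    then show ?thesis unfolding step1 by linarith
  qed
  have p2: "(\<lambda>k. 1 / 2 ^ k :: real) \<longlonglongrightarrow> 0"
    using LIMSEQ_power_zero[of "1 / 2 :: real"] by (simp add: power_one_over)
  have lim: "(\<lambda>k. step_integral \<Omega> \<mu> (h k)) \<longlonglongrightarrow> l"
  proof (rule tendsto_sandwich)
    show "(\<lambda>k. l - 1 / 2 ^ k) \<longlonglongrightarrow> l" using tendsto_diff[OF tendsto_const p2, of l] by simp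
  qed (use up low in auto)
  show ?thesis
    unfolding has_ba_integral_real_def
  proof (intro exI[of _ "\<lambda>k z. - M + (2 * M) * h k z"] conjI allI impI)
    show "simple_on \<Omega> (\<lambda>z. - M + (2 * M) * h k z)" for k
      by (intro simple_function_add simple_function_mult simple_function_const hsimple)
    have "(\<lambda>k. - M + (2 * M) * step_integral \<Omega> \<mu> (h k)) \<longlonglongrightarrow> - M + (2 * M) * l" by (intro tendsto_intros lim)
    moreover have "- M + (2 * M) * l = L" using M by (simp add: l_def)
    ultimately show "(\<lambda>k. step_integral \<Omega> \<mu> (\<lambda>z. - M + (2 * M) * h k z)) \<longlonglongrightarrow> L" unfolding step1 by simp
    show "((\<lambda>(k, l). step_integral \<Omega> \<mu> (\<lambda>z. \<bar>(- M + (2 * M) * h k z) - (- M + (2 * M) * h l z)\<bar>)) \<longlongrightarrow> 0) (sequentially \<times>\<^sub>F sequentially)"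
    proof (rule Lim_null_comparison)
      have b: "\<bar>step_integral \<Omega> \<mu> (\<lambda>z. \<bar>(- M + (2 * M) * h k z) - (- M + (2 * M) * h j z)\<bar>)\<bar> \<le> 2 * M * (1 / 2 ^ k + 1 / 2 ^ j)" for k j
      proof -
        have s: "simple_on \<Omega> (\<lambda>z. \<bar>(- M + (2 * M) * h k z) - (- M + (2 * M) * h j z)\<bar>)"
          by (intro simple_on_abs_diff simple_function_add simple_function_mult simple_function_const hsimple)
        have "step_integral \<Omega> \<mu> (\<lambda>z. \<bar>(- M + (2 * M) * h k z) - (- M + (2 * M) * h j z)\<bar>) \<le> step_integral \<Omega> \<mu> (\<lambda>_. 2 * M * (1 / 2 ^ k + 1 / 2 ^ j))"
        proof (rule step_integral_mono[OF pc(1) s simple_function_const])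
          fix z
          have "\<bar>h k z - h j z\<bar> \<le> 1 / 2 ^ k + 1 / 2 ^ j"
            using happ[where k=k and z=z] happ[where k=j and z=z] zero_le_power[of "1/2::real" k] zero_le_power[of "1/2::real" j]
            by (simp add: power_one_over abs_le_iff)
          then have "2 * M * \<bar>h k z - h j z\<bar> \<le> 2 * M * (1 / 2 ^ k + 1 / 2 ^ j)" using M by (intro mult_left_mono) auto
          moreover have "\<bar>(- M + (2 * M) * h k z) - (- M + (2 * M) * h j z)\<bar> = 2 * M * \<bar>h k z - h j z\<bar>"
            using M by (simp add: abs_mult flip: right_diff_distrib)
          ultimately show "\<bar>(- M + (2 * M) * h k z) - (- M + (2 * M) * h j z)\<bar> \<le> 2 * M * (1 / 2 ^ k + 1 / 2 ^ j)" by simp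
        qed
        moreover have "0 \<le> step_integral \<Omega> \<mu> (\<lambda>z. \<bar>(- M + (2 * M) * h k z) - (- M + (2 * M) * h j z)\<bar>)"
          using step_integral_mono[OF pc(1) simple_function_const s, of 0] by (simp add: step_integral_const[OF pc(1)])
        ultimately show ?thesis using pc(2) by (simp add: step_integral_const[OF pc(1)])
      qed
      show "\<forall>\<^sub>F kl in sequentially \<times>\<^sub>F sequentially. norm (case kl of (k, l) \<Rightarrow> step_integral \<Omega> \<mu> (\<lambda>z. \<bar>(- M + (2 * M) * h k z) - (- M + (2 * M) * h l z)\<bar>))
          \<le> 2 * M * (1 / 2 ^ fst kl + 1 / 2 ^ snd kl)"
        by (rule always_eventually) (simp only: split_paired_All case_prod_conv fst_conv snd_conv real_norm_def b simp_thms)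
      have "((\<lambda>kl. 2 * M * (1 / 2 ^ fst kl + 1 / 2 ^ snd kl)) \<longlongrightarrow> 2 * M * (0 + 0)) (sequentially \<times>\<^sub>F sequentially)"
        by (intro tendsto_mult tendsto_add tendsto_const filterlim_compose[OF p2 filterlim_fst] filterlim_compose[OF p2 filterlim_snd])
      then show "((\<lambda>kl. 2 * M * (1 / 2 ^ fst kl + 1 / 2 ^ snd kl)) \<longlongrightarrow> 0) (sequentially \<times>\<^sub>F sequentially)" by simp
    qed
    fix \<epsilon> :: real assume \<epsilon>: "0 < \<epsilon>"
    have "(\<lambda>k. 2 * M * (1 / 2 ^ k)) \<longlonglongrightarrow> 2 * M * 0" by (intro tendsto_mult tendsto_const p2)
    then have "\<forall>\<^sub>F k in sequentially. 2 * M * (1 / 2 ^ k) < \<epsilon>" using \<epsilon> by (intro order_tendstoD(2)) auto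
    then show "(\<lambda>k. ba_outer \<Omega> \<mu> {z\<in>\<Omega>. \<bar>(- M + (2 * M) * h k z) - g z\<bar> > \<epsilon>}) \<longlonglongrightarrow> 0"
    proof (rule tendsto_eventually[OF eventually_mono])
      fix k assume k: "2 * M * (1 / 2 ^ k) < \<epsilon>"
      let ?S = "{z\<in>\<Omega>. \<bar>(- M + (2 * M) * h k z) - g z\<bar> > \<epsilon>}"
      have NB: "N \<inter> \<Omega> \<in> borel_subsets \<Omega>" using N(1) O by (auto simp: borel_subsets_iff)
      have "emeasure lborel (N \<inter> \<Omega>) = 0" using N(1) O by (metis null_setsD1 null_set_Int2 sets_lborel)
      then have NM: "\<mu> (N \<inter> \<Omega>) = 0" using \<mu>' NB by (auto simp: Dens_def ba_def)
      have "?S \<inter> ball x d \<subseteq> N \<inter> \<Omega>"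
      proof
        fix z assume z: "z \<in> ?S \<inter> ball x d"
        have "gh z \<noteq> (g z + M) / (2 * M)"
        proof
          assume eq: "gh z = (g z + M) / (2 * M)"
          have "\<bar>h k z - gh z\<bar> \<le> 1 / 2 ^ k" using happ[where k=k and z=z] by (simp add: abs_le_iff)
          then have "2 * M * \<bar>h k z - gh z\<bar> \<le> 2 * M * (1 / 2 ^ k)" using M by (intro mult_left_mono) auto
          moreover have "(- M + (2 * M) * h k z) - g z = 2 * M * (h k z - gh z)" using M unfolding eq by (simp add: field_simps)
          then have "\<bar>(- M + (2 * M) * h k z) - g z\<bar> = 2 * M * \<bar>h k z - gh z\<bar>" using M by (simp add: abs_mult)
          ultimately show False using z k by simp
        qed
        then show "z \<in> N \<inter> \<Omega>" using N(2) z by auto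
      qed
      then obtain B where B: "B \<in> borel_subsets \<Omega>" "?S \<subseteq> B" "\<mu> B = 0"
        using Dens_null_cover[OF \<mu>' O d(1) _ _ NB NM, of ?S] by blast
      have "ba_outer \<Omega> \<mu> ?S \<le> 0" using ba_outer_le[OF pc(1) B(1,2)] B(3) by simp
      then show "ba_outer \<Omega> \<mu> ?S = 0" by (intro antisym ba_outer_nonneg[OF pc(1) _ O]) auto
    qed
  qed
qed

section \<open>Differentiability and precise representatives\<close>

lemma in_Lp_bounded:
  assumes "in_Lp \<infinity> S g"
  obtains M where "0 < M" "AE z in lebesgue_on S. norm (g z) \<le> M"
proof -
  have e: "esssup (lebesgue_on S) (\<lambda>x. ereal (norm (g x))) < \<infinity>" using assms by (simp add: in_Lp_def)
  then obtain M where M: "esssup (lebesgue_on S) (\<lambda>x. ereal (norm (g x))) < ereal M"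
    using ereal_dense2 by blast
  have "AE z in lebesgue_on S. ereal (norm (g z)) \<le> esssup (lebesgue_on S) (\<lambda>x. ereal (norm (g x)))"
    by (rule esssup_AE)
  then have "AE z in lebesgue_on S. norm (g z) \<le> max M 1"
  proof eventually_elim
    fix z assume "ereal (norm (g z)) \<le> esssup (lebesgue_on S) (\<lambda>x. ereal (norm (g x)))"
    then have "ereal (norm (g z)) < ereal M" using M by (rule order_le_less_trans)
    then show "norm (g z) \<le> max M 1" by simp
  qed
  then show ?thesis by (rule that[rotated]) simp
qed

text \<open>For \<open>p = \<infinity>\<close> a locally bounded function is integrable on compact
  sets to the power \<open>n + 1\<close>, so both cases reduce to a real exponent above the
  dimension.\<close>

lemma in_Lp_loc_real_exponent:
  fixes G :: "'a::euclidean_space \<Rightarrow> 'b::euclidean_space"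
  assumes p: "of_nat n < p" and G: "in_Lp_loc p \<Omega> G"
  obtains q where "real n < q" "\<And>K. compact K \<Longrightarrow> K \<subseteq> \<Omega> \<Longrightarrow> integrable (lebesgue_on K) (\<lambda>z. norm (G z) powr q)"
proof (cases "p = \<infinity>")
  case True
  show ?thesis
  proof (rule that[of "real n + 1"])
    fix K assume K: "compact K" "K \<subseteq> \<Omega>"
    then have L: "in_Lp \<infinity> K G" using G True by (simp add: in_Lp_loc_def)
    then have m: "G \<in> borel_measurable (lebesgue_on K)" by (simp add: in_Lp_def)
    obtain M where M: "0 < M" "AE z in lebesgue_on K. norm (G z) \<le> M" by (rule in_Lp_bounded[OF L])
    show "integrable (lebesgue_on K) (\<lambda>z. norm (G z) powr (real n + 1))"
    proof (rule finite_measure.integrable_const_bound)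
      show "finite_measure (lebesgue_on K)" by (rule finite_measure_lebesgue_on[OF lmeasurable_compact[OF K(1)]])
      show "AE z in lebesgue_on K. norm (norm (G z) powr (real n + 1)) \<le> M powr (real n + 1)"
        using M(2) by eventually_elim (simp add: powr_mono2)
      show "(\<lambda>z. norm (G z) powr (real n + 1)) \<in> borel_measurable (lebesgue_on K)" using m by measurable
    qed
  qed simp
next
  case False
  then obtain q where q: "p = ennreal q" "0 \<le> q" by (cases p) auto
  show ?thesis
  proof (rule that[of q])
    show "real n < q" using p q by (simp add: ennreal_of_nat_eq_real_of_nat ennreal_less_iff)
    show "integrable (lebesgue_on K) (\<lambda>z. norm (G z) powr q)" if "compact K" "K \<subseteq> \<Omega>" for K
      using G that q by (simp add: in_Lp_loc_def in_Lp_def)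
  qed
qed

text \<open>Near \<open>x\<close>, the points where the continuous \<open>ft\<close> violates the
  remainder bound form an open set. As \<open>g\<close> satisfies the bound and equals
  \<open>ft\<close> almost everywhere, this set is null, hence empty. Differentiability of any
  representative is thus that of \<open>ft\<close>.\<close>

lemma first_order_expansion_imp_derivative:
  fixes ft g :: "real^'n \<Rightarrow> real^'m"
  assumes \<Omega>: "open \<Omega>" "x \<in> \<Omega>" and ft: "continuous_on \<Omega> ft" "AE z in lebesgue. z \<in> \<Omega> \<longrightarrow> ft z = g z"
    and g: "first_order_expansion \<Omega> g x \<alpha> L"
  shows "(ft has_derivative (\<lambda>h. L *v h)) (at x)"
proof -
  let ?R = "\<lambda>u z. u z - \<alpha> - L *v (z - x)"
  have bound: "\<exists>d>0. \<forall>z. norm (z - x) < d \<longrightarrow> norm (?R ft z) \<le> e * norm (z - x)" if e: "0 < e" for e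
  proof -
    have "\<forall>\<^sub>F z in at x within \<Omega>. dist (?R g z /\<^sub>R norm (z - x)) 0 < e"
      using g e unfolding first_order_expansion_def by (rule tendstoD)
    then obtain d where d: "0 < d" "\<And>z. z \<in> \<Omega> \<Longrightarrow> z \<noteq> x \<Longrightarrow> dist z x < d \<Longrightarrow> norm (?R g z /\<^sub>R norm (z - x)) < e"
      unfolding eventually_at by auto
    have "\<exists>r>0. ball x r \<subseteq> \<Omega>" using \<Omega> by (simp add: open_contains_ball)
    then obtain r where r: "0 < r" "ball x r \<subseteq> \<Omega>" by (elim exE conjE)
    let ?U = "ball x (min d r)"
    have U: "?U \<subseteq> \<Omega>" using r(2) by (auto simp: subset_iff)
    have cont: "continuous_on ?U (\<lambda>z. norm (?R ft z) - e * norm (z - x))"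
      by (intro continuous_intros continuous_on_subset[OF ft(1) U] bounded_linear.continuous_on[OF matrix_vector_mul_bounded_linear])
    let ?S = "?U \<inter> (\<lambda>z. norm (?R ft z) - e * norm (z - x)) -` {0<..}"
    have oS: "open ?S" by (rule continuous_open_preimage[OF cont]) auto
    \<comment> \<open>The expansion of \<open>g\<close> says nothing at \<open>x\<close>
      itself.\<close>
    have "negligible {x}" by simp
    then have "AE z in lebesgue. z \<notin> {x}" unfolding negligible_iff_null_sets by (rule AE_not_in)
    with ft(2) have "AE z in lebesgue. z \<notin> ?S"
    proof eventually_elim
      fix z assume a: "z \<in> \<Omega> \<longrightarrow> ft z = g z" "z \<notin> {x}"
      show "z \<notin> ?S"
      proof
        assume zS: "z \<in> ?S"
        then have z: "z \<in> \<Omega>" "z \<noteq> x" "dist z x < d" using U a(2) by (auto simp: dist_commute)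
        have "norm (?R g z) / norm (z - x) < e" using d(2)[OF z] by (simp add: divide_inverse mult.commute)
        then have "norm (?R g z) < e * norm (z - x)" using z(2) by (simp add: pos_divide_less_eq)
        then show False using zS a(1) z(1) by auto
      qed
    qed
    moreover have "?S \<in> sets lebesgue" using oS by (simp add: borel_open)
    ultimately have "?S \<in> null_sets lebesgue" by (simp only: AE_iff_null_sets)
    then have "?S = {}" using open_not_negligible[OF oS] by (auto simp: negligible_iff_null_sets)
    then have b: "norm (?R ft z) \<le> e * norm (z - x)" if "z \<in> ?U" for z using that by (auto simp: not_less)
    show ?thesis
      using d(1) r(1) by (intro exI[of _ "min d r"] conjI allI impI b) (auto simp: dist_norm norm_minus_commute)
  qed
  obtain d where "0 < d" "\<forall>z. norm (z - x) < d \<longrightarrow> norm (?R ft z) \<le> 1 * norm (z - x)" using bound[of 1] by auto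
  \<comment> \<open>The bound for \<open>ft\<close> holds also at \<open>x\<close>; there it
    identifies \<open>\<alpha>\<close> with \<open>ft x\<close>.\<close>
  then have "norm (?R ft x) \<le> 1 * norm (x - x)" by (metis diff_self norm_zero)
  then have "ft x = \<alpha>" by (simp add: matrix_vector_mult_0_right)
  then show ?thesis
    unfolding has_derivative_at_alt using bound by (auto simp: matrix_vector_mul_bounded_linear algebra_simps)
qed

lemma derivative_imp_first_order_expansion:
  assumes "(ft has_derivative (\<lambda>h. L *v h)) (at x)"
  shows "first_order_expansion \<Omega> ft x (ft x) L"
proof -
  have "(ft has_derivative (\<lambda>h. L *v h)) (at x within \<Omega>)" using assms by (rule has_derivative_at_withinI)
  then have "((\<lambda>y. (1 / norm (y - x)) *\<^sub>R (ft y - (ft x + L *v (y - x)))) \<longlongrightarrow> 0) (at x within \<Omega>)"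
    by (simp add: has_derivative_within)
  then show ?thesis
    unfolding first_order_expansion_def by (simp add: inverse_eq_divide diff_diff_eq)
qed

lemma has_star_value_continuous:
  fixes f ft :: "'a::euclidean_space \<Rightarrow> 'b::euclidean_space"
  assumes \<Omega>: "open \<Omega>" "x \<in> \<Omega>" and li: "locally_integrable \<Omega> f"
    and ft: "continuous_on \<Omega> ft" "AE z in lebesgue. z \<in> \<Omega> \<longrightarrow> ft z = f z"
  shows "has_star_value \<Omega> f x (ft x)"
  unfolding has_star_value_def
proof (intro conjI li tendstoI)
  fix e :: real assume e: "0 < e"
  have "isCont ft x" using ft(1) \<Omega> by (simp add: continuous_on_eq_continuous_at)
  then obtain d where d: "0 < d" "\<And>z. dist z x < d \<Longrightarrow> dist (ft z) (ft x) < e / 2"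
    using e unfolding continuous_at_eps_delta by (metis half_gt_zero)
  have "\<exists>r>0. cball x r \<subseteq> \<Omega>" using \<Omega> by (simp add: open_contains_cball)
  then obtain r where r: "0 < r" "cball x r \<subseteq> \<Omega>" by (elim exE conjE)
  have ir: "integrable (lebesgue_on (cball x r)) f" using li r(2) by (simp add: locally_integrable_def)
  have "0 < min d r" using d r by simp
  from eventually_at_right_real[OF this]
  show "\<forall>\<^sub>F \<delta> in at_right 0. dist ((1 / measure lebesgue (ball x \<delta> \<inter> \<Omega>)) *\<^sub>R integral\<^sup>L (lebesgue_on (ball x \<delta> \<inter> \<Omega>)) f) (ft x) < e"
  proof eventually_elim
    fix \<delta> assume "\<delta> \<in> {0<..<min d r}"
    then have \<delta>: "0 < \<delta>" "\<delta> < d" "\<delta> < r" by auto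
    let ?B = "ball x \<delta>"
    have sub: "?B \<subseteq> cball x r" using \<delta> by (auto simp: subset_iff)
    then have B: "?B \<inter> \<Omega> = ?B" "?B \<subseteq> \<Omega>" using r(2) by blast+
    have Bs: "?B \<in> sets lebesgue" "cball x r \<in> sets lebesgue" by (auto simp: borel_open borel_closed)
    have V: "0 < measure lebesgue ?B" using \<delta>(1) by simp
    have i: "integrable (lebesgue_on ?B) f" by (rule integrable_lebesgue_on_subset[OF ir sub Bs])
    have ic: "integrable (lebesgue_on ?B) (\<lambda>z. c)" for c :: "'c::{banach,second_countable_topology}"
      by (rule finite_measure.integrable_const[OF finite_measure_lebesgue_on[OF lmeasurable_ball]])
    have c: "(\<integral>z. c \<partial>lebesgue_on ?B) = measure lebesgue ?B *\<^sub>R c" for c :: "'c::{banach,second_countable_topology}"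
      using Bs by (simp add: measure_restrict_space)
    have "AE z in lebesgue. z \<in> ?B \<longrightarrow> norm (f z - ft x) \<le> e / 2"
      using ft(2)
    proof eventually_elim
      fix z assume a: "z \<in> \<Omega> \<longrightarrow> ft z = f z"
      show "z \<in> ?B \<longrightarrow> norm (f z - ft x) \<le> e / 2"
        using d(2)[of z] a B(2) \<delta> by (auto simp: dist_norm norm_minus_commute subset_iff)
    qed
    then have ae: "AE z in lebesgue_on ?B. norm (f z - ft x) \<le> e / 2" using Bs by (simp add: AE_restrict_space_iff)
    have "norm (\<integral>z. f z - ft x \<partial>lebesgue_on ?B) \<le> (\<integral>z. norm (f z - ft x) \<partial>lebesgue_on ?B)"
      by (rule integral_norm_bound)
    also have "\<dots> \<le> (\<integral>z. e / 2 \<partial>lebesgue_on ?B)"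
      by (rule Bochner_Integration.integral_mono_AE[OF integrable_norm[OF Bochner_Integration.integrable_diff[OF i ic]] ic ae])
    also have "\<dots> = measure lebesgue ?B * (e / 2)" using c[of "e / 2"] by simp
    finally have le: "norm (\<integral>z. f z - ft x \<partial>lebesgue_on ?B) \<le> measure lebesgue ?B * (e / 2)" .
    have "(\<integral>z. f z - ft x \<partial>lebesgue_on ?B) = integral\<^sup>L (lebesgue_on ?B) f - measure lebesgue ?B *\<^sub>R ft x"
      unfolding Bochner_Integration.integral_diff[OF i ic] c ..
    then have "(1 / measure lebesgue ?B) *\<^sub>R integral\<^sup>L (lebesgue_on ?B) f - ft x = (1 / measure lebesgue ?B) *\<^sub>R (\<integral>z. f z - ft x \<partial>lebesgue_on ?B)"
      using V by (simp add: scaleR_diff_right)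
    then have "dist ((1 / measure lebesgue ?B) *\<^sub>R integral\<^sup>L (lebesgue_on ?B) f) (ft x) = (1 / measure lebesgue ?B) * norm (\<integral>z. f z - ft x \<partial>lebesgue_on ?B)"
      by (simp add: dist_norm)
    also have "\<dots> \<le> (1 / measure lebesgue ?B) * (measure lebesgue ?B * (e / 2))"
      using le by (intro mult_left_mono) auto
    also have "\<dots> < e" using V e by simp
    finally show "dist ((1 / measure lebesgue (?B \<inter> \<Omega>)) *\<^sub>R integral\<^sup>L (lebesgue_on (?B \<inter> \<Omega>)) f) (ft x) < e"
      unfolding B(1) .
  qed
qed

lemma has_ess_lim_continuous:
  fixes f ft :: "'a::euclidean_space \<Rightarrow> 'b::euclidean_space"
  assumes \<Omega>: "open \<Omega>" "x \<in> \<Omega>" and li: "locally_integrable \<Omega> f"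
    and ft: "continuous_on \<Omega> ft" "AE z in lebesgue. z \<in> \<Omega> \<longrightarrow> ft z = f z"
  shows "has_ess_lim \<Omega> f x (ft x)"
  unfolding has_ess_lim_def
proof -
  have "\<exists>r>0. cball x r \<subseteq> \<Omega>" using \<Omega> by (simp add: open_contains_cball)
  then obtain r where r: "0 < r" "cball x r \<subseteq> \<Omega>" by (elim exE conjE)
  have ir: "integrable (lebesgue_on (cball x r)) f" using li r(2) by (simp add: locally_integrable_def)
  let ?s = "\<lambda>\<delta>. esssup (lebesgue_on (ball x \<delta> \<inter> \<Omega>)) (\<lambda>y. ereal (norm (f y - ft x)))"
  have m: "(\<lambda>y. ereal (norm (f y - ft x))) \<in> borel_measurable (lebesgue_on (ball x \<delta> \<inter> \<Omega>))" if "0 < \<delta>" "\<delta> < r" for \<delta>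
  proof -
    have sub: "ball x \<delta> \<subseteq> cball x r" using that by (auto simp: subset_iff)
    then have B: "ball x \<delta> \<inter> \<Omega> = ball x \<delta>" using r(2) by blast
    have "integrable (lebesgue_on (ball x \<delta>)) f"
      by (rule integrable_lebesgue_on_subset[OF ir sub]) (auto simp: borel_open borel_closed)
    then show ?thesis unfolding B by measurable
  qed
  \<comment> \<open>On a space of measure 0 an essential supremum would be minus infinity; the lower
    bound uses that balls have positive measure.\<close>
  have nn: "0 \<le> ?s \<delta>" if "0 < \<delta>" "\<delta> < r" for \<delta>
  proof -
    have sub: "ball x \<delta> \<subseteq> cball x r" using that by (auto simp: subset_iff)
    then have B: "ball x \<delta> \<inter> \<Omega> = ball x \<delta>" using r(2) by blast
    have "0 < measure lebesgue (ball x \<delta>)" using that by simp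
    then have "emeasure lebesgue (ball x \<delta>) \<noteq> 0" by (auto simp: measure_def)
    then have e: "emeasure (lebesgue_on (ball x \<delta> \<inter> \<Omega>)) (space (lebesgue_on (ball x \<delta> \<inter> \<Omega>))) \<noteq> 0"
      unfolding B by (simp add: space_restrict_space emeasure_restrict_space borel_open)
    have "(0::ereal) = esssup (lebesgue_on (ball x \<delta> \<inter> \<Omega>)) (\<lambda>_. 0)" by (rule esssup_const[OF e, symmetric])
    also have "\<dots> \<le> ?s \<delta>" by (rule esssup_mono) auto
    finally show ?thesis .
  qed
  show "(?s \<longlongrightarrow> 0) (at_right 0)"
  proof (rule order_tendstoI)
    fix a :: ereal assume "a < 0"
    show "\<forall>\<^sub>F \<delta> in at_right 0. a < ?s \<delta>"
      using eventually_at_right_real[OF r(1)] by eventually_elim (use nn \<open>a < 0\<close> less_le_trans in auto)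
  next
    fix a :: ereal assume "0 < a"
    then obtain e where e: "0 < ereal e" "ereal e < a" using ereal_dense2[of 0 a] by auto
    have "isCont ft x" using ft(1) \<Omega> by (simp add: continuous_on_eq_continuous_at)
    moreover have "0 < e" using e(1) by simp
    ultimately obtain d where d: "0 < d" "\<And>z. dist z x < d \<Longrightarrow> dist (ft z) (ft x) < e"
      unfolding continuous_at_eps_delta by metis
    have "0 < min d r" using d r by simp
    from eventually_at_right_real[OF this] show "\<forall>\<^sub>F \<delta> in at_right 0. ?s \<delta> < a"
    proof eventually_elim
      fix \<delta> assume "\<delta> \<in> {0<..<min d r}"
      then have \<delta>: "0 < \<delta>" "\<delta> < d" "\<delta> < r" by auto
      have Bs: "ball x \<delta> \<inter> \<Omega> \<in> sets lebesgue" using \<Omega> by (intro sets.Int) (auto simp: borel_open)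
      have "AE z in lebesgue. z \<in> ball x \<delta> \<inter> \<Omega> \<longrightarrow> ereal (norm (f z - ft x)) \<le> ereal e"
        using ft(2)
      proof eventually_elim
        fix z assume a: "z \<in> \<Omega> \<longrightarrow> ft z = f z"
        show "z \<in> ball x \<delta> \<inter> \<Omega> \<longrightarrow> ereal (norm (f z - ft x)) \<le> ereal e"
          using d(2)[of z] a \<delta> by (auto simp: dist_norm norm_minus_commute)
      qed
      then have "AE z in lebesgue_on (ball x \<delta> \<inter> \<Omega>). ereal (norm (f z - ft x)) \<le> ereal e" using Bs by (simp add: AE_restrict_space_iff)
      from esssup_I[OF m[OF \<delta>(1,3)] this] show "?s \<delta> < a" using e(2) by (rule le_less_trans)
    qed
  qed
qed

text \<open>Convergence of the means at \<open>x\<close> is all that is asked of the point; it need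
  not be a Lebesgue point of \<open>G\<close>.\<close>

lemma bounded_Ln_Dens_integral_vector:
  fixes G :: "'a::euclidean_space \<Rightarrow> 'b::euclidean_space"
  assumes \<Omega>: "open \<Omega>" "x \<in> \<Omega>" and \<mu>: "\<mu> \<in> Ln_Dens \<Omega> x" and d: "0 < d" and G: "in_Lp \<infinity> (ball x d \<inter> \<Omega>) G"
    and star: "has_star_value \<Omega> G x L"
  shows "has_ba_integral \<Omega> \<mu> G L"
  unfolding has_ba_integral_def
proof
  fix b :: 'b assume b: "b \<in> Basis"
  have "\<exists>r>0. cball x r \<subseteq> \<Omega>" using \<Omega> by (simp add: open_contains_cball)
  then obtain R where R: "0 < R" "cball x R \<subseteq> \<Omega>" by (elim exE conjE)
  have iR: "integrable (lebesgue_on (cball x R)) G" using star R(2) by (simp add: has_star_value_def locally_integrable_def)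
  let ?d = "min d R"
  have d': "0 < ?d" "ball x ?d \<subseteq> \<Omega>" "ball x ?d \<subseteq> ball x d \<inter> \<Omega>" using d R by (auto simp: subset_iff)
  obtain M where M: "0 < M" "AE z in lebesgue_on (ball x d \<inter> \<Omega>). norm (G z) \<le> M" by (rule in_Lp_bounded[OF G])
  have S: "ball x d \<inter> \<Omega> \<in> sets lebesgue" using \<Omega> by (intro sets.Int) (auto simp: borel_open)
  have sub: "ball x \<delta> \<subseteq> cball x R" "ball x \<delta> \<inter> \<Omega> = ball x \<delta>" if "\<delta> \<le> R" for \<delta> using that R(2) by (auto simp: subset_iff)
  have iB: "integrable (lebesgue_on (ball x \<delta>)) G" if "\<delta> \<le> R" for \<delta>
    by (rule integrable_lebesgue_on_subset[OF iR sub(1)[OF that]]) (auto simp: borel_open borel_closed)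
  show "has_ba_integral_real \<Omega> \<mu> (\<lambda>z. G z \<bullet> b) (L \<bullet> b)"
  proof (rule bounded_Ln_Dens_integral[OF \<Omega> \<mu> d'(1,2) _ _ _ M(1)])
    have "integrable (lebesgue_on (ball x ?d)) G" by (rule iB) simp
    then show "(\<lambda>z. G z \<bullet> b) \<in> borel_measurable (lebesgue_on (ball x ?d))" by measurable
    have "AE z in lebesgue. z \<in> ball x d \<inter> \<Omega> \<longrightarrow> norm (G z) \<le> M" using M(2) S by (simp add: AE_restrict_space_iff)
    then show "AE z in lebesgue. z \<in> ball x ?d \<longrightarrow> \<bar>G z \<bullet> b\<bar> \<le> M"
    proof eventually_elim
      fix z assume a: "z \<in> ball x d \<inter> \<Omega> \<longrightarrow> norm (G z) \<le> M"
      show "z \<in> ball x ?d \<longrightarrow> \<bar>G z \<bullet> b\<bar> \<le> M"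
        using Basis_le_norm[OF b, of "G z"] a d'(3) by (auto simp del: mem_ball)
    qed
    have "((\<lambda>\<delta>. ((1 / measure lebesgue (ball x \<delta> \<inter> \<Omega>)) *\<^sub>R integral\<^sup>L (lebesgue_on (ball x \<delta> \<inter> \<Omega>)) G) \<bullet> b) \<longlongrightarrow> L \<bullet> b) (at_right 0)"
      using star unfolding has_star_value_def by (intro tendsto_inner tendsto_const) simp
    then show "((\<lambda>\<delta>. (\<integral>z. G z \<bullet> b \<partial>lebesgue_on (ball x \<delta>)) / measure lebesgue (ball x \<delta>)) \<longlongrightarrow> L \<bullet> b) (at_right 0)"
    proof (rule Lim_transform_eventually)
      show "\<forall>\<^sub>F \<delta> in at_right 0. ((1 / measure lebesgue (ball x \<delta> \<inter> \<Omega>)) *\<^sub>R integral\<^sup>L (lebesgue_on (ball x \<delta> \<inter> \<Omega>)) G) \<bullet> b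
         = (\<integral>z. G z \<bullet> b \<partial>lebesgue_on (ball x \<delta>)) / measure lebesgue (ball x \<delta>)"
        using eventually_at_right_real[OF R(1)]
      proof eventually_elim
        fix \<delta> assume "\<delta> \<in> {0<..<R}"
        then have \<delta>: "\<delta> \<le> R" by simp
        have "(\<integral>z. G z \<bullet> b \<partial>lebesgue_on (ball x \<delta>)) = (\<integral>z. G z \<partial>lebesgue_on (ball x \<delta>)) \<bullet> b"
          using iB[OF \<delta>] by simp
        then show "((1 / measure lebesgue (ball x \<delta> \<inter> \<Omega>)) *\<^sub>R integral\<^sup>L (lebesgue_on (ball x \<delta> \<inter> \<Omega>)) G) \<bullet> b
         = (\<integral>z. G z \<bullet> b \<partial>lebesgue_on (ball x \<delta>)) / measure lebesgue (ball x \<delta>)"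
          unfolding sub(2)[OF \<delta>] by simp
      qed
    qed
  qed
qed

text \<open>The existence half of \<open>has_pr_value\<close> rests on
  \<open>Ln_Dens_nonempty\<close>; without it the universal statement could be vacuous.\<close>

lemma has_pr_valueI:
  assumes \<Omega>: "open \<Omega>" "x \<in> \<Omega>" and I: "\<And>\<mu>. \<mu> \<in> Ln_Dens \<Omega> x \<Longrightarrow> has_ba_integral \<Omega> \<mu> g \<beta>"
  shows "has_pr_value \<Omega> g x \<beta> \<and> (\<forall>\<mu>\<in>Ln_Dens \<Omega> x. ba_integrable \<Omega> \<mu> g \<and> ba_integral \<Omega> \<mu> g = \<beta>)"
proof -
  have "\<forall>\<mu>\<in>Ln_Dens \<Omega> x. ba_integrable \<Omega> \<mu> g \<and> ba_integral \<Omega> \<mu> g = \<beta>"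
  proof
    fix \<mu> assume \<mu>: "\<mu> \<in> Ln_Dens \<Omega> x"
    then have "pos_charge \<Omega> \<mu>" using Ln_Dens_subset_Dens[OF \<Omega>] Dens_pos_charge by blast
    then show "ba_integrable \<Omega> \<mu> g \<and> ba_integral \<Omega> \<mu> g = \<beta>"
      using \<Omega>(1) by (intro has_ba_integral_eq I \<mu>) auto
  qed
  moreover obtain \<mu> where "\<mu> \<in> Ln_Dens \<Omega> x" using Ln_Dens_nonempty[OF \<Omega>(1)] by blast
  ultimately show ?thesis unfolding has_pr_value_def by blast
qed

theorem proposition5p17:
  fixes \<Omega> :: "(real^'n) set" and f :: "real^'n \<Rightarrow> real^'m" and p :: ennreal
  assumes "open \<Omega>"
    and "of_nat CARD('n) < p" and "p \<le> \<infinity>"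
    and "in_W1p_loc p \<Omega> f"
  shows "\<Omega> - diff_points \<Omega> f \<in> null_sets lebesgue \<and>
    (\<forall>x\<in>diff_points \<Omega> f.
       has_precise_derivative \<Omega> f x (precise_derivative \<Omega> f x) \<and>
       (\<exists>\<beta>. has_pr_value \<Omega> f x \<beta> \<and> has_star_value \<Omega> f x \<beta> \<and> has_ess_lim \<Omega> f x \<beta> \<and>
            (\<forall>\<mu>\<in>Dens \<Omega> x. ba_integrable \<Omega> \<mu> f \<and> ba_integral \<Omega> \<mu> f = \<beta>)) \<and>
       has_star_value \<Omega> (precise_derivative \<Omega> f) x (precise_derivative \<Omega> f x)) \<and>
    (AE x in lebesgue_on \<Omega>. x \<in> diff_points \<Omega> f \<longrightarrow>
       has_pr_value \<Omega> (precise_derivative \<Omega> f) x (precise_derivative \<Omega> f x) \<and>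
       (\<forall>\<mu>\<in>Ln_Dens \<Omega> x. ba_integrable \<Omega> \<mu> (precise_derivative \<Omega> f) \<and>
          ba_integral \<Omega> \<mu> (precise_derivative \<Omega> f) = precise_derivative \<Omega> f x)) \<and>
    (\<forall>x\<in>diff_points \<Omega> f.
       (\<exists>\<delta>>0. in_Lp \<infinity> (ball x \<delta> \<inter> \<Omega>) (precise_derivative \<Omega> f)) \<longrightarrow>
       has_pr_value \<Omega> (precise_derivative \<Omega> f) x (precise_derivative \<Omega> f x) \<and>
       (\<forall>\<mu>\<in>Ln_Dens \<Omega> x. ba_integrable \<Omega> \<mu> (precise_derivative \<Omega> f) \<and>
          ba_integral \<Omega> \<mu> (precise_derivative \<Omega> f) = precise_derivative \<Omega> f x))"
proof -
  note \<Omega> = assms(1)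
  have Ob: "\<Omega> \<in> sets borel" "\<Omega> \<in> sets lebesgue" using \<Omega> by (simp_all add: borel_open)
  obtain G where G: "weak_derivative \<Omega> f G" "in_Lp_loc p \<Omega> G" using assms(4) unfolding in_W1p_loc_def by blast
  have li: "locally_integrable \<Omega> f" "locally_integrable \<Omega> G" using G(1) by (auto simp: weak_derivative_def)
  obtain q where q: "real CARD('n) < q" "\<And>K. compact K \<Longrightarrow> K \<subseteq> \<Omega> \<Longrightarrow> integrable (lebesgue_on K) (\<lambda>z. norm (G z) powr q)"
    using in_Lp_loc_real_exponent[OF assms(2) G(2)] by blast
  have q0: "0 < q" using q(1) of_nat_0_le_iff[of "CARD('n)"] by linarith
  obtain ft where ft: "continuous_on \<Omega> ft" "AE x in lebesgue. x \<in> \<Omega> \<longrightarrow> ft x = f x"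
    "\<And>x. x \<in> \<Omega> \<Longrightarrow> lebesgue_point q G x \<Longrightarrow> (ft has_derivative (\<lambda>h. G x *v h)) (at x)"
    using Sobolev_representative[OF \<Omega> G(1) q] by blast
  let ?D = "precise_derivative \<Omega> f"
  have Gm: "G \<in> borel_measurable (lebesgue_on K)" if "compact K" "K \<subseteq> \<Omega>" for K
    using li(2) that by (simp add: locally_integrable_def borel_measurable_integrable)
  have lp: "AE x in lebesgue. x \<in> \<Omega> \<longrightarrow> lebesgue_point q G x"
    by (rule AE_lebesgue_point[OF \<Omega> q0 Gm q(2)])
  have ftf: "AE x in lebesgue. x \<in> \<Omega> \<longrightarrow> ft x = ft x" by simp
  have Dens: "ba_integrable \<Omega> \<mu> f \<and> ba_integral \<Omega> \<mu> f = ft y" if "y \<in> \<Omega>" "\<mu> \<in> Dens \<Omega> y" for y \<mu>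
    by (rule has_ba_integral_eq[OF Dens_pos_charge[OF that(2)] Ob(1) Dens_integral_continuous[OF that(2) \<Omega> that(1) ft(1,2)]])
  have diff1: "\<exists>L. (ft has_derivative (\<lambda>h. L *v h)) (at x)" if x: "x \<in> diff_points \<Omega> f" for x
  proof -
    obtain g \<alpha> L where g: "x \<in> \<Omega>" "AE y in lebesgue_on \<Omega>. g y = f y" "first_order_expansion \<Omega> g x \<alpha> L"
      using x unfolding diff_points_def by blast
    have "AE y in lebesgue. y \<in> \<Omega> \<longrightarrow> g y = f y" using g(2) Ob(2) by (simp add: AE_restrict_space_iff)
    with ft(2) have "AE y in lebesgue. y \<in> \<Omega> \<longrightarrow> ft y = g y" by eventually_elim simp
    from first_order_expansion_imp_derivative[OF \<Omega> g(1) ft(1) this g(3)] show ?thesis by blast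
  qed
  have diff2: "x \<in> diff_points \<Omega> f" if x: "x \<in> \<Omega>" and L: "(ft has_derivative (\<lambda>h. L *v h)) (at x)" for x L
  proof -
    have "AE y in lebesgue_on \<Omega>. ft y = f y" using ft(2) Ob(2) by (simp add: AE_restrict_space_iff)
    then show ?thesis unfolding diff_points_def using x derivative_imp_first_order_expansion[OF L] by blast
  qed
  have prec: "has_precise_derivative \<Omega> f x L" if x: "x \<in> \<Omega>" and L: "(ft has_derivative (\<lambda>h. L *v h)) (at x)" for x L
  proof -
    \<comment> \<open>Any selection will do: each density measure at \<open>y\<close> integrates
      \<open>f\<close> to \<open>ft y\<close>.\<close>
    define d where "d y = (SOME \<mu>. \<mu> \<in> Ln_Dens \<Omega> y)" for y
    have d: "d y \<in> Ln_Dens \<Omega> y" for y unfolding d_def using Ln_Dens_nonempty[OF \<Omega>] by (simp add: some_in_eq)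
    have ds: "ba_integrable \<Omega> (d y) f \<and> ba_integral \<Omega> (d y) f = ft y" if "y \<in> \<Omega>" for y
      using Dens[OF that] d Ln_Dens_subset_Dens[OF \<Omega> that] by blast
    have "first_order_expansion \<Omega> (\<lambda>y. ba_integral \<Omega> (d y) f) x (ft x) L"
      unfolding first_order_expansion_def
    proof (rule Lim_transform_eventually[OF derivative_imp_first_order_expansion[OF L, of \<Omega>, unfolded first_order_expansion_def]])
      show "\<forall>\<^sub>F y in at x within \<Omega>. (ft y - ft x - L *v (y - x)) /\<^sub>R norm (y - x) = (ba_integral \<Omega> (d y) f - ft x - L *v (y - x)) /\<^sub>R norm (y - x)"
        unfolding eventually_at_filter using ds by (intro always_eventually) simp
    qed
    then show ?thesis unfolding has_precise_derivative_def using d ds by (intro exI[of _ 1] conjI exI[of _ d] exI[of _ "ft x"]) auto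
  qed
  \<comment> \<open>Whatever selection witnesses the precise derivative, its integrals coincide with
    \<open>ft\<close> near \<open>x\<close>. This gives the uniqueness behind the definite
    description.\<close>
  have prec': "(ft has_derivative (\<lambda>h. L *v h)) (at x)" if x: "x \<in> \<Omega>" and L: "has_precise_derivative \<Omega> f x L" for x L
  proof -
    obtain r d \<alpha> where r: "0 < r" "\<forall>y\<in>ball x r \<inter> \<Omega>. d y \<in> Ln_Dens \<Omega> y \<and> ba_integrable \<Omega> (d y) f"
      "first_order_expansion \<Omega> (\<lambda>y. ba_integral \<Omega> (d y) f) x \<alpha> L"
      using L unfolding has_precise_derivative_def by blast
    have eq: "ba_integral \<Omega> (d y) f = ft y" if "y \<in> ball x r \<inter> \<Omega>" for y
      using Dens[of y "d y"] r(2) that Ln_Dens_subset_Dens[OF \<Omega>, of y] by blast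
    have "first_order_expansion \<Omega> ft x \<alpha> L"
      unfolding first_order_expansion_def
    proof (rule Lim_transform_eventually[OF r(3)[unfolded first_order_expansion_def]])
      show "\<forall>\<^sub>F y in at x within \<Omega>. (ba_integral \<Omega> (d y) f - \<alpha> - L *v (y - x)) /\<^sub>R norm (y - x) = (ft y - \<alpha> - L *v (y - x)) /\<^sub>R norm (y - x)"
        unfolding eventually_at using r(1) eq by (intro exI[of _ r]) (auto simp: dist_commute)
    qed
    then show ?thesis by (rule first_order_expansion_imp_derivative[OF \<Omega> x ft(1) ftf])
  qed
  have D: "?D x = L" if x: "x \<in> \<Omega>" and L: "(ft has_derivative (\<lambda>h. L *v h)) (at x)" for x L
    unfolding precise_derivative_def
  proof (rule the_equality)
    show "has_precise_derivative \<Omega> f x L" by (rule prec[OF x L])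
    fix L' assume "has_precise_derivative \<Omega> f x L'"
    from has_derivative_unique[OF prec'[OF x this] L] show "L' = L" by (simp add: matrix_eq fun_eq_iff)
  qed
  have inO: "x \<in> \<Omega>" if "x \<in> diff_points \<Omega> f" for x using that by (simp add: diff_points_def)
  have DD: "(ft has_derivative (\<lambda>h. ?D x *v h)) (at x)" if "x \<in> diff_points \<Omega> f" for x
    using diff1[OF that] D[OF inO[OF that]] by auto
  \<comment> \<open>Ties the pointwise defined \<open>?D\<close> to the class of the weak
    derivative; off the points of differentiability \<open>?D\<close> is an arbitrary value, on a
    null set only.\<close>
  have "?D x = G x" if "x \<in> \<Omega>" "lebesgue_point q G x" for x by (rule D[OF that(1) ft(3)[OF that]])
  then have DG: "AE x in lebesgue. x \<in> \<Omega> \<longrightarrow> G x = ?D x" using lp by (auto elim!: eventually_mono)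
  have GD: "AE x in lebesgue. x \<in> \<Omega> \<longrightarrow> ?D x = G x" using DG by eventually_elim simp
  \<comment> \<open>Now \<open>?D\<close> itself may be averaged, and its means converge at every
    point of differentiability.\<close>
  have wD: "weak_derivative \<Omega> f ?D" by (rule weak_derivative_AE[OF \<Omega> G(1) DG])
  have star: "has_star_value \<Omega> ?D x (?D x)" if "x \<in> diff_points \<Omega> f" for x
    by (rule has_star_value_weak_derivative[OF \<Omega> wD inO[OF that] ft(2) DD[OF that]])
  have c1: "\<Omega> - diff_points \<Omega> f \<in> null_sets lebesgue"
  proof -
    have "AE x in lebesgue. x \<in> \<Omega> \<longrightarrow> x \<in> diff_points \<Omega> f" using lp by eventually_elim (use diff2 ft(3) in blast)
    then obtain N where N: "N \<in> null_sets lebesgue" "{x. \<not> (x \<in> \<Omega> \<longrightarrow> x \<in> diff_points \<Omega> f)} \<subseteq> N"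
      by (auto simp: eventually_ae_filter)
    have "negligible N" using N(1) by (simp add: negligible_iff_null_sets)
    then have "negligible (\<Omega> - diff_points \<Omega> f)" by (rule negligible_subset) (use N(2) in blast)
    then show ?thesis by (simp add: negligible_iff_null_sets)
  qed
  have c2: "has_precise_derivative \<Omega> f x (?D x) \<and>
       (\<exists>\<beta>. has_pr_value \<Omega> f x \<beta> \<and> has_star_value \<Omega> f x \<beta> \<and> has_ess_lim \<Omega> f x \<beta> \<and>
            (\<forall>\<mu>\<in>Dens \<Omega> x. ba_integrable \<Omega> \<mu> f \<and> ba_integral \<Omega> \<mu> f = \<beta>)) \<and>
       has_star_value \<Omega> ?D x (?D x)" if x: "x \<in> diff_points \<Omega> f" for x
  proof (intro conjI exI[of _ "ft x"] ballI)
    note xO = inO[OF x]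
    show "has_precise_derivative \<Omega> f x (?D x)" by (rule prec[OF xO DD[OF x]])
    show "has_star_value \<Omega> ?D x (?D x)" by (rule star[OF x])
    show "has_star_value \<Omega> f x (ft x)" by (rule has_star_value_continuous[OF \<Omega> xO li(1) ft(1,2)])
    show "has_ess_lim \<Omega> f x (ft x)" by (rule has_ess_lim_continuous[OF \<Omega> xO li(1) ft(1,2)])
    show "ba_integrable \<Omega> \<mu> f" "ba_integral \<Omega> \<mu> f = ft x" if "\<mu> \<in> Dens \<Omega> x" for \<mu> using Dens[OF xO that] by auto
    have "has_ba_integral \<Omega> \<mu> f (ft x)" if "\<mu> \<in> Ln_Dens \<Omega> x" for \<mu>
      using Ln_Dens_subset_Dens[OF \<Omega> xO] that by (intro Dens_integral_continuous[OF _ \<Omega> xO ft(1,2)]) blast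
    then show "has_pr_value \<Omega> f x (ft x)" using has_pr_valueI[OF \<Omega> xO] by blast
  qed
  let ?C = "\<lambda>x. has_pr_value \<Omega> ?D x (?D x) \<and> (\<forall>\<mu>\<in>Ln_Dens \<Omega> x. ba_integrable \<Omega> \<mu> ?D \<and> ba_integral \<Omega> \<mu> ?D = ?D x)"
  have "AE x in lebesgue. x \<in> \<Omega> \<longrightarrow> x \<in> diff_points \<Omega> f \<longrightarrow> ?C x"
    using lp GD
  proof eventually_elim
    fix x assume a: "x \<in> \<Omega> \<longrightarrow> lebesgue_point q G x" "x \<in> \<Omega> \<longrightarrow> ?D x = G x"
    show "x \<in> \<Omega> \<longrightarrow> x \<in> diff_points \<Omega> f \<longrightarrow> ?C x"
    proof (intro impI)
      assume x: "x \<in> \<Omega>"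
      then have "lebesgue_point q G x" "?D x = G x" using a by auto
      then show "?C x"
        using Ln_Dens_integral_lebesgue_point[OF _ \<Omega> x _ q0 Gm q(2) GD] by (intro has_pr_valueI[OF \<Omega> x]) simp
    qed
  qed
  then have c3: "AE x in lebesgue_on \<Omega>. x \<in> diff_points \<Omega> f \<longrightarrow> ?C x" using Ob(2) by (simp add: AE_restrict_space_iff)
  \<comment> \<open>The value of the integral is the limit of means from \<open>star\<close>, which
    is available at all these points.\<close>
  have c4: "?C x" if x: "x \<in> diff_points \<Omega> f" "\<exists>\<delta>>0. in_Lp \<infinity> (ball x \<delta> \<inter> \<Omega>) ?D" for x
  proof -
    obtain \<delta> where \<delta>: "0 < \<delta>" "in_Lp \<infinity> (ball x \<delta> \<inter> \<Omega>) ?D" using x(2) by blast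
    show ?thesis
      by (rule has_pr_valueI[OF \<Omega> inO[OF x(1)]]) (rule bounded_Ln_Dens_integral_vector[OF \<Omega> inO[OF x(1)] _ \<delta> star[OF x(1)]])
  qed
  from c1 c2 c3 c4 show ?thesis by blast
qed

end
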